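(* Consider the MIMO Gaussian channel with noiseless feedback $\mathbf y_i=\Lambda\mathbf x_i+\mathbf z_i$ with state-space noise, under the standing assumptions listed in the context. The feedback capacity is upper bounded by the convex optimization $$C_{fb}(P)\le\max_{\Pi,\hat\Sigma,\Gamma}\ \tfrac12\log\det(\Psi_Y)-\tfrac12\log\det(\Psi)$$ subject to $$\begin{pmatrix}\Pi&\Gamma\\ \Gamma^T&\hat\Sigma\end{pmatrix}\succeq0,\qquad \mathrm{Tr}(\Pi)\le P,$$ $$\Psi_Y=\Lambda\Pi\Lambda^T+H\hat\Sigma H^T+\Lambda\Gamma H^T+H\Gamma^T\Lambda^T+\Psi,$$ $$K_Y=(F\Gamma^T\Lambda^T+F\hat\Sigma H^T+K_p\Psi)\Psi_Y^{-1},$$ $$\begin{pmatrix}F\hat\Sigma F^T+K_p\Psi K_p^T-\hat\Sigma&K_Y\Psi_Y\\ \Psi_YK_Y^T&\Psi_Y\end{pmatrix}\succeq0,$$ where $\Pi\in\mathbb R^{m\times m}$, $\hat\Sigma\in\mathbb R^{d\times d}$ (symmetric) and $\Gamma\in\mathbb R^{m\times d}$.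
   Context: Channel: $\mathbf y_i=\Lambda\mathbf x_i+\mathbf z_i$, $i=1,2,\dots$, with input $\mathbf x_i\in\mathbb R^m$, output $\mathbf y_i\in\mathbb R^p$, known matrix $\Lambda\in\mathbb R^{p\times m}$. Noise: $\mathbf s_{i+1}=F\mathbf s_i+G\mathbf w_i$, $\mathbf z_i=H\mathbf s_i+\mathbf v_i$, with hidden state $\mathbf s_i\in\mathbb R^d$, where $(\mathbf w_i,\mathbf v_i)$ is an i.i.d. jointly Gaussian zero-mean sequence with $\mathrm{cov}(\mathbf w_i)=W$, $\mathrm{cov}(\mathbf v_i)=V$, $\mathbb E[\mathbf w_i\mathbf v_i^T]=L$, independent of $\mathbf s_1\sim N(0,\Sigma_1)$. Coding: for blocklength $n$ and rate $R$, a message $m$ uniform on $\{1,\dots,2^{nR}\}$ (independent of the noise) is encoded with strictly causal noiseless feedback, $\mathbf x_i=f_i(m,\mathbf y^{i-1})$ where $\mathbf y^{i-1}=(\mathbf y_1,\dots,\mathbf y_{i-1})$, subject to $\frac1n\sum_{i=1}^n\mathbb E[\mathbf x_i^T\mathbf x_i]\le P$; the decoder outputs $\hat m(\mathbf y^n)$. $R$ is achievable if there are codes with $\Pr(\hat m\ne m)\to0$ as $n\to\infty$; $C_{fb}(P)$ is the supremum of achievable rates (logarithms in base 2). Noise Riccati recursion: $\Sigma_{i+1}=F\Sigma_iF^T+GWG^T-K_{p,i}\Psi_iK_{p,i}^T$, $K_{p,i}=(F\Sigma_iH^T+GL)\Psi_i^{-1}$, $\Psi_i=H\Sigma_iH^T+V$,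 started at $\Sigma_1$. The Riccati equation is $\Sigma=F\Sigma F^T+GWG^T-K_p\Psi K_p^T$ with $K_p=(F\Sigma H^T+GL)\Psi^{-1}$, $\Psi=H\Sigma H^T+V$; its stabilizing solution is the unique solution with $\rho(F-K_pH)<1$ ($\rho$ = spectral radius). $K_p,\Psi$ denote the constants evaluated at the stabilizing solution. Standing assumptions: $\Psi_i\succ0$ for all $i$; $V$ is invertible; (1) $(F,H)$ is detectable, i.e. there is $K$ with $\rho(F-KH)<1$; (2) with $F_s=F-GLV^{-1}H$ and $W_s=GWG^T-GLV^{-1}L^TG^T$, the pair $(F_s,W_s)$ is controllable on the unit circle: whenever $xF_s=\lambda x$ with row vector $x\neq0$ and $|\lambda|=1$, then $xW_s^{1/2}\ne0$; (3) the recursion $\Sigma_i$ started from $\Sigma_1$ converges to the stabilizing solution $\Sigma$. *)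

theory Defs
  imports "HOL-Probability.Probability"
begin

section \<open>Matrices\<close>

text \<open>An \<open>r \<times> c\<close> real matrix has type \<open>real^'c^'r\<close>.\<close>

definition psd :: "real^'n^'n \<Rightarrow> bool" where
  "psd A \<longleftrightarrow> transpose A = A \<and> (\<forall>x. 0 \<le> x \<bullet> (A *v x))"

definition pos_def :: "real^'n^'n \<Rightarrow> bool" where
  "pos_def A \<longleftrightarrow> transpose A = A \<and> (\<forall>x. x \<noteq> 0 \<longrightarrow> 0 < x \<bullet> (A *v x))"

definition psd_sqrt :: "real^'n^'n \<Rightarrow> real^'n^'n" where
  "psd_sqrt A = (THE S. psd S \<and> S ** S = A)"

definition block_mat ::
    "'a^'n^'m \<Rightarrow> 'a^'k^'m \<Rightarrow> 'a^'n^'l \<Rightarrow> 'a^'k^'l \<Rightarrow> 'a^('n + 'k)^('m + 'l)" where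
  "block_mat A B C D =
     (\<chi> i j. case i of
        Inl a \<Rightarrow> (case j of Inl b \<Rightarrow> A $ a $ b | Inr b \<Rightarrow> B $ a $ b)
      | Inr a \<Rightarrow> (case j of Inl b \<Rightarrow> C $ a $ b | Inr b \<Rightarrow> D $ a $ b))"

definition complex_mat :: "real^'n^'m \<Rightarrow> complex^'n^'m" where
  "complex_mat A = map_matrix complex_of_real A"

definition spectral_radius :: "real^'n^'n \<Rightarrow> real" where
  "spectral_radius A = Max {cmod k | k. \<exists>x. x \<noteq> 0 \<and> complex_mat A *v x = k *s x}"

definition detectable :: "real^'d^'d \<Rightarrow> real^'d^'p \<Rightarrow> bool" where
  "detectable F H \<longleftrightarrow> (\<exists>K :: real^'p^'d. spectral_radius (F - K ** H) < 1)"

definition unit_circle_controllable :: "real^'d^'d \<Rightarrow> real^'d^'d \<Rightarrow> bool" where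
  "unit_circle_controllable F W \<longleftrightarrow>
     (\<forall>k x. x \<noteq> 0 \<longrightarrow> cmod k = 1 \<longrightarrow> x v* complex_mat F = k *s x \<longrightarrow>
        x v* complex_mat (psd_sqrt W) \<noteq> 0)"

section \<open>The noise Riccati recursion\<close>

definition innov_cov :: "real^'d^'p \<Rightarrow> real^'p^'p \<Rightarrow> real^'d^'d \<Rightarrow> real^'p^'p" where
  "innov_cov H V S = H ** S ** transpose H + V"

definition predictor_gain ::
    "real^'d^'d \<Rightarrow> real^'q^'d \<Rightarrow> real^'d^'p \<Rightarrow> real^'p^'p \<Rightarrow> real^'p^'q \<Rightarrow> real^'d^'d \<Rightarrow> real^'p^'d" where
  "predictor_gain F G H V L S =
     (F ** S ** transpose H + G ** L) ** matrix_inv (innov_cov H V S)"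

definition riccati_step ::
    "real^'d^'d \<Rightarrow> real^'q^'d \<Rightarrow> real^'d^'p \<Rightarrow> real^'q^'q \<Rightarrow> real^'p^'p \<Rightarrow> real^'p^'q
     \<Rightarrow> real^'d^'d \<Rightarrow> real^'d^'d" where
  "riccati_step F G H W V L S =
     F ** S ** transpose F + G ** W ** transpose G
     - predictor_gain F G H V L S ** innov_cov H V S ** transpose (predictor_gain F G H V L S)"

text \<open>Time starts at 0: index \<open>i\<close> stands for time \<open>i + 1\<close> in the usual one-based indexing.\<close>

primrec riccati_seq ::
    "real^'d^'d \<Rightarrow> real^'q^'d \<Rightarrow> real^'d^'p \<Rightarrow> real^'q^'q \<Rightarrow> real^'p^'p \<Rightarrow> real^'p^'q
     \<Rightarrow> real^'d^'d \<Rightarrow> nat \<Rightarrow> real^'d^'d" where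
  "riccati_seq F G H W V L S0 0 = S0"
| "riccati_seq F G H W V L S0 (Suc i) = riccati_step F G H W V L (riccati_seq F G H W V L S0 i)"

definition stabilizing_solution ::
    "real^'d^'d \<Rightarrow> real^'q^'d \<Rightarrow> real^'d^'p \<Rightarrow> real^'q^'q \<Rightarrow> real^'p^'p \<Rightarrow> real^'p^'q
     \<Rightarrow> real^'d^'d \<Rightarrow> bool" where
  "stabilizing_solution F G H W V L S \<longleftrightarrow>
     transpose S = S \<and> invertible (innov_cov H V S) \<and>
     S = riccati_step F G H W V L S \<and>
     spectral_radius (F - predictor_gain F G H V L S ** H) < 1"

section \<open>Random vectors\<close>

text \<open>Standard deviation 0 is the point mass; \<^const>\<open>normal_density\<close> does not cover this case.
  A Gaussian vector may thus have a singular covariance matrix.\<close>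

definition gaussian_measure :: "real \<Rightarrow> real \<Rightarrow> real measure" where
  "gaussian_measure \<mu> \<sigma> =
     (if \<sigma> = 0 then return borel \<mu> else density lborel (\<lambda>x. ennreal (normal_density \<mu> \<sigma> x)))"

definition gaussian_vector :: "'a measure \<Rightarrow> ('a \<Rightarrow> 'b::euclidean_space) \<Rightarrow> bool" where
  "gaussian_vector M X \<longleftrightarrow>
     X \<in> borel_measurable M \<and>
     (\<forall>a. \<exists>\<mu> \<sigma>. 0 \<le> \<sigma> \<and> distr M borel (\<lambda>\<omega>. a \<bullet> X \<omega>) = gaussian_measure \<mu> \<sigma>)"

definition cross_moment :: "'a measure \<Rightarrow> ('a \<Rightarrow> real^'n) \<Rightarrow> ('a \<Rightarrow> real^'k) \<Rightarrow> real^'k^'n" where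
  "cross_moment M X Y = (\<chi> i j. \<integral>\<omega>. X \<omega> $ i * Y \<omega> $ j \<partial>M)"

definition cov_matrix :: "'a measure \<Rightarrow> ('a \<Rightarrow> real^'n) \<Rightarrow> real^'n^'n" where
  "cov_matrix M X =
     cross_moment M (\<lambda>\<omega>. X \<omega> - integral\<^sup>L M X) (\<lambda>\<omega>. X \<omega> - integral\<^sup>L M X)"

definition iid :: "'a measure \<Rightarrow> (nat \<Rightarrow> 'a \<Rightarrow> 'b::topological_space) \<Rightarrow> bool" where
  "iid M X \<longleftrightarrow>
     prob_space.indep_vars M (\<lambda>_. borel) X UNIV \<and>
     (\<forall>i j. distr M borel (X i) = distr M borel (X j))"

text \<open>\<^const>\<open>prob_space.indep_var\<close> requires both variables to have the same value type.\<close>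

definition indep_rv :: "'a measure \<Rightarrow> 'b measure \<Rightarrow> ('a \<Rightarrow> 'b) \<Rightarrow> 'c measure \<Rightarrow> ('a \<Rightarrow> 'c) \<Rightarrow> bool" where
  "indep_rv M N X N' Y \<longleftrightarrow>
     X \<in> measurable M N \<and> Y \<in> measurable M N' \<and>
     prob_space.indep_set M {X -` A \<inter> space M | A. A \<in> sets N} {Y -` B \<inter> space M | B. B \<in> sets N'}"

section \<open>Feedback coding over the channel\<close>

text \<open>An encoder \<open>f\<close> gives the input \<open>f m i h\<close> at time \<open>i\<close> for message \<open>m\<close> and past outputs
  \<open>h\<close>, where \<open>h\<close> lives in the product space over the time indices \<open>{..<i}\<close>.
  For a noise path \<open>z\<close>, \<open>outputs \<Lambda> f z i\<close> consists of the outputs at times \<open>{..<i}\<close>.\<close>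

primrec outputs ::
    "real^'m^'p \<Rightarrow> (nat \<Rightarrow> (nat \<Rightarrow> real^'p) \<Rightarrow> real^'m) \<Rightarrow> (nat \<Rightarrow> real^'p) \<Rightarrow> nat \<Rightarrow> (nat \<Rightarrow> real^'p)" where
  "outputs \<Lambda> f z 0 = (\<lambda>_. undefined)"
| "outputs \<Lambda> f z (Suc i) = (outputs \<Lambda> f z i)(i := \<Lambda> *v f i (outputs \<Lambda> f z i) + z i)"

definition channel_input ::
    "real^'m^'p \<Rightarrow> (nat \<Rightarrow> (nat \<Rightarrow> real^'p) \<Rightarrow> real^'m) \<Rightarrow> (nat \<Rightarrow> real^'p) \<Rightarrow> nat \<Rightarrow> real^'m" where
  "channel_input \<Lambda> f z i = f i (outputs \<Lambda> f z i)"

text \<open>The message is uniform on \<open>{1..N}\<close> and independent of the noise, hence the product measure.\<close>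

definition message_noise_space :: "nat \<Rightarrow> 'a measure \<Rightarrow> (nat \<times> 'a) measure" where
  "message_noise_space N M = uniform_count_measure {1..N} \<Otimes>\<^sub>M M"

definition feedback_code ::
    "'a measure \<Rightarrow> real^'m^'p \<Rightarrow> (nat \<Rightarrow> 'a \<Rightarrow> real^'p) \<Rightarrow> real \<Rightarrow> nat \<Rightarrow> nat
     \<Rightarrow> (nat \<Rightarrow> nat \<Rightarrow> (nat \<Rightarrow> real^'p) \<Rightarrow> real^'m) \<Rightarrow> ((nat \<Rightarrow> real^'p) \<Rightarrow> nat) \<Rightarrow> bool" where
  "feedback_code M \<Lambda> z P n N f g \<longleftrightarrow>
     (\<forall>m\<in>{1..N}. \<forall>i<n. f m i \<in> measurable (Pi\<^sub>M {..<i} (\<lambda>_. borel)) borel) \<and>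
     g \<in> measurable (Pi\<^sub>M {..<n} (\<lambda>_. borel)) (count_space UNIV) \<and>
     (\<Sum>i<n. \<integral>\<^sup>+ (m, \<omega>). ennreal (let x = channel_input \<Lambda> (f m) (\<lambda>t. z t \<omega>) i in x \<bullet> x)
        \<partial>message_noise_space N M) / of_nat n \<le> ennreal P"

definition error_prob ::
    "'a measure \<Rightarrow> real^'m^'p \<Rightarrow> (nat \<Rightarrow> 'a \<Rightarrow> real^'p) \<Rightarrow> nat \<Rightarrow> nat
     \<Rightarrow> (nat \<Rightarrow> nat \<Rightarrow> (nat \<Rightarrow> real^'p) \<Rightarrow> real^'m) \<Rightarrow> ((nat \<Rightarrow> real^'p) \<Rightarrow> nat) \<Rightarrow> real" where
  "error_prob M \<Lambda> z n N f g =
     measure (message_noise_space N M)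
       {(m, \<omega>) \<in> space (message_noise_space N M). g (outputs \<Lambda> (f m) (\<lambda>t. z t \<omega>) n) \<noteq> m}"

text \<open>\<open>2\<^sup>n\<^sup>R\<close> is rounded up to an integer number of messages.\<close>

definition num_messages :: "nat \<Rightarrow> real \<Rightarrow> nat" where
  "num_messages n R = nat \<lceil>2 powr (real n * R)\<rceil>"

definition achievable ::
    "'a measure \<Rightarrow> real^'m^'p \<Rightarrow> (nat \<Rightarrow> 'a \<Rightarrow> real^'p) \<Rightarrow> real \<Rightarrow> real \<Rightarrow> bool" where
  "achievable M \<Lambda> z P R \<longleftrightarrow> 0 \<le> R \<and>
     (\<exists>f g. (\<forall>n\<ge>1. feedback_code M \<Lambda> z P n (num_messages n R) (f n) (g n)) \<and>
            (\<lambda>n. error_prob M \<Lambda> z n (num_messages n R) (f n) (g n)) \<longlonglongrightarrow> 0)"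

text \<open>The supremum is taken in the extended reals, so that an upper bound on it entails that the
  set of achievable rates is bounded.\<close>

definition feedback_capacity ::
    "'a measure \<Rightarrow> real^'m^'p \<Rightarrow> (nat \<Rightarrow> 'a \<Rightarrow> real^'p) \<Rightarrow> real \<Rightarrow> ereal" where
  "feedback_capacity M \<Lambda> z P = (SUP R \<in> {R. achievable M \<Lambda> z P R}. ereal R)"

section \<open>The optimization problem\<close>

text \<open>The decision variable is a triple \<open>(\<Pi>, S, \<Gamma>)\<close>, where \<open>S\<close> stands for the hatted Sigma.
  The parameters \<open>Kp\<close> and \<open>\<Psi>\<close> are the constants of the noise Riccati equation.\<close>

definition Psi_Y ::
    "real^'m^'p \<Rightarrow> real^'d^'p \<Rightarrow> real^'p^'p \<Rightarrow> (real^'m^'m) \<times> (real^'d^'d) \<times> (real^'d^'m) \<Rightarrow> real^'p^'p" where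
  "Psi_Y \<Lambda> H \<Psi> = (\<lambda>(\<Pi>\<^sub>x, S, \<Gamma>).
     \<Lambda> ** \<Pi>\<^sub>x ** transpose \<Lambda> + H ** S ** transpose H
     + \<Lambda> ** \<Gamma> ** transpose H + H ** transpose \<Gamma> ** transpose \<Lambda> + \<Psi>)"

definition K_Y ::
    "real^'m^'p \<Rightarrow> real^'d^'d \<Rightarrow> real^'d^'p \<Rightarrow> real^'p^'d \<Rightarrow> real^'p^'p
     \<Rightarrow> (real^'m^'m) \<times> (real^'d^'d) \<times> (real^'d^'m) \<Rightarrow> real^'p^'d" where
  "K_Y \<Lambda> F H Kp \<Psi> = (\<lambda>(\<Pi>\<^sub>x, S, \<Gamma>).
     (F ** transpose \<Gamma> ** transpose \<Lambda> + F ** S ** transpose H + Kp ** \<Psi>)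
     ** matrix_inv (Psi_Y \<Lambda> H \<Psi> (\<Pi>\<^sub>x, S, \<Gamma>)))"

definition feasible_set ::
    "real^'m^'p \<Rightarrow> real^'d^'d \<Rightarrow> real^'d^'p \<Rightarrow> real^'p^'d \<Rightarrow> real^'p^'p \<Rightarrow> real
     \<Rightarrow> ((real^'m^'m) \<times> (real^'d^'d) \<times> (real^'d^'m)) set" where
  "feasible_set \<Lambda> F H Kp \<Psi> P =
     {(\<Pi>\<^sub>x, S, \<Gamma>).
        psd (block_mat \<Pi>\<^sub>x \<Gamma> (transpose \<Gamma>) S) \<and>
        trace \<Pi>\<^sub>x \<le> P \<and>
        (let PY = Psi_Y \<Lambda> H \<Psi> (\<Pi>\<^sub>x, S, \<Gamma>); KY = K_Y \<Lambda> F H Kp \<Psi> (\<Pi>\<^sub>x, S, \<Gamma>)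
         in psd (block_mat (F ** S ** transpose F + Kp ** \<Psi> ** transpose Kp - S) (KY ** PY)
                           (PY ** transpose KY) PY))}"

definition objective ::
    "real^'m^'p \<Rightarrow> real^'d^'p \<Rightarrow> real^'p^'p \<Rightarrow> (real^'m^'m) \<times> (real^'d^'d) \<times> (real^'d^'m) \<Rightarrow> real" where
  "objective \<Lambda> H \<Psi> q = 1 / 2 * log 2 (det (Psi_Y \<Lambda> H \<Psi> q)) - 1 / 2 * log 2 (det \<Psi>)"

end

theory Submission
  imports Defs "HOL-Computational_Algebra.Fundamental_Theorem_Algebra"
begin

text \<open>Given the message, the channel output is a causal function of the innovations \<open>e\<^sub>i\<close> of the
  noise, which are independent with law \<open>N(0, \<Psi>\<^sub>i)\<close>. Let the receiver track the predicted noise state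
  with error \<open>d\<^sub>i\<close> by the linear recursion whose gain is the regression coefficient of the next error
  on \<open>\<epsilon>\<^sub>i = \<Lambda>x\<^sub>i + Hd\<^sub>i + e\<^sub>i\<close>. The outputs and the \<open>\<epsilon>\<^sub>i\<close> determine each other without knowledge of the
  message, so comparing the true law of the \<open>\<epsilon>\<^sub>i\<close> with the product of the \<open>N(0, \<Psi>\<^sub>Y\<^sub>,\<^sub>i)\<close> bounds the
  rate by the average of \<open>1/2 log det \<Psi>\<^sub>Y\<^sub>,\<^sub>i - 1/2 log det \<Psi>\<^sub>i\<close>; no optimality of the tracking is needed.
  The second moments of \<open>(x\<^sub>i, d\<^sub>i)\<close> satisfy the matrix inequality with the covariance of \<open>d\<^sub>i\<^sub>+\<^sub>1\<close> in
  place of that of \<open>d\<^sub>i\<close>. Since \<open>d\<^sub>0 = 0\<close>, averaging over time turns this into the constraint itself, up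
  to an error that vanishes because the Riccati recursion converges. Concavity of \<open>log det\<close> and
  compactness of the feasible set, which follows from the stability of \<open>F - K\<^sub>pH\<close>, conclude.\<close>

section \<open>Positive definite matrices\<close>

text \<open>The encoder may be nonlinear, so neither the tracking errors nor the
  \<open>\<epsilon>\<^sub>i\<close> need be Gaussian. A Gaussian bound still results because the
  logarithm of a Gaussian density is quadratic: the mean log-likelihood ratio sees second moments
  only, and \<open>\<Psi>\<^sub>Y\<^sub>,\<^sub>i\<close> is chosen to match them. The gains depend
  on the code but not on the message, so the comparison law is the same for all N messages, and
  under it a decoder is right with probability at most 1/N. Averaging over time is legitimate
  because the matrix inequality, read as an inequality between quadratic forms, is linear in the
  second moments; the inverse in \<open>K_Y\<close> cancels against \<open>Psi_Y\<close>. Replacing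
  the covariance of the next error by that of the current one goes in the favourable direction: the
  sum of the differences telescopes from zero to a positive semidefinite matrix. State covariances
  may be singular, so laws of states are handled through characteristic functions; densities appear
  only for innovations, whose covariances are positive definite.\<close>

lemma pos_def_psd: "pos_def A \<Longrightarrow> psd A"
  unfolding pos_def_def psd_def by (metis inner_zero_left order.refl less_imp_le)

lemma inner_matrix_vector: "(x::real^'n) \<bullet> (A *v y) = (transpose A *v x) \<bullet> (y::real^'m)"
  by (metis dot_lmul_matrix transpose_matrix_vector)

lemma pos_def_invertible:
  assumes "pos_def A" shows "invertible A"
proof -
  have "x = 0" if "A *v x = 0" for x
    using assms that unfolding pos_def_def by (metis inner_zero_right less_irrefl)
  then show ?thesis
    by (metis invertible_left_inverse matrix_left_invertible_ker)
qed

text \<open>Gram-Schmidt for the inner product defined by \<open>A\<close>.\<close>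

lemma pos_def_congruence_one:
  fixes A :: "real^'n^'n"
  assumes "pos_def A"
  obtains C :: "real^'n^'n" where "invertible C" "transpose C ** A ** C = mat 1"
proof -
  have sym: "transpose A = A" and pos: "\<And>x. x \<noteq> 0 \<Longrightarrow> 0 < x \<bullet> (A *v x)"
    using assms by (auto simp: pos_def_def)
  have symA: "x \<bullet> (A *v y) = y \<bullet> (A *v x)" for x y
    by (metis inner_commute inner_matrix_vector sym)
  have "\<exists>f. \<forall>i\<in>I. \<forall>j\<in>I. f i \<bullet> (A *v f j) = of_bool (i = j)" if "finite I" for I :: "'n set"
    using that
  proof (induction I)
    case (insert k I)
    then obtain f where f: "\<And>i j. i \<in> I \<Longrightarrow> j \<in> I \<Longrightarrow> f i \<bullet> (A *v f j) = of_bool (i = j)" by auto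
    \<comment> \<open>Orthogonality to \<open>A *v f i\<close> is orthogonality to
      \<open>f i\<close> in the new inner product. Fewer than n such vectors cannot span the space,
      so a nonzero x orthogonal to all of them exists and can be normalised.\<close>
    let ?S = "span ((\<lambda>i. A *v f i) ` I)"
    have "dim ?S \<le> card ((\<lambda>i. A *v f i) ` I)"
      unfolding dim_span by (rule dim_le_card') (use insert in auto)
    also have "\<dots> \<le> card I" using insert by (simp add: card_image_le)
    also have "card I < CARD('n)"
      using insert.hyps by (intro psubset_card_mono) auto
    finally have "dim ?S < DIM(real^'n)" by simp
    from orthogonal_to_subspace_exists[OF this]
    obtain x where x: "x \<noteq> 0" "\<And>y. y \<in> ?S \<Longrightarrow> x \<bullet> y = 0"
      unfolding orthogonal_def by (auto simp: span_span)
    let ?c = "1 / sqrt (x \<bullet> (A *v x))"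
    let ?g = "f(k := ?c *\<^sub>R x)"
    have "x \<bullet> (A *v f i) = 0" if "i \<in> I" for i
      using x(2) that by (simp add: span_base)
    then have o: "x \<bullet> (A *v f i) = 0" "f i \<bullet> (A *v x) = 0" if "i \<in> I" for i
      using that symA by auto
    have "?g i \<bullet> (A *v ?g j) = of_bool (i = j)" if "i \<in> insert k I" "j \<in> insert k I" for i j
      using that f o pos[OF x(1)] insert.hyps(2)
      by (auto simp: matrix_vector_mult_scaleR real_sqrt_mult_self power2_eq_square field_simps)
    then show ?case by blast
  qed simp
  then obtain f :: "'n \<Rightarrow> real^'n" where f: "\<And>i j. f i \<bullet> (A *v f j) = of_bool (i = j)"
    by (metis UNIV_I finite)
  define C where "C = (\<chi> i j. f j $ i)"
  have "(transpose C ** A ** C) $ i $ j = f i \<bullet> (A *v f j)" for i j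
    unfolding matrix_mul_assoc[symmetric]
    by (simp add: matrix_matrix_mult_def matrix_vector_mult_def inner_vec_def transpose_def C_def)
  then have 1: "transpose C ** A ** C = mat 1" by (simp add: vec_eq_iff f mat_def)
  then show thesis
    by (metis that invertible_left_inverse)
qed

text \<open>Determinants in the congruence with the identity give
  \<open>(det C)\<^sup>2 * det A = 1\<close>.\<close>

lemma pos_def_det: fixes A :: "real^'n^'n" assumes "pos_def A" shows "0 < det A"
proof -
  obtain C :: "real^'n^'n" where "transpose C ** A ** C = mat 1" using pos_def_congruence_one[OF assms] .
  then have "det C * det A * det C = 1" by (metis det_I det_mul det_transpose)
  then have *: "(det C)\<^sup>2 * det A = 1" by (simp add: power2_eq_square mult_ac)
  show ?thesis
  proof (rule ccontr)
    assume "\<not> 0 < det A"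
    then have "(det C)\<^sup>2 * det A \<le> 0" by (simp add: mult_nonneg_nonpos)
    with * show False by simp
  qed
qed

section \<open>Linear change of variables\<close>

text \<open>By \<open>inv\<close>, \<open>\<phi>\<close> is constant on every line in direction b,
  so on each such line the map is a translation. With the coordinate b integrated first, translation
  invariance in one dimension suffices.\<close>

lemma nn_integral_lborel_shear:
  fixes b :: "'a::euclidean_space"
  assumes b: "b \<in> Basis" and [measurable]: "\<phi> \<in> borel_measurable borel" "g \<in> borel_measurable borel"
    and inv: "\<And>x r. \<phi> (x + r *\<^sub>R b) = \<phi> x"
  shows "(\<integral>\<^sup>+x. g (x + \<phi> x *\<^sub>R b) \<partial>lborel) = (\<integral>\<^sup>+x. g x \<partial>(lborel :: 'a measure))"
proof -
  interpret product_sigma_finite "\<lambda>_::'a. lborel :: real measure" ..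
  let ?B = "Basis - {b} :: 'a set"
  let ?T = "\<lambda>f::'a\<Rightarrow>real. \<Sum>c\<in>Basis. f c *\<^sub>R c"
  have B: "Basis = insert b ?B" using b by auto
  have T: "?T (f(b := y)) = (\<Sum>c\<in>?B. f c *\<^sub>R c) + y *\<^sub>R b" for f y
    using b by (subst sum.remove[of _ b]) (auto intro!: sum.cong)
  have *: "(\<integral>\<^sup>+x. h x \<partial>(lborel :: 'a measure)) =
      (\<integral>\<^sup>+f. \<integral>\<^sup>+y. h ((\<Sum>c\<in>?B. f c *\<^sub>R c) + y *\<^sub>R b) \<partial>lborel \<partial>Pi\<^sub>M ?B (\<lambda>_. lborel))"
    if [measurable]: "h \<in> borel_measurable borel" for h :: "'a \<Rightarrow> ennreal"
  proof -
    have "(\<integral>\<^sup>+x. h x \<partial>(lborel :: 'a measure)) = (\<integral>\<^sup>+f. h (?T f) \<partial>Pi\<^sub>M Basis (\<lambda>_. lborel))"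
      by (subst lborel_eq) (simp add: nn_integral_distr)
    also have "\<dots> = (\<integral>\<^sup>+f. h (?T f) \<partial>Pi\<^sub>M (insert b ?B) (\<lambda>_. lborel))"
      using B by simp
    also have "\<dots> = (\<integral>\<^sup>+f. \<integral>\<^sup>+y. h (?T (f(b := y))) \<partial>lborel \<partial>Pi\<^sub>M ?B (\<lambda>_. lborel))"
      by (subst product_nn_integral_insert) (auto simp: B[symmetric])
    finally show ?thesis by (simp only: T)
  qed
  have "(\<integral>\<^sup>+y. g ((\<Sum>c\<in>?B. f c *\<^sub>R c) + y *\<^sub>R b + \<phi> ((\<Sum>c\<in>?B. f c *\<^sub>R c) + y *\<^sub>R b) *\<^sub>R b) \<partial>lborel)
     = (\<integral>\<^sup>+y. g ((\<Sum>c\<in>?B. f c *\<^sub>R c) + y *\<^sub>R b) \<partial>lborel)" for f :: "'a \<Rightarrow> real"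
  proof -
    let ?s = "\<Sum>c\<in>?B. f c *\<^sub>R c"
    have "(\<integral>\<^sup>+y. g (?s + y *\<^sub>R b) \<partial>lborel) = (\<integral>\<^sup>+y. g (?s + y *\<^sub>R b) \<partial>distr lborel borel ((+) (\<phi> ?s)))"
      by (simp add: lborel_distr_plus)
    also have "\<dots> = (\<integral>\<^sup>+y. g (?s + (\<phi> ?s + y) *\<^sub>R b) \<partial>lborel)"
      by (subst nn_integral_distr) auto
    finally show ?thesis unfolding inv by (simp add: algebra_simps)
  qed
  then show ?thesis by (subst (1 2) *) auto
qed

text \<open>The corresponding facts of the library need a well-ordered index type.\<close>

lemma nn_integral_lborel_matrix:
  fixes A :: "real^'n^'n"
  assumes "det A \<noteq> 0" and "g \<in> borel_measurable borel"
  shows "ennreal \<bar>det A\<bar> * (\<integral>\<^sup>+x. g (A *v x) \<partial>lborel) = (\<integral>\<^sup>+x. g x \<partial>lborel)"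
proof -
  \<comment> \<open>Elementary matrices generate all square matrices. The integrand is quantified
    inside the induction because a product \<open>A ** B\<close> is treated by applying the
    hypothesis for B to g composed with A.\<close>
  have "det A \<noteq> 0 \<longrightarrow> (\<forall>g::real^'n \<Rightarrow> ennreal. g \<in> borel_measurable borel \<longrightarrow>
    ennreal \<bar>det A\<bar> * (\<integral>\<^sup>+x. g (A *v x) \<partial>lborel) = (\<integral>\<^sup>+x. g x \<partial>lborel))"
  proof (induction A rule: induct_matrix_elementary_alt)
    case (1 A B)
    show ?case
    proof (intro impI allI)
      fix g :: "real^'n \<Rightarrow> ennreal"
      assume "det (A ** B) \<noteq> 0" and [measurable]: "g \<in> borel_measurable borel"
      then have d: "det A \<noteq> 0" "det B \<noteq> 0" by (auto simp: det_mul)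
      have [measurable]: "(\<lambda>x. g (A *v x)) \<in> borel_measurable borel"
        by (intro measurable_compose[OF _ \<open>g \<in> _\<close>] borel_measurable_continuous_onI)
           (intro matrix_vector_mult_linear_continuous_on)
      have "ennreal \<bar>det (A ** B)\<bar> * (\<integral>\<^sup>+x. g ((A ** B) *v x) \<partial>lborel) =
         ennreal \<bar>det A\<bar> * (ennreal \<bar>det B\<bar> * (\<integral>\<^sup>+x. g (A *v (B *v x)) \<partial>lborel))"
        by (simp add: det_mul abs_mult ennreal_mult mult.assoc matrix_vector_mul_assoc)
      also have "\<dots> = ennreal \<bar>det A\<bar> * (\<integral>\<^sup>+x. g (A *v x) \<partial>lborel)"
        using 1(2)[rule_format, OF d(2), of "\<lambda>x. g (A *v x)"] by simp
      also have "\<dots> = (\<integral>\<^sup>+x. g x \<partial>lborel)" using 1(1) d(1) by simp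
      finally show "ennreal \<bar>det (A ** B)\<bar> * (\<integral>\<^sup>+x. g ((A ** B) *v x) \<partial>lborel) = (\<integral>\<^sup>+x. g x \<partial>lborel)" .
    qed
  next
    case (2 A i) then show ?case by (simp add: det_zero_row(2))
  next
    case (3 A)
    have det: "det A = (\<Prod>i\<in>UNIV. A $ i $ i)" using 3 by (rule det_diagonal)
    show ?case
    proof (intro impI allI)
      fix g :: "real^'n \<Rightarrow> ennreal"
      assume "det A \<noteq> 0" and [measurable]: "g \<in> borel_measurable borel"
      then have nz: "A $ i $ i \<noteq> 0" for i by (simp add: det)
      \<comment> \<open>\<open>lborel_affine_euclidean\<close> takes the scaling factors as a
        function of the basis vector; the sum picks the diagonal entry of the one index whose axis
        vector is j.\<close>
      define c where "c j = (\<Sum>i\<in>UNIV. if j = axis i 1 then A $ i $ i else 0)" for j :: "real^'n"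
      have ax: "axis k (1::real) = axis i 1 \<longleftrightarrow> k = i" for k i :: 'n by (simp add: axis_eq_axis)
      have c: "c (axis i 1) = A $ i $ i" for i
        unfolding c_def ax by simp
      have T: "(\<Sum>j\<in>Basis. (c j * (x \<bullet> j)) *\<^sub>R j) = A *v x" for x
      proof -
        have "(\<Sum>j\<in>Basis. (c j * (x \<bullet> j)) *\<^sub>R j) = (\<Sum>i\<in>UNIV. (A $ i $ i * x $ i) *\<^sub>R axis i 1)"
          unfolding Basis_vec_def
          by (simp add: c inner_axis ax inj_on_def sum.reindex UNION_singleton_eq_range)
        also have "\<dots> = A *v x"
        proof (rule vec_eq_iff[THEN iffD2], rule)
          fix k
          have "(\<Sum>j\<in>UNIV. A $ k $ j * x $ j) = (\<Sum>j\<in>UNIV. if j = k then A $ k $ k * x $ k else 0)"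
            by (rule sum.cong) (use 3 in auto)
          then show "(\<Sum>i\<in>UNIV. (A $ i $ i * x $ i) *\<^sub>R axis i 1) $ k = (A *v x) $ k"
            by (simp add: matrix_vector_mult_def axis_def if_distrib cong: if_cong)
        qed
        finally show ?thesis .
      qed
      have P: "(\<Prod>j\<in>Basis. \<bar>c j\<bar>) = \<bar>det A\<bar>"
        unfolding Basis_vec_def det
        by (simp add: c ax inj_on_def prod.reindex UNION_singleton_eq_range abs_prod)
      have "lborel = density (distr lborel borel (\<lambda>x. 0 + (\<Sum>j\<in>Basis. (c j * (x \<bullet> j)) *\<^sub>R j))) (\<lambda>_.
          ennreal (\<Prod>j\<in>Basis. \<bar>c j\<bar>))"
        by (rule lborel_affine_euclidean) (auto simp: Basis_vec_def c nz)
      then have L: "lborel = density (distr lborel borel (\<lambda>x. A *v x)) (\<lambda>_. ennreal \<bar>det A\<bar>)"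
        by (simp only: T P add_0)
      have [measurable]: "(\<lambda>x. A *v x) \<in> borel_measurable borel"
        by (intro borel_measurable_continuous_onI matrix_vector_mult_linear_continuous_on)
      show "ennreal \<bar>det A\<bar> * (\<integral>\<^sup>+x. g (A *v x) \<partial>lborel) = (\<integral>\<^sup>+x. g x \<partial>lborel)"
        by (subst (2) L) (simp add: nn_integral_density nn_integral_cmult nn_integral_distr)
    qed
  next
    case (4 m n)
    let ?S = "(\<chi> i j. mat 1 $ i $ Transposition.transpose m n j) :: real^'n^'n"
    have S: "?S *v x = (\<chi> i. x $ Transposition.transpose m n i)" for x
    proof -
      have "(\<Sum>j\<in>UNIV. ?S $ i $ j * x $ j) = (\<Sum>j\<in>UNIV. if j = Transposition.transpose m n i then x $
          j else 0)" for i
        by (rule sum.cong) (auto simp: mat_def transpose_eq_iff)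
      then show ?thesis by (simp add: matrix_vector_mult_def vec_eq_iff)
    qed
    have "?S ** ?S = mat 1"
      by (simp add: matrix_eq matrix_vector_mul_assoc[symmetric] S vec_eq_iff)
    then have "det ?S * det ?S = 1" by (metis det_mul det_I)
    then have d: "\<bar>det ?S\<bar> = 1"
      unfolding power2_eq_square[symmetric] abs_square_eq_1 .
    have [measurable]: "(\<lambda>x. ?S *v x) \<in> borel_measurable borel"
      by (intro borel_measurable_continuous_onI matrix_vector_mult_linear_continuous_on)
    \<comment> \<open>A swap of two coordinates permutes the sides of every box, so boxes keep their
      volume.\<close>
    have L: "lborel = distr lborel borel (\<lambda>x. ?S *v x)"
    proof (rule lborel_eqI)
      fix l u :: "real^'n" assume le: "\<And>b. b \<in> Basis \<Longrightarrow> l \<bullet> b \<le> u \<bullet> b"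
      have le': "l $ i \<le> u $ i" for i using le[of "axis i 1"] by (simp add: inner_axis)
      have "(\<lambda>x. ?S *v x) -` box l u = box (?S *v l) (?S *v u)"
        unfolding S vimage_def by (auto simp: mem_box_cart) (metis transpose_involutory)+
      moreover have "(\<Prod>b\<in>Basis. (?S *v u - ?S *v l) \<bullet> b) = (\<Prod>b\<in>Basis. (u - l) \<bullet> b)"
      proof -
        have pr: "(\<Prod>b\<in>Basis. f \<bullet> b) = (\<Prod>i\<in>UNIV. f $ i)" for f :: "real^'n"
          unfolding Basis_vec_def
          by (simp add: inner_axis inj_on_def axis_eq_axis prod.reindex UNION_singleton_eq_range)
        have "(\<Prod>i\<in>UNIV. u $ Transposition.transpose m n i - l $ Transposition.transpose m n i) =
            (\<Prod>i\<in>UNIV. u $ i - l $ i)"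
          by (rule prod.reindex_bij_betw[of "Transposition.transpose m n"]) simp
        then show ?thesis by (simp add: pr S)
      qed
      ultimately show "emeasure (distr lborel borel ((*v) ?S)) (box l u) = (\<Prod>b\<in>Basis. (u - l) \<bullet> b)"
        using le' by (simp add: emeasure_distr emeasure_lborel_box_eq)
           (auto simp: Basis_vec_def inner_axis S)
    qed simp
    show ?case
    proof (intro impI allI)
      fix g :: "real^'n \<Rightarrow> ennreal"
      assume [measurable]: "g \<in> borel_measurable borel"
      show "ennreal \<bar>det ?S\<bar> * (\<integral>\<^sup>+x. g (?S *v x) \<partial>lborel) = (\<integral>\<^sup>+x. g x \<partial>lborel)"
        unfolding d by (subst (2) L) (simp add: nn_integral_distr)
    qed
  next
    case (5 m n)
    let ?S = "(\<chi> i j. of_bool (i = m \<and> j = n \<or> i = j)) :: real^'n^'n"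
    \<comment> \<open>The matrix adds the n-th coordinate to the m-th. Since m differs from n, the
      n-th coordinate is constant along axis m, the situation of
      \<open>nn_integral_lborel_shear\<close>.\<close>
    have S: "?S *v x = x + (x $ n) *\<^sub>R axis m 1" for x
    proof -
      have "(\<Sum>j\<in>UNIV. ?S $ i $ j * x $ j) = (\<Sum>j\<in>UNIV. (if j = i then x $ i else 0) + (if j = n then
          (if i = m then x $ n else 0) else 0))" for i
        by (rule sum.cong) (use 5 in auto)
      then show ?thesis by (auto simp add: matrix_vector_mult_def vec_eq_iff sum.distrib axis_def)
    qed
    have "det ?S = det (\<chi> k. if k = m then row m (mat 1) + (1::real) *s row n (mat 1) else row k
        (mat 1) :: real^'n^'n)"
      using 5 by (intro arg_cong[where f=det]) (auto simp: vec_eq_iff row_def mat_def)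
    also have "\<dots> = 1" using det_row_operation[OF 5, of "mat 1 :: real^'n^'n" 1] by simp
    finally have d: "det ?S = 1" .
    show ?case
    proof (intro impI allI)
      fix g :: "real^'n \<Rightarrow> ennreal"
      assume [measurable]: "g \<in> borel_measurable borel"
      have "(\<integral>\<^sup>+x. g (x + (x $ n) *\<^sub>R axis m 1) \<partial>lborel) = (\<integral>\<^sup>+x. g x \<partial>lborel)"
        using 5 by (intro nn_integral_lborel_shear) (auto simp: Basis_vec_def axis_def)
      then show "ennreal \<bar>det ?S\<bar> * (\<integral>\<^sup>+x. g (?S *v x) \<partial>lborel) = (\<integral>\<^sup>+x. g x \<partial>lborel)"
        unfolding S d by simp
    qed
  qed
  then show ?thesis using assms by blast
qed

section \<open>Gaussian measures and characteristic functions\<close>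

definition std_gauss_density :: "'a::euclidean_space \<Rightarrow> real" where
  "std_gauss_density x = (\<Prod>b\<in>Basis. std_normal_density (x \<bullet> b))"

definition std_gauss :: "'a::euclidean_space measure" where
  "std_gauss = density lborel (\<lambda>x. ennreal (std_gauss_density x))"

lemma std_gauss_density_measurable [measurable]: "std_gauss_density \<in> borel_measurable borel"
  unfolding std_gauss_density_def by measurable

lemma std_gauss_density_nonneg [simp]: "0 \<le> std_gauss_density x"
  unfolding std_gauss_density_def by (intro prod_nonneg) auto

lemma std_gauss_density_eq:
  "std_gauss_density (x::'a::euclidean_space) = exp (- (x \<bullet> x) / 2) / sqrt (2 * pi) ^ DIM('a)"
  unfolding std_gauss_density_def std_normal_density_def
  by (subst (2) euclidean_inner)
     (simp add: prod.distrib exp_sum[symmetric] sum_negf sum_divide_distrib[symmetric]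
         power2_eq_square prod_dividef)

lemma sets_std_gauss [measurable_cong, simp]: "sets std_gauss = sets borel"
  and space_std_gauss [simp]: "space std_gauss = UNIV"
  unfolding std_gauss_def by auto

lemma prob_space_std_gauss: "prob_space (std_gauss :: 'a::euclidean_space measure)"
proof
  have "(\<integral>\<^sup>+x. ennreal (std_normal_density x) \<partial>lborel) = 1"
    using prob_space.emeasure_space_1[OF prob_space_normal_density[of 1 0]]
    by (simp add: emeasure_density)
  then have "(\<integral>\<^sup>+x. ennreal (std_gauss_density (x::'a)) \<partial>lborel) = 1"
    unfolding std_gauss_density_def
    by (simp add: prod_ennreal[symmetric] nn_integral_lborel_prod[of "\<lambda>_ x. ennreal (std_normal_density x)"])
  then show "emeasure std_gauss (space (std_gauss :: 'a measure)) = 1"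
    by (simp add: std_gauss_def emeasure_density)
qed

text \<open>Density and exponential both factor over the coordinates, which leaves a product of
  one-dimensional characteristic functions.\<close>

lemma char_std_gauss:
  fixes t :: "'a::euclidean_space"
  shows "(CLINT x|std_gauss. iexp (t \<bullet> x)) = exp (- (t \<bullet> t) / 2)"
proof -
  interpret P: product_sigma_finite "\<lambda>_::'a. lborel :: real measure" ..
  have *: "std_gauss_density x *\<^sub>R iexp (t \<bullet> x) = (\<Prod>b\<in>Basis. std_normal_density (x \<bullet> b) *\<^sub>R iexp ((t
      \<bullet> b) * (x \<bullet> b)))" for x
    unfolding std_gauss_density_def
    by (subst (1) euclidean_inner)
       (simp add: sum_distrib_left exp_sum[symmetric] scaleR_conv_of_real prod.distrib)
  have int: "integrable lborel (\<lambda>y. std_normal_density y *\<^sub>R iexp (s * y))" for s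
    by (rule Bochner_Integration.integrable_bound[of _ "std_normal_density"]) auto
  have 1: "(CLINT y|lborel. std_normal_density y *\<^sub>R iexp (s * y)) = exp (- s\<^sup>2 / 2)" for s
    using fun_cong[OF char_std_normal_distribution, of s]
    by (simp add: char_def integral_density)
  have "(CLINT x|std_gauss. iexp (t \<bullet> x)) = (CLINT x|lborel. std_gauss_density x *\<^sub>R iexp (t \<bullet> x))"
    unfolding std_gauss_def by (subst integral_density) auto
  also have "\<dots> = (CLINT f|Pi\<^sub>M (Basis::'a set) (\<lambda>_. lborel). (\<Prod>b\<in>Basis. std_normal_density (f b) *\<^sub>R
      iexp ((t \<bullet> b) * f b)))"
    unfolding * by (subst lborel_eq) (simp add: integral_distr)
  also have "\<dots> = (\<Prod>b\<in>Basis. CLINT y|lborel. std_normal_density y *\<^sub>R iexp ((t \<bullet> b) * y))"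
    by (rule P.product_integral_prod) (rule finite_Basis, rule int)
  also have "\<dots> = (\<Prod>b\<in>(Basis::'a set). complex_of_real (exp (- (t \<bullet> b)\<^sup>2 / 2)))"
    unfolding 1 by simp
  also have "\<dots> = exp (- (t \<bullet> t) / 2)"
    by (subst euclidean_inner) (simp add: of_real_prod[symmetric] exp_sum[symmetric] sum_negf
        sum_divide_distrib[symmetric] power2_eq_square del: of_real_prod)
  finally show ?thesis .
qed

lemma borel_measurable_iexp_inner [measurable]:
  "(\<lambda>x::'a::euclidean_space. iexp (t \<bullet> x)) \<in> borel_measurable borel"
  by measurable

section \<open>Characteristic functions determine the law\<close>

text \<open>Up to a constant, the standard Gaussian density is its own characteristic function.
  Writing it as an integral of exponentials and exchanging the integrals makes the characteristic
  function of \<open>\<mu>\<close> appear.\<close>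

lemma smoothed_density_char:
  fixes \<mu> :: "'b::euclidean_space measure"
  assumes "prob_space \<mu>" and sets [simp, measurable_cong]: "sets \<mu> = sets borel"
  shows "complex_of_real (\<integral>x. std_gauss_density ((y - x) /\<^sub>R \<sigma>) \<partial>\<mu>) =
    (CLINT u|std_gauss. (CLINT x|\<mu>. iexp ((- u /\<^sub>R \<sigma>) \<bullet> x)) * iexp (u \<bullet> (y /\<^sub>R \<sigma>))) / sqrt (2 * pi) ^ DIM('b)"
proof -
  interpret \<mu>: prob_space \<mu> by fact
  interpret g: prob_space "std_gauss :: 'b measure" by (rule prob_space_std_gauss)
  interpret p: pair_prob_space \<mu> "std_gauss :: 'b measure" ..
  have [simp]: "space \<mu> = UNIV" using sets_eq_imp_space_eq[OF sets] by simp
  have "complex_of_real (\<integral>x. std_gauss_density ((y - x) /\<^sub>R \<sigma>) \<partial>\<mu>) =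
     (CLINT x|\<mu>. (CLINT u|std_gauss. iexp (((y - x) /\<^sub>R \<sigma>) \<bullet> u)) / sqrt (2 * pi) ^ DIM('b))"
    unfolding char_std_gauss std_gauss_density_eq
    by (simp flip: integral_complex_of_real)
  also have "\<dots> = (CLINT x|\<mu>. (CLINT u|std_gauss. iexp (((y - x) /\<^sub>R \<sigma>) \<bullet> u))) / sqrt (2 * pi) ^ DIM('b)"
    by simp
  also have "(CLINT x|\<mu>. (CLINT u|std_gauss. iexp (((y - x) /\<^sub>R \<sigma>) \<bullet> u))) =
     (CLINT u|std_gauss. (CLINT x|\<mu>. iexp (((y - x) /\<^sub>R \<sigma>) \<bullet> u)))"
    by (rule p.Fubini_integral[symmetric], rule p.P.integrable_const_bound[of _ 1]) auto
  also have "\<dots> = (CLINT u|std_gauss. (CLINT x|\<mu>. iexp ((- u /\<^sub>R \<sigma>) \<bullet> x)) * iexp (u \<bullet> (y /\<^sub>R \<sigma>)))"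
  proof (rule Bochner_Integration.integral_cong[OF refl])
    fix u :: 'b
    have "iexp (((y - x) /\<^sub>R \<sigma>) \<bullet> u) = iexp ((- u /\<^sub>R \<sigma>) \<bullet> x) * iexp (u \<bullet> (y /\<^sub>R \<sigma>))" for x
      by (simp add: exp_add[symmetric] algebra_simps inner_commute)
    then show "(CLINT x|\<mu>. iexp (((y - x) /\<^sub>R \<sigma>) \<bullet> u)) = (CLINT x|\<mu>. iexp ((- u /\<^sub>R \<sigma>) \<bullet> x)) * iexp
        (u \<bullet> (y /\<^sub>R \<sigma>))"
      by simp
  qed
  finally show ?thesis .
qed

text \<open>For x of law \<open>\<mu>\<close> and u standard Gaussian, the factor of f on the right
  is the density of \<open>x + \<sigma> *\<^sub>R u\<close>: substitute y for this sum, then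
  integrate over x first.\<close>

lemma smoothed_nn_integral:
  fixes \<mu> :: "'b::euclidean_space measure"
  assumes "prob_space \<mu>" and sets [simp, measurable_cong]: "sets \<mu> = sets borel"
    and \<sigma>: "0 < \<sigma>" and f [measurable]: "f \<in> borel_measurable borel"
  shows "(\<integral>\<^sup>+x. \<integral>\<^sup>+u. f (x + \<sigma> *\<^sub>R u) \<partial>std_gauss \<partial>\<mu>) =
    (\<integral>\<^sup>+y. f y * (ennreal (\<integral>x. std_gauss_density ((y - x) /\<^sub>R \<sigma>) \<partial>\<mu>) / ennreal (\<sigma> ^ DIM('b))) \<partial>lborel)"
proof -
  interpret \<mu>: prob_space \<mu> by fact
  interpret p: pair_sigma_finite \<mu> "lborel :: 'b measure" ..
  have c: "ennreal (\<sigma> ^ DIM('b)) \<noteq> 0" "ennreal (\<sigma> ^ DIM('b)) \<noteq> top" using \<sigma> by auto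
  have 1: "(\<integral>\<^sup>+u. f (x + \<sigma> *\<^sub>R u) \<partial>std_gauss) =
     (\<integral>\<^sup>+y. f y * (ennreal (std_gauss_density ((y - x) /\<^sub>R \<sigma>)) / ennreal (\<sigma> ^ DIM('b))) \<partial>lborel)" for x
  proof -
    have L: "lborel = density (distr lborel borel (\<lambda>u::'b. x + \<sigma> *\<^sub>R u)) (\<lambda>_. ennreal (\<sigma> ^ DIM('b)))"
      using lborel_affine[of \<sigma> x] \<sigma> by simp
    have "(\<integral>\<^sup>+y. f y * (ennreal (std_gauss_density ((y - x) /\<^sub>R \<sigma>)) / ennreal (\<sigma> ^ DIM('b))) \<partial>lborel)
      = (\<integral>\<^sup>+u. ennreal (\<sigma> ^ DIM('b)) * (f (x + \<sigma> *\<^sub>R u) * (ennreal (std_gauss_density u) / ennreal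
          (\<sigma> ^ DIM('b)))) \<partial>lborel)"
      using \<sigma> by (subst L) (simp add: nn_integral_density nn_integral_distr)
    also have "\<dots> = (\<integral>\<^sup>+u. ennreal (std_gauss_density u) * f (x + \<sigma> *\<^sub>R u) \<partial>lborel)"
    proof (rule nn_integral_cong)
      fix u
      have "k * (a * (b / k)) = b * a" if "k \<noteq> 0" "k \<noteq> top" for k a b :: ennreal
        using that by (metis ennreal_mult_divide_eq ennreal_times_divide mult.commute mult.left_commute)
      then show "ennreal (\<sigma> ^ DIM('b)) * (f (x + \<sigma> *\<^sub>R u) * (ennreal (std_gauss_density u) / ennreal
          (\<sigma> ^ DIM('b))))
          = ennreal (std_gauss_density u) * f (x + \<sigma> *\<^sub>R u)" using c by blast
    qed
    also have "\<dots> = (\<integral>\<^sup>+u. f (x + \<sigma> *\<^sub>R u) \<partial>std_gauss)"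
      unfolding std_gauss_def by (simp add: nn_integral_density)
    finally show ?thesis by simp
  qed
  have "std_gauss_density z \<le> 1 / sqrt (2 * pi) ^ DIM('b)" for z :: 'b
    unfolding std_gauss_density_eq by (auto intro!: divide_right_mono)
  then have int: "integrable \<mu> (\<lambda>x. std_gauss_density ((y - x) /\<^sub>R \<sigma>))" for y
    by (intro \<mu>.integrable_const_bound[of _ "1 / sqrt (2 * pi) ^ DIM('b)"]) auto
  have "(\<integral>\<^sup>+x. \<integral>\<^sup>+u. f (x + \<sigma> *\<^sub>R u) \<partial>std_gauss \<partial>\<mu>) =
     (\<integral>\<^sup>+y. \<integral>\<^sup>+x. f y * (ennreal (std_gauss_density ((y - x) /\<^sub>R \<sigma>)) / ennreal (\<sigma> ^ DIM('b))) \<partial>\<mu> \<partial>lborel)"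
    unfolding 1 by (rule p.Fubini'[symmetric]) measurable
  also have "\<dots> = (\<integral>\<^sup>+y. f y * (ennreal (\<integral>x. std_gauss_density ((y - x) /\<^sub>R \<sigma>) \<partial>\<mu>) / ennreal (\<sigma> ^
      DIM('b))) \<partial>lborel)"
    using int by (simp add: nn_integral_cmult nn_integral_divide nn_integral_eq_integral)
  finally show ?thesis .
qed

text \<open>After smoothing with a Gaussian of standard deviation \<open>\<sigma>\<close> both measures have densities that are
  determined by their characteristic functions; then let \<open>\<sigma>\<close> tend to 0.\<close>

theorem char_uniqueness_euclidean:
  fixes \<mu> \<nu> :: "'b::euclidean_space measure"
  assumes \<mu>: "prob_space \<mu>" "sets \<mu> = sets borel" and \<nu>: "prob_space \<nu>" "sets \<nu> = sets borel"
    and eq: "\<And>t. (CLINT x|\<mu>. iexp (t \<bullet> x)) = (CLINT x|\<nu>. iexp (t \<bullet> x))"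
  shows "\<mu> = \<nu>"
proof -
  have smooth: "(\<integral>\<^sup>+x. \<integral>\<^sup>+u. f (x + \<sigma> *\<^sub>R u) \<partial>std_gauss \<partial>\<mu>) = (\<integral>\<^sup>+x. \<integral>\<^sup>+u. f (x + \<sigma> *\<^sub>R u) \<partial>std_gauss \<partial>\<nu>)"
    if [measurable]: "f \<in> borel_measurable borel" and "0 < \<sigma>" for f and \<sigma> :: real
  proof -
    have "complex_of_real (\<integral>x. std_gauss_density ((y - x) /\<^sub>R \<sigma>) \<partial>\<mu>) = complex_of_real (\<integral>x.
        std_gauss_density ((y - x) /\<^sub>R \<sigma>) \<partial>\<nu>)" for y :: 'b
      by (simp only: smoothed_density_char[OF \<mu>]
          smoothed_density_char[OF \<nu>] eq)
    then show ?thesis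
      using that by (simp add: smoothed_nn_integral \<mu> \<nu>)
  qed
  have lim: "(\<lambda>k. \<integral>\<^sup>+x. \<integral>\<^sup>+u. f (x + (1 / real (Suc k)) *\<^sub>R u) \<partial>std_gauss \<partial>\<rho>) \<longlonglongrightarrow> (\<integral>\<^sup>+x. f x \<partial>\<rho>)"
    if "prob_space \<rho>" and sets[simp, measurable_cong]: "sets \<rho> = sets borel" and f: "continuous_on
        UNIV f" and le: "\<And>x. f x \<le> 1"
    for f :: "'b \<Rightarrow> ennreal" and \<rho>
  proof -
    interpret \<rho>: prob_space \<rho> by fact
    interpret g: prob_space "std_gauss :: 'b measure" by (rule prob_space_std_gauss)
    interpret p: pair_prob_space \<rho> "std_gauss :: 'b measure" ..
    have [measurable]: "f \<in> borel_measurable borel" using f by (rule borel_measurable_continuous_onI)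
    have "(\<lambda>k. \<integral>\<^sup>+z. f (fst z + (1 / real (Suc k)) *\<^sub>R snd z) \<partial>(\<rho> \<Otimes>\<^sub>M std_gauss)) \<longlonglongrightarrow> (\<integral>\<^sup>+z. f (fst z)
        \<partial>(\<rho> \<Otimes>\<^sub>M (std_gauss :: 'b measure)))"
    proof (rule nn_integral_dominated_convergence[where w="\<lambda>_. 1" and u="\<lambda>k z. f (fst z + (1 / real
        (Suc k)) *\<^sub>R snd z)" and u'="\<lambda>z. f (fst z)"])
      show "AE z in \<rho> \<Otimes>\<^sub>M std_gauss. (\<lambda>k. f (fst z + (1 / real (Suc k)) *\<^sub>R snd z)) \<longlonglongrightarrow> f (fst z)"
      proof (rule AE_I2)
        fix z :: "'b \<times> 'b"
        have "(\<lambda>k. fst z + (1 / real (Suc k)) *\<^sub>R snd z) \<longlonglongrightarrow> fst z + 0 *\<^sub>R snd z"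
          by (intro tendsto_intros LIMSEQ_Suc[OF lim_1_over_n])
        then show "(\<lambda>k. f (fst z + (1 / real (Suc k)) *\<^sub>R snd z)) \<longlonglongrightarrow> f (fst z)"
          using f by (intro continuous_on_tendsto_compose[OF f]) auto
      qed
      show "(\<integral>\<^sup>+z. 1 \<partial>(\<rho> \<Otimes>\<^sub>M (std_gauss :: 'b measure))) < \<infinity>"
        using p.P.emeasure_space_1 by simp
    qed (simp_all add: le)
    then show ?thesis
      by (simp add: g.nn_integral_fst[symmetric] g.emeasure_space_1[simplified])
  qed
  have cont: "(\<integral>\<^sup>+x. f x \<partial>\<mu>) = (\<integral>\<^sup>+x. f x \<partial>\<nu>)"
    if f: "continuous_on UNIV f" and le: "\<And>x. f x \<le> 1" for f :: "'b \<Rightarrow> ennreal"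
  proof (rule LIMSEQ_unique[OF lim[OF \<mu> f le]])
    show "(\<lambda>k. \<integral>\<^sup>+x. \<integral>\<^sup>+u. f (x + (1 / real (Suc k)) *\<^sub>R u) \<partial>std_gauss \<partial>\<mu>) \<longlonglongrightarrow> (\<integral>\<^sup>+x. f x \<partial>\<nu>)"
      using lim[OF \<nu> f le] smooth[OF borel_measurable_continuous_onI[OF f]] by simp
  qed
  have op: "emeasure \<mu> U = emeasure \<nu> U" if "open U" for U
  \<comment> \<open>The distance to the empty set is 0 by convention, so the approximation used in
    the other case would be identically 0 for the whole space.\<close>
  proof (cases "U = UNIV")
    case True
    then show ?thesis
      using prob_space.emeasure_space_1[OF \<mu>(1)] prob_space.emeasure_space_1[OF \<nu>(1)]
        sets_eq_imp_space_eq[OF \<mu>(2)] sets_eq_imp_space_eq[OF \<nu>(2)] by simp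
  next
    case False
    \<comment> \<open>Continuous functions with values in [0, 1] that converge to the indicator of
      the open set U.\<close>
    let ?f = "\<lambda>k x. ennreal (min 1 (real k * infdist x (- U)))"
    have lim: "(\<lambda>k. ?f k x) \<longlonglongrightarrow> indicator U x" for x
    proof (cases "x \<in> U")
      case True
      then have pos: "0 < infdist x (- U)"
        using \<open>open U\<close> False
        by (metis Compl_UNIV_eq ComplD closed_Compl double_complement in_closed_iff_infdist_zero
            infdist_nonneg order.order_iff_strict)
      obtain K :: nat where K: "1 / infdist x (- U) \<le> real K" using real_arch_simple by blast
      have "1 \<le> real k * infdist x (- U)" if "K \<le> k" for k
      proof -
        have "1 / infdist x (- U) \<le> real k" using K that by (meson of_nat_mono order_trans)
        then show ?thesis using pos by (simp add: field_simps)
      qed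
      then have "eventually (\<lambda>k. ?f k x = 1) sequentially"
        by (auto simp: eventually_sequentially intro!: exI[of _ K])
      then show ?thesis using True by (simp add: tendsto_eventually)
    qed (simp)
    have em: "(\<lambda>k. \<integral>\<^sup>+x. ?f k x \<partial>\<rho>) \<longlonglongrightarrow> emeasure \<rho> U"
      if "prob_space \<rho>" and sets[simp, measurable_cong]: "sets \<rho> = sets borel" for \<rho>
    proof -
      interpret \<rho>: prob_space \<rho> by fact
      have [measurable]: "U \<in> sets borel" using \<open>open U\<close> by simp
      have [measurable]: "(\<lambda>x. infdist x (- U)) \<in> borel_measurable borel"
        by (intro borel_measurable_continuous_onI continuous_intros)
      have "(\<lambda>k. \<integral>\<^sup>+x. ?f k x \<partial>\<rho>) \<longlonglongrightarrow> (\<integral>\<^sup>+x. indicator U x \<partial>\<rho>)"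
        by (rule nn_integral_dominated_convergence[where w="\<lambda>_. 1"])
           (use lim in \<open>auto simp: \<rho>.emeasure_space_1 ennreal_le_1\<close>)
      then show ?thesis by simp
    qed
    have "(\<integral>\<^sup>+x. ?f k x \<partial>\<mu>) = (\<integral>\<^sup>+x. ?f k x \<partial>\<nu>)" for k
      by (rule cont) (auto intro!: continuous_on_ennreal continuous_intros simp: ennreal_le_1)
    then show ?thesis
      using LIMSEQ_unique[OF em[OF \<mu>]] em[OF \<nu>] by simp
  qed
  show ?thesis
  proof (rule measure_eqI_generator_eq[where E="{S. open S}" and \<Omega>=UNIV and A="\<lambda>_. UNIV"])
    show "emeasure \<mu> UNIV \<noteq> \<infinity>"
      using prob_space.emeasure_space_1[OF \<mu>(1)] sets_eq_imp_space_eq[OF \<mu>(2)] by simp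
  qed (auto simp: op Int_stable_def \<mu> \<nu> borel_def)
qed

section \<open>Normal laws with a general covariance matrix, and concavity of log det\<close>

lemma matrix_inv_mult:
  assumes "invertible A"
  shows "A ** matrix_inv A = mat 1" "matrix_inv A ** A = mat 1"
  using someI_ex[of "\<lambda>B. A ** B = mat 1 \<and> B ** A = mat 1"] assms
  unfolding matrix_inv_def invertible_def by auto

lemma transpose_matrix_inv:
  assumes "invertible A" "transpose A = A"
  shows "transpose (matrix_inv A) = matrix_inv (A :: real^'n^'n)"
proof -
  have "transpose (matrix_inv A) ** A = mat 1"
    using arg_cong[OF matrix_inv_mult(1)[OF assms(1)], of transpose]
    by (simp add: matrix_transpose_mul assms(2) transpose_mat)
  then have "transpose (matrix_inv A) ** (A ** matrix_inv A) = matrix_inv A"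
    by (simp add: matrix_mul_assoc)
  then show ?thesis by (simp add: matrix_inv_mult(1)[OF assms(1)])
qed

lemma pos_def_matrix_inv:
  assumes A: "pos_def A" shows "pos_def (matrix_inv A)"
  unfolding pos_def_def
proof (intro conjI allI impI)
  note inv = matrix_inv_mult[OF pos_def_invertible[OF A]]
  show "transpose (matrix_inv A) = matrix_inv A"
    using A by (intro transpose_matrix_inv pos_def_invertible) (auto simp: pos_def_def)
  fix x :: "real^'a" assume "x \<noteq> 0"
  have x: "A *v (matrix_inv A *v x) = x"
    by (simp add: matrix_vector_mul_assoc inv)
  with \<open>x \<noteq> 0\<close> have "matrix_inv A *v x \<noteq> 0" by auto
  with A have "0 < (matrix_inv A *v x) \<bullet> (A *v (matrix_inv A *v x))" by (auto simp: pos_def_def)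
  then show "0 < x \<bullet> (matrix_inv A *v x)" by (simp add: x inner_commute)
qed

lemma det_matrix_inv:
  assumes "invertible A" shows "det (matrix_inv A) = 1 / det (A :: real^'n^'n)"
  using arg_cong[OF matrix_inv_mult(1)[OF assms], of det] assms
  by (simp add: det_mul invertible_det_nz field_simps)

lemma matrix_vector_measurable [measurable]:
  "(\<lambda>x. (A :: real^'n^'m) *v x) \<in> borel_measurable borel"
  by (intro borel_measurable_continuous_onI matrix_vector_mult_linear_continuous_on)

lemma inner_congruence:
  fixes A :: "real^'n^'n"
  shows "x \<bullet> ((transpose C ** A ** C) *v x) = (C *v x) \<bullet> (A *v (C *v x))"
  unfolding matrix_vector_mul_assoc[symmetric] inner_matrix_vector[of x "transpose C"] transpose_transpose ..

text \<open>Substituting \<open>C *v x\<close>, where C carries A to the identity by congruence,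
  leaves the standard Gaussian integral and the factor
  \<open>\<bar>det C\<bar> = 1 / sqrt (det A)\<close>.\<close>

lemma gaussian_integral:
  fixes A :: "real^'n^'n"
  assumes "pos_def A"
  shows "(\<integral>\<^sup>+x. ennreal (exp (- (x \<bullet> (A *v x)) / 2)) \<partial>lborel) = ennreal (sqrt ((2 * pi) ^ CARD('n) / det A))"
proof -
  obtain C :: "real^'n^'n" where C: "invertible C" "transpose C ** A ** C = mat 1"
    using pos_def_congruence_one[OF assms] .
  have "det C * det A * det C = 1" using C(2) by (metis det_I det_mul det_transpose)
  then have d: "\<bar>det C\<bar> = 1 / sqrt (det A)"
    using pos_def_det[OF assms]
    by (intro real_sqrt_unique[of _ "1 / det A", symmetric, unfolded real_sqrt_divide real_sqrt_one])
       (auto simp: power2_eq_square field_simps)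
  have q: "(C *v x) \<bullet> (A *v (C *v x)) = x \<bullet> x" for x
  proof -
    have "(C *v x) \<bullet> (A *v (C *v x)) = x \<bullet> ((transpose C ** A ** C) *v x)"
      by (simp only: inner_congruence)
    then show ?thesis by (simp add: C)
  qed
  have "1 = (\<integral>\<^sup>+x. ennreal (std_gauss_density x) \<partial>(lborel :: (real^'n) measure))"
    using prob_space.emeasure_space_1[OF prob_space_std_gauss[where 'a="real^'n"]]
    by (simp add: std_gauss_def emeasure_density)
  also have "\<dots> = (\<integral>\<^sup>+x. ennreal (exp (- (x \<bullet> x) / 2)) * ennreal (1 / sqrt (2 * pi) ^ CARD('n))
      \<partial>(lborel :: (real^'n) measure))"
    by (simp add: std_gauss_density_eq ennreal_mult[symmetric] del: ennreal_mult)
  also have "\<dots> = (\<integral>\<^sup>+x. ennreal (exp (- (x \<bullet> x) / 2)) \<partial>(lborel :: (real^'n) measure)) * ennreal (1 /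
      sqrt (2 * pi) ^ CARD('n))"
    by (simp add: nn_integral_multc)
  finally have 1: "(\<integral>\<^sup>+x. ennreal (exp (- (x \<bullet> x) / 2)) \<partial>(lborel :: (real^'n) measure)) * ennreal (1
      / sqrt (2 * pi) ^ CARD('n)) = 1" ..
  have "(\<integral>\<^sup>+x. ennreal (exp (- (x \<bullet> x) / 2)) \<partial>(lborel :: (real^'n) measure)) =
     (\<integral>\<^sup>+x. ennreal (exp (- (x \<bullet> x) / 2)) \<partial>(lborel :: (real^'n) measure)) * ennreal (1 / sqrt (2 *
         pi) ^ CARD('n)) * ennreal (sqrt (2 * pi) ^ CARD('n))"
    by (simp add: mult.assoc ennreal_mult[symmetric] del: ennreal_mult)
  also have "\<dots> = ennreal (sqrt (2 * pi) ^ CARD('n))" unfolding 1 by simp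
  finally have 2: "(\<integral>\<^sup>+x. ennreal (exp (- (x \<bullet> x) / 2)) \<partial>(lborel :: (real^'n) measure)) = ennreal
      (sqrt (2 * pi) ^ CARD('n))" .
  have "(\<integral>\<^sup>+x. ennreal (exp (- (x \<bullet> (A *v x)) / 2)) \<partial>lborel) = ennreal \<bar>det C\<bar> * (\<integral>\<^sup>+x. ennreal (exp
      (- (x \<bullet> x) / 2)) \<partial>(lborel :: (real^'n) measure))"
    using nn_integral_lborel_matrix[of C "\<lambda>x. ennreal (exp (- (x \<bullet> (A *v x)) / 2))", symmetric] C(1)
    by (simp add: q invertible_det_nz)
  also have "\<dots> = ennreal (sqrt ((2 * pi) ^ CARD('n) / det A))"
    unfolding 2 d using pos_def_det[OF assms]
    by (simp add: ennreal_mult[symmetric] real_sqrt_divide real_sqrt_power real_sqrt_mult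
        power_mult_distrib del: ennreal_mult)
  finally show ?thesis .
qed

text \<open>Integrate the weighted inequality of arithmetic and geometric means between two Gaussian densities.\<close>

lemma ln_det_concave:
  fixes A B :: "real^'n^'n"
  assumes A: "pos_def A" and B: "pos_def B" and t: "0 \<le> t" "0 \<le> u" "t + u = 1"
  shows "t * ln (det A) + u * ln (det B) \<le> ln (det (t *\<^sub>R A + u *\<^sub>R B))"
proof -
  let ?C = "t *\<^sub>R A + u *\<^sub>R B"
  define Z where "Z A = sqrt ((2 * pi) ^ CARD('n) / det A)" for A :: "real^'n^'n"
  have q: "x \<bullet> (?C *v x) = t * (x \<bullet> (A *v x)) + u * (x \<bullet> (B *v x))" for x
    by (simp add: matrix_vector_mult_add_rdistrib scaleR_matrix_vector_assoc[symmetric] inner_add_right)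
  have C: "pos_def ?C"
    unfolding pos_def_def
  proof (intro conjI allI impI)
    show "transpose ?C = ?C"
      using A B by (auto simp: pos_def_def transpose_def vec_eq_iff)
    fix x :: "real^'n" assume "x \<noteq> 0"
    then have "0 < x \<bullet> (A *v x)" "0 < x \<bullet> (B *v x)" using A B by (auto simp: pos_def_def)
    moreover have "0 < t \<or> 0 < u" using t by linarith
    ultimately show "0 < x \<bullet> (?C *v x)"
      unfolding q using t by (auto intro: add_pos_nonneg add_nonneg_pos)
  qed
  have Z: "0 < Z A" "ln (Z A) = (ln ((2 * pi) ^ CARD('n)) - ln (det A)) / 2" if "pos_def A" for A
    using pos_def_det[OF that] by (auto simp: Z_def ln_sqrt ln_div)
  define e where "e A x = exp (- (x \<bullet> (A *v x)) / 2)" for A :: "real^'n^'n" and x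
  have [measurable]: "e A \<in> borel_measurable borel" for A unfolding e_def by measurable
  have Zi: "(\<integral>\<^sup>+x. ennreal (e A x) \<partial>lborel) = ennreal (Z A)" if "pos_def A" for A
    unfolding e_def Z_def by (rule gaussian_integral[OF that])
  \<comment> \<open>The weighted geometric mean of the two normalising constants. The aim is
    \<open>Z ?C \<le> k\<close>; since Z is a constant times det to the power -1/2, taking
    logarithms reverses the inequality for det.\<close>
  define k where "k = exp (t * ln (Z A) + u * ln (Z B))"
  have le: "e ?C x \<le> k * (t * (e A x / Z A) + u * (e B x / Z B))" for x
  proof -
    \<comment> \<open>Logarithms of the two normalised densities at x. Convexity of exp at these
      points is the inequality of arithmetic and geometric means.\<close>
    define \<alpha> \<beta> where "\<alpha> = - (x \<bullet> (A *v x)) / 2 - ln (Z A)" and "\<beta> = - (x \<bullet> (B *v x)) / 2 - ln (Z B)"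
    have "exp (t *\<^sub>R \<alpha> + u *\<^sub>R \<beta>) \<le> t * exp \<alpha> + u * exp \<beta>"
      using exp_convex t unfolding convex_on_def by blast
    moreover have "exp \<alpha> = e A x / Z A" "exp \<beta> = e B x / Z B"
      using Z(1)[OF A] Z(1)[OF B] by (auto simp: \<alpha>_def \<beta>_def e_def exp_diff)
    moreover have "e ?C x = k * exp (t *\<^sub>R \<alpha> + u *\<^sub>R \<beta>)"
      unfolding e_def q k_def \<alpha>_def \<beta>_def exp_add[symmetric] by (simp add: field_simps)
    ultimately show ?thesis by (simp add: k_def)
  qed
  have [simp]: "0 \<le> e A x" "0 \<le> k" for A x by (auto simp: e_def k_def)
  have "ennreal (Z ?C) = (\<integral>\<^sup>+x. ennreal (e ?C x) \<partial>lborel)" using Zi[OF C] by simp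
  also have "\<dots> \<le> (\<integral>\<^sup>+x. ennreal (k * t / Z A) * ennreal (e A x) + ennreal (k * u / Z B) * ennreal (e
      B x) \<partial>lborel)"
  proof (rule nn_integral_mono)
    fix x
    have "ennreal (k * t / Z A) * ennreal (e A x) + ennreal (k * u / Z B) * ennreal (e B x) =
        ennreal (k * (t * (e A x / Z A) + u * (e B x / Z B)))"
      using Z(1)[OF A] Z(1)[OF B] t
      by (simp add: ennreal_mult[symmetric] ennreal_plus[symmetric] algebra_simps del: ennreal_mult
          ennreal_plus)
    then show "ennreal (e ?C x) \<le> ennreal (k * t / Z A) * ennreal (e A x) + ennreal (k * u / Z B) *
        ennreal (e B x)"
      using le[of x] by (simp add: ennreal_leI)
  qed
  also have "\<dots> = ennreal (k * t / Z A) * ennreal (Z A) + ennreal (k * u / Z B) * ennreal (Z B)"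
    by (simp add: nn_integral_add nn_integral_cmult Zi A B)
  also have "\<dots> = ennreal k"
    using Z(1)[OF A] Z(1)[OF B] t
    by (simp add: ennreal_mult[symmetric] ennreal_plus[symmetric] distrib_left[symmetric] del:
        ennreal_mult ennreal_plus)
  finally have "Z ?C \<le> k" by simp
  then have "ln (Z ?C) \<le> t * ln (Z A) + u * ln (Z B)"
    using Z(1)[OF C] by (metis k_def ln_exp ln_le_cancel_iff exp_gt_zero)
  then have "ln ((2 * pi) ^ CARD('n)) - ln (det ?C) \<le> (t + u) * ln ((2 * pi) ^ CARD('n)) - (t * ln
      (det A) + u * ln (det B))"
    unfolding Z(2)[OF A] Z(2)[OF B] Z(2)[OF C] by (simp add: field_simps)
  then show ?thesis using t by simp
qed

definition mvn_density :: "real^'n^'n \<Rightarrow> real^'n \<Rightarrow> real" where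
  "mvn_density \<Psi> x = exp (- (x \<bullet> (matrix_inv \<Psi> *v x)) / 2) / sqrt ((2 * pi) ^ CARD('n) * det \<Psi>)"

lemma mvn_density_measurable [measurable]: "mvn_density \<Psi> \<in> borel_measurable borel"
  unfolding mvn_density_def by measurable

lemma mvn_density_pos: "pos_def \<Psi> \<Longrightarrow> 0 < mvn_density \<Psi> x"
  unfolding mvn_density_def using pos_def_det[of \<Psi>] by simp

lemma ln_mvn_density:
  fixes \<Psi> :: "real^'n^'n"
  assumes "pos_def \<Psi>"
  shows "ln (mvn_density \<Psi> x) = - (x \<bullet> (matrix_inv \<Psi> *v x)) / 2 - (CARD('n) * ln (2 * pi) + ln (det \<Psi>)) / 2"
  using pos_def_det[OF assms]
  by (simp add: mvn_density_def ln_div ln_sqrt ln_mult ln_realpow field_simps)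

text \<open>B is chosen to carry the inverse of \<open>\<Psi>\<close> to the identity by congruence.
  Then the exponent becomes the standard one after substituting \<open>B *v x\<close>, the Jacobian
  \<open>sqrt (det \<Psi>)\<close> is the extra normalising factor, and
  \<open>B ** transpose B\<close> is forced to be \<open>\<Psi>\<close>.\<close>

lemma mvn_eq_distr_std_gauss:
  fixes \<Psi> :: "real^'n^'n"
  assumes "pos_def \<Psi>"
  obtains B :: "real^'n^'n" where "B ** transpose B = \<Psi>"
    "density lborel (\<lambda>x. ennreal (mvn_density \<Psi> x)) = distr std_gauss borel (\<lambda>x. B *v x)"
proof -
  note I = matrix_inv_mult[OF pos_def_invertible[OF assms]]
  note dI = det_matrix_inv[OF pos_def_invertible[OF assms]]
  obtain B :: "real^'n^'n" where B: "invertible B" "transpose B ** matrix_inv \<Psi> ** B = mat 1"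
    using pos_def_congruence_one[OF pos_def_matrix_inv[OF assms]] .
  have "det B * det (matrix_inv \<Psi>) * det B = 1" using B(2) by (metis det_I det_mul det_transpose)
  then have d: "\<bar>det B\<bar> = sqrt (det \<Psi>)"
    using pos_def_det[OF assms] dI
    by (intro real_sqrt_unique[symmetric]) (auto simp: power2_eq_square field_simps)
  have q: "(B *v x) \<bullet> (matrix_inv \<Psi> *v (B *v x)) = x \<bullet> x" for x
  proof -
    have "(B *v x) \<bullet> (matrix_inv \<Psi> *v (B *v x)) = x \<bullet> ((transpose B ** matrix_inv \<Psi> ** B) *v x)"
      by (simp only: inner_congruence)
    then show ?thesis by (simp add: B)
  qed
  have BB: "B ** transpose B = \<Psi>"
  proof -
    have "B ** (transpose B ** matrix_inv \<Psi>) = mat 1"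
      using matrix_left_right_inverse B(2) by blast
    then have "B ** transpose B ** (matrix_inv \<Psi> ** \<Psi>) = \<Psi>"
      by (metis matrix_mul_assoc matrix_mul_lid)
    then show ?thesis by (simp add: I)
  qed
  have "density lborel (\<lambda>x. ennreal (mvn_density \<Psi> x)) = distr std_gauss borel (\<lambda>x. B *v x)"
  proof (rule measure_eqI)
    fix E assume "E \<in> sets (density lborel (\<lambda>x. ennreal (mvn_density \<Psi> x)))"
    then have [measurable]: "E \<in> sets borel" by simp
    have dd: "std_gauss_density x = \<bar>det B\<bar> * mvn_density \<Psi> (B *v x)" for x
      unfolding mvn_density_def q std_gauss_density_eq d using pos_def_det[OF assms]
      by (simp add: real_sqrt_mult real_sqrt_power power_mult_distrib)
    have "emeasure (density lborel (\<lambda>x. ennreal (mvn_density \<Psi> x))) E = (\<integral>\<^sup>+x. ennreal (mvn_density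
        \<Psi> x) * indicator E x \<partial>lborel)"
      by (simp add: emeasure_density)
    also have "\<dots> = ennreal \<bar>det B\<bar> * (\<integral>\<^sup>+x. ennreal (mvn_density \<Psi> (B *v x)) * indicator E (B *v x) \<partial>lborel)"
      using B(1) by (intro nn_integral_lborel_matrix[symmetric]) (auto simp: invertible_det_nz)
    also have "\<dots> = (\<integral>\<^sup>+x. ennreal (std_gauss_density x) * indicator E (B *v x) \<partial>lborel)"
      unfolding dd using mvn_density_pos[OF assms]
      by (subst nn_integral_cmult[symmetric]) (auto simp: ennreal_mult mult.assoc less_imp_le)
    also have "\<dots> = (\<integral>\<^sup>+x. indicator E (B *v x) \<partial>std_gauss)"
      unfolding std_gauss_def by (simp add: nn_integral_density)
    also have "\<dots> = emeasure (distr std_gauss borel (\<lambda>x. B *v x)) E"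
      using nn_integral_distr[of "\<lambda>x. B *v x" std_gauss borel "indicator E"] by simp
    finally show "emeasure (density lborel (\<lambda>x. ennreal (mvn_density \<Psi> x))) E = emeasure (distr
        std_gauss borel (\<lambda>x. B *v x)) E" .
  qed simp
  with BB show thesis by (rule that)
qed

lemma prob_space_mvn:
  fixes \<Psi> :: "real^'n^'n"
  assumes "pos_def \<Psi>" shows "prob_space (density lborel (\<lambda>x. ennreal (mvn_density \<Psi> x)))"
proof -
  obtain B :: "real^'n^'n" where B: "density lborel (\<lambda>x. ennreal (mvn_density \<Psi> x)) = distr
      std_gauss borel (\<lambda>x. B *v x)"
    using mvn_eq_distr_std_gauss[OF assms] by blast
  show ?thesis unfolding B by (rule prob_space.prob_space_distr[OF prob_space_std_gauss]) simp
qed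

lemma char_mvn:
  fixes \<Psi> :: "real^'n^'n"
  assumes "pos_def \<Psi>"
  shows "(CLINT x|density lborel (\<lambda>x. ennreal (mvn_density \<Psi> x)). iexp (t \<bullet> x)) = exp (- (t \<bullet> (\<Psi> *v t)) / 2)"
proof -
  obtain B :: "real^'n^'n" where B: "B ** transpose B = \<Psi>" "density lborel (\<lambda>x. ennreal (mvn_density
      \<Psi> x)) = distr std_gauss borel (\<lambda>x. B *v x)"
    using mvn_eq_distr_std_gauss[OF assms] by blast
  have "(CLINT x|density lborel (\<lambda>x. ennreal (mvn_density \<Psi> x)). iexp (t \<bullet> x)) = (CLINT x|std_gauss.
      iexp ((transpose B *v t) \<bullet> x))"
    unfolding B(2) by (subst integral_distr) (auto simp: inner_matrix_vector[of t])
  also have "\<dots> = exp (- (t \<bullet> (\<Psi> *v t)) / 2)"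
    unfolding char_std_gauss B(1)[symmetric] by (simp add: matrix_vector_mul_assoc[symmetric]
        inner_matrix_vector[of t])
  finally show ?thesis .
qed

section \<open>Moments and characteristic functions of Gaussian vectors\<close>

text \<open>Collected in one statement because all parts need the same case distinction: a point
  mass if \<open>\<sigma>\<close> is 0, otherwise a rescaled standard normal law.\<close>

lemma gaussian_measure_moments:
  assumes "0 \<le> \<sigma>"
  shows prob_space_gaussian_measure: "prob_space (gaussian_measure \<mu> \<sigma>)"
    and sets_gaussian_measure: "sets (gaussian_measure \<mu> \<sigma>) = sets borel"
    and integrable_gaussian_measure: "integrable (gaussian_measure \<mu> \<sigma>) (\<lambda>x. x)"
    and integral_gaussian_measure: "(\<integral>x. x \<partial>gaussian_measure \<mu> \<sigma>) = \<mu>"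
    and integrable_gaussian_measure_square: "integrable (gaussian_measure 0 \<sigma>) (\<lambda>x. x\<^sup>2)"
    and integral_gaussian_measure_square: "(\<integral>x. x\<^sup>2 \<partial>gaussian_measure 0 \<sigma>) = \<sigma>\<^sup>2"
    and char_gaussian_measure: "(CLINT x|gaussian_measure 0 \<sigma>. iexp (t * x)) = exp (- (\<sigma>\<^sup>2 * t\<^sup>2) / 2)"
proof -
  have A: "prob_space (gaussian_measure \<mu> \<sigma>) \<and> sets (gaussian_measure \<mu> \<sigma>) = sets borel \<and> integrable
      (gaussian_measure \<mu> \<sigma>) (\<lambda>x. x) \<and>
    (\<integral>x. x \<partial>gaussian_measure \<mu> \<sigma>) = \<mu> \<and> integrable (gaussian_measure 0 \<sigma>) (\<lambda>x. x\<^sup>2) \<and> (\<integral>x. x\<^sup>2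
        \<partial>gaussian_measure 0 \<sigma>) = \<sigma>\<^sup>2 \<and>
    (CLINT x|gaussian_measure 0 \<sigma>. iexp (t * x)) = exp (- (\<sigma>\<^sup>2 * t\<^sup>2) / 2)"
  proof (cases "\<sigma> = 0")
    case True
    have I: "integrable (return borel a) f" if [measurable]: "f \<in> borel_measurable borel" for a ::
        real and f :: "real \<Rightarrow> real"
      by (rule integrableI_bounded) (simp_all add: nn_integral_return)
    have "integrable (return borel \<mu>) (\<lambda>x. x)" by (rule I) measurable
    moreover have "integrable (return borel (0::real)) (\<lambda>x. x\<^sup>2)" by (rule I) measurable
    moreover have "prob_space (return borel \<mu>)" by (rule prob_space_return) simp
    moreover have "(CLINT x|return borel (0::real). iexp (t * x)) = 1"
      by (subst integral_return) simp_all
    moreover have "(\<integral>x. x \<partial>return borel \<mu>) = \<mu>" "(\<integral>x. x\<^sup>2 \<partial>return borel (0::real)) = 0"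
      by (subst integral_return; simp)+
    ultimately show ?thesis unfolding gaussian_measure_def using True by auto
  next
    case False
    with assms have \<sigma>: "0 < \<sigma>" by simp
    then have G: "gaussian_measure \<mu> \<sigma> = density lborel (normal_density \<mu> \<sigma>)" for \<mu>
      by (simp add: gaussian_measure_def)
    interpret S: prob_space std_normal_distribution
      by (rule prob_space_normal_density) simp
    have "distributed std_normal_distribution lborel (\<lambda>x. x) std_normal_density"
      unfolding distributed_def by (auto simp: distr_id2)
    from S.normal_density_affine[OF this, of \<sigma> 0] \<sigma>
    have "distributed std_normal_distribution lborel (\<lambda>x. \<sigma> * x) (normal_density 0 \<sigma>)" by simp
    then have D: "density lborel (normal_density 0 \<sigma>) = distr std_normal_distribution lborel (\<lambda>x. \<sigma> * x)"
      by (simp add: distributed_def)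
    have "(CLINT x|gaussian_measure 0 \<sigma>. iexp (t * x)) = char std_normal_distribution (t * \<sigma>)"
      unfolding G D char_def by (subst integral_distr) (auto simp: mult.assoc)
    also have "\<dots> = exp (- (\<sigma>\<^sup>2 * t\<^sup>2) / 2)"
      by (simp add: char_std_normal_distribution power_mult_distrib mult.commute)
    finally have "(CLINT x|gaussian_measure 0 \<sigma>. iexp (t * x)) = exp (- (\<sigma>\<^sup>2 * t\<^sup>2) / 2)" .
    moreover have "integrable lborel (\<lambda>x. normal_density 0 \<sigma> x * x\<^sup>2)"
      using integrable_normal_moment[OF \<sigma>, of 0 2] by simp
    moreover have "(\<integral>x. normal_density 0 \<sigma> x * x\<^sup>2 \<partial>lborel) = \<sigma>\<^sup>2"
      using integral_normal_moment_even[OF \<sigma>, of 0 1] \<sigma> by (simp add: numeral_2_eq_2)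
    ultimately show ?thesis
      using \<sigma> integrable_normal_moment_nz_1[OF \<sigma>, of \<mu>] integral_normal_moment_nz_1[OF \<sigma>, of \<mu>]
      by (simp add: G prob_space_normal_density integrable_density integral_density)
  qed
  then show "prob_space (gaussian_measure \<mu> \<sigma>)" "sets (gaussian_measure \<mu> \<sigma>) = sets borel"
    "integrable (gaussian_measure \<mu> \<sigma>) (\<lambda>x. x)" "(\<integral>x. x \<partial>gaussian_measure \<mu> \<sigma>) = \<mu>"
    "integrable (gaussian_measure 0 \<sigma>) (\<lambda>x. x\<^sup>2)" "(\<integral>x. x\<^sup>2 \<partial>gaussian_measure 0 \<sigma>) = \<sigma>\<^sup>2"
    "(CLINT x|gaussian_measure 0 \<sigma>. iexp (t * x)) = exp (- (\<sigma>\<^sup>2 * t\<^sup>2) / 2)"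
    by blast+
qed

text \<open>Gaussian vectors are defined through their one-dimensional projections, so the
  characteristic function at t is that of the projection on t, with variance equal to its second
  moment. No density is involved and the covariance may be singular.\<close>

lemma gaussian_vector_char:
  fixes X :: "'a \<Rightarrow> 'b::euclidean_space"
  assumes "gaussian_vector M X" and mean: "integral\<^sup>L M X = 0"
  shows "integrable M (\<lambda>\<omega>. (t \<bullet> X \<omega>)\<^sup>2)" "integrable M (\<lambda>\<omega>. t \<bullet> X \<omega>)"
    "(CLINT \<omega>|M. iexp (t \<bullet> X \<omega>)) = exp (- (\<integral>\<omega>. (t \<bullet> X \<omega>)\<^sup>2 \<partial>M) / 2)"
proof -
  have X [measurable]: "X \<in> borel_measurable M" using assms(1) by (simp add: gaussian_vector_def)
  have ex: "\<exists>\<mu> \<sigma>. 0 \<le> \<sigma> \<and> distr M borel (\<lambda>\<omega>. a \<bullet> X \<omega>) = gaussian_measure \<mu> \<sigma>" for a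
    using assms(1) by (simp add: gaussian_vector_def)
  have int: "integrable M (\<lambda>\<omega>. a \<bullet> X \<omega>)" for a
  proof -
    obtain \<mu> \<sigma> where "0 \<le> \<sigma>" "distr M borel (\<lambda>\<omega>. a \<bullet> X \<omega>) = gaussian_measure \<mu> \<sigma>" using ex by blast
    then have "integrable (distr M borel (\<lambda>\<omega>. a \<bullet> X \<omega>)) (\<lambda>x. x)"
      by (simp add: integrable_gaussian_measure)
    then show ?thesis by (simp add: integrable_distr_eq)
  qed
  \<comment> \<open>Integrability must be established separately: an integral equal to 0 would also
    be the default value for a non-integrable X. With it, the mean of each projection is the
    projection of the mean.\<close>
  have "integrable M (\<lambda>\<omega>. \<Sum>b\<in>Basis. (b \<bullet> X \<omega>) *\<^sub>R b)" using int by auto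
  then have "integrable M X" by (simp add: inner_commute[of _ "X _"] euclidean_representation)
  then have m: "(\<integral>\<omega>. t \<bullet> X \<omega> \<partial>M) = 0" by (simp add: mean)
  obtain \<mu> \<sigma> where \<sigma>: "0 \<le> \<sigma>" and D: "distr M borel (\<lambda>\<omega>. t \<bullet> X \<omega>) = gaussian_measure \<mu> \<sigma>" using ex by blast
  have "(\<integral>\<omega>. t \<bullet> X \<omega> \<partial>M) = (\<integral>x. x \<partial>distr M borel (\<lambda>\<omega>. t \<bullet> X \<omega>))" by (simp add: integral_distr)
  then have [simp]: "\<mu> = 0" unfolding D using m by (simp add: integral_gaussian_measure \<sigma>)
  have "integrable (distr M borel (\<lambda>\<omega>. t \<bullet> X \<omega>)) (\<lambda>x. x\<^sup>2)"
    unfolding D using \<sigma> by (simp add: integrable_gaussian_measure_square)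
  then show "integrable M (\<lambda>\<omega>. (t \<bullet> X \<omega>)\<^sup>2)" by (simp add: integrable_distr_eq)
  have "(\<integral>\<omega>. (t \<bullet> X \<omega>)\<^sup>2 \<partial>M) = (\<integral>x. x\<^sup>2 \<partial>distr M borel (\<lambda>\<omega>. t \<bullet> X \<omega>))" by (simp add: integral_distr)
  also have "\<dots> = \<sigma>\<^sup>2" unfolding D using \<sigma> by (simp add: integral_gaussian_measure_square)
  finally have v: "(\<integral>\<omega>. (t \<bullet> X \<omega>)\<^sup>2 \<partial>M) = \<sigma>\<^sup>2" .
  have "(CLINT \<omega>|M. iexp (t \<bullet> X \<omega>)) = (CLINT x|distr M borel (\<lambda>\<omega>. t \<bullet> X \<omega>). iexp (1 * x))"
    by (simp add: integral_distr)
  also have "\<dots> = exp (- (\<sigma>\<^sup>2 * 1\<^sup>2) / 2)" unfolding D \<open>\<mu> = 0\<close> by (rule char_gaussian_measure[OF \<sigma>])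
  finally show "(CLINT \<omega>|M. iexp (t \<bullet> X \<omega>)) = exp (- (\<integral>\<omega>. (t \<bullet> X \<omega>)\<^sup>2 \<partial>M) / 2)" by (simp add: v)
  show "integrable M (\<lambda>\<omega>. t \<bullet> X \<omega>)" by (rule int)
qed

text \<open>The characteristic function identifies the law as centred normal with variance q, whose
  moments are known.\<close>

lemma (in prob_space) second_moment_of_char:
  fixes Y :: "'a \<Rightarrow> real"
  assumes [measurable]: "Y \<in> borel_measurable M" and q: "0 \<le> q"
    and char: "\<And>t. (CLINT \<omega>|M. iexp (t * Y \<omega>)) = exp (- (q * t\<^sup>2) / 2)"
  shows "integrable M (\<lambda>\<omega>. (Y \<omega>)\<^sup>2)" "(\<integral>\<omega>. (Y \<omega>)\<^sup>2 \<partial>M) = q"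
    "integrable M Y" "(\<integral>\<omega>. Y \<omega> \<partial>M) = 0"
proof -
  have \<sigma>: "0 \<le> sqrt q" using q by simp
  have D: "distr M borel Y = gaussian_measure 0 (sqrt q)"
  proof (rule char_uniqueness_euclidean)
    show "prob_space (distr M borel Y)" by (rule prob_space_distr) simp
    fix t
    show "(CLINT x|distr M borel Y. iexp (t \<bullet> x)) = (CLINT x|gaussian_measure 0 (sqrt q). iexp (t \<bullet> x))"
      using char_gaussian_measure[OF \<sigma>, of t] char[of t] q by (simp add: integral_distr)
  qed (simp_all add: prob_space_gaussian_measure sets_gaussian_measure q)
  have "integrable (distr M borel Y) (\<lambda>x. x\<^sup>2)" "(\<integral>x. x\<^sup>2 \<partial>distr M borel Y) = q"
    "integrable (distr M borel Y) (\<lambda>x. x)" "(\<integral>x. x \<partial>distr M borel Y) = 0"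
    unfolding D using q
    by (simp_all add: integrable_gaussian_measure_square integral_gaussian_measure_square
        integrable_gaussian_measure integral_gaussian_measure)
  note m = this
  show "integrable M (\<lambda>\<omega>. (Y \<omega>)\<^sup>2)" using m(1) by (subst (asm) integrable_distr_eq) simp_all
  show "(\<integral>\<omega>. (Y \<omega>)\<^sup>2 \<partial>M) = q" using m(2) by (subst (asm) integral_distr) simp_all
  show "integrable M Y" using m(3) by (subst (asm) integrable_distr_eq) simp_all
  show "(\<integral>\<omega>. Y \<omega> \<partial>M) = 0" using m(4) by (subst (asm) integral_distr) simp_all
qed

text \<open>The scalar variable \<open>a \<bullet> x\<close> has a known characteristic function,
  which spares any integration of polynomials against the density.\<close>

lemma mvn_second_moment:
  fixes \<Psi> :: "real^'n^'n"
  assumes "pos_def \<Psi>"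
  shows "integrable (density lborel (\<lambda>x. ennreal (mvn_density \<Psi> x))) (\<lambda>x. (a \<bullet> x)\<^sup>2)"
    "(\<integral>x. (a \<bullet> x)\<^sup>2 \<partial>density lborel (\<lambda>x. ennreal (mvn_density \<Psi> x))) = a \<bullet> (\<Psi> *v a)"
    "integrable (density lborel (\<lambda>x. ennreal (mvn_density \<Psi> x))) (\<lambda>x. a \<bullet> x)"
    "(\<integral>x. a \<bullet> x \<partial>density lborel (\<lambda>x. ennreal (mvn_density \<Psi> x))) = 0"
proof -
  interpret prob_space "density lborel (\<lambda>x. ennreal (mvn_density \<Psi> x))" by (rule prob_space_mvn[OF assms])
  have q: "0 \<le> a \<bullet> (\<Psi> *v a)" using pos_def_psd[OF assms] by (simp add: psd_def)
  have c: "(CLINT x|density lborel (\<lambda>x. ennreal (mvn_density \<Psi> x)). iexp (t * (a \<bullet> x))) = exp (- ((a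
      \<bullet> (\<Psi> *v a)) * t\<^sup>2) / 2)" for t
    using char_mvn[OF assms, of "t *\<^sub>R a"] by (simp add: matrix_vector_mult_scaleR power2_eq_square mult_ac)
  have m: "(\<lambda>x. a \<bullet> x) \<in> borel_measurable (density lborel (\<lambda>x. ennreal (mvn_density \<Psi> x)))" by simp
  note s = second_moment_of_char[OF m q c]
  show "integrable (density lborel (\<lambda>x. ennreal (mvn_density \<Psi> x))) (\<lambda>x. (a \<bullet> x)\<^sup>2)" by (rule s)
  show "(\<integral>x. (a \<bullet> x)\<^sup>2 \<partial>density lborel (\<lambda>x. ennreal (mvn_density \<Psi> x))) = a \<bullet> (\<Psi> *v a)" by (rule s)
  show "integrable (density lborel (\<lambda>x. ennreal (mvn_density \<Psi> x))) (\<lambda>x. a \<bullet> x)" by (rule s)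
  show "(\<integral>x. a \<bullet> x \<partial>density lborel (\<lambda>x. ennreal (mvn_density \<Psi> x))) = 0" by (rule s)
qed

section \<open>The innovations of the noise\<close>

lemma borel_measurable_matrix_vector [measurable (raw)]:
  "f \<in> borel_measurable M \<Longrightarrow> (\<lambda>x. (A :: real^'n^'m) *v f x) \<in> borel_measurable M"
  by (rule measurable_compose[OF _ matrix_vector_measurable])

lemma borel_measurable_fst_snd:
  fixes f :: "'a \<Rightarrow> 'b::second_countable_topology \<times> 'c::second_countable_topology"
  assumes "f \<in> borel_measurable M"
  shows "(\<lambda>x. fst (f x)) \<in> borel_measurable M" "(\<lambda>x. snd (f x)) \<in> borel_measurable M"
  by (rule measurable_compose[OF assms], intro borel_measurable_continuous_onI continuous_intros)+

lemma transpose_plus: "transpose (A + B) = transpose A + transpose B"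
  by (simp add: transpose_def vec_eq_iff)

lemma integral_pair_mult:
  fixes f :: "'a \<Rightarrow> complex"
  assumes "prob_space A" "prob_space B" and [measurable]: "f \<in> borel_measurable A" "g \<in> borel_measurable B"
    and bd: "\<And>x. norm (f x) \<le> 1" "\<And>y. norm (g y) \<le> 1"
  shows "(CLINT z|A \<Otimes>\<^sub>M B. f (fst z) * g (snd z)) = (CLINT x|A. f x) * (CLINT y|B. g y)"
proof -
  interpret A: prob_space A by fact
  interpret B: prob_space B by fact
  interpret P: pair_prob_space A B ..
  have "norm (f x * g y) \<le> 1" for x y
    using mult_mono[OF bd(1) bd(2)] by (simp add: norm_mult)
  then have "integrable (A \<Otimes>\<^sub>M B) (\<lambda>z. f (fst z) * g (snd z))"
    by (intro P.P.integrable_const_bound[of _ 1]) auto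
  from P.integral_fst'[OF this] show ?thesis by simp
qed

lemma char_pair:
  fixes A :: "'b::euclidean_space measure" and B :: "'c::euclidean_space measure"
  assumes "prob_space A" "prob_space B" "sets A = sets borel" "sets B = sets borel"
  shows "(CLINT z|A \<Otimes>\<^sub>M B. iexp ((a, b) \<bullet> z)) = (CLINT x|A. iexp (a \<bullet> x)) * (CLINT y|B. iexp (b \<bullet> y))"
proof -
  note [measurable_cong] = assms(3,4)
  have "(CLINT z|A \<Otimes>\<^sub>M B. iexp ((a, b) \<bullet> z)) = (CLINT z|A \<Otimes>\<^sub>M B. iexp (a \<bullet> fst z) * iexp (b \<bullet> snd z))"
    by (simp add: inner_prod_def exp_add[symmetric] distrib_left)
  also have "\<dots> = (CLINT x|A. iexp (a \<bullet> x)) * (CLINT y|B. iexp (b \<bullet> y))"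
    by (rule integral_pair_mult) (simp_all add: assms)
  finally show ?thesis .
qed

lemma inner_transpose_matrix: "(transpose A *v x) \<bullet> y = x \<bullet> (A *v (y :: real^'n))"
  for x :: "real^'m"
  by (rule inner_matrix_vector[symmetric])

text \<open>Completion of the square behind one step of the Kalman filter. The left side is the
  variance of a times the innovation plus b times the next prediction error, expressed in the
  current error and the driving noise. The right side has no term mixing a and b, which is what
  makes the two independent.\<close>

lemma quadratic_kalman:
  fixes F :: "real^'d^'d" and G :: "real^'q^'d" and H :: "real^'d^'p"
    and W :: "real^'q^'q" and V :: "real^'p^'p" and L :: "real^'p^'q" and S :: "real^'d^'d"
    and a :: "real^'p" and b :: "real^'d"
  defines "\<Psi> \<equiv> innov_cov H V S" and "K \<equiv> predictor_gain F G H V L S"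
  assumes S: "transpose S = S" and W: "transpose W = W" and V: "transpose V = V" and inv: "invertible \<Psi>"
  defines "c \<equiv> a - transpose K *v b"
  defines "\<alpha> \<equiv> transpose H *v c + transpose F *v b"
  shows "\<alpha> \<bullet> (S *v \<alpha>) + ((transpose G *v b) \<bullet> (W *v (transpose G *v b)) + 2 * ((transpose G *v b) \<bullet>
      (L *v c)) + c \<bullet> (V *v c))
    = a \<bullet> (\<Psi> *v a) + b \<bullet> (riccati_step F G H W V L S *v b)"
proof -
  note [simp del] = transpose_matrix_vector
  have K: "K ** \<Psi> = F ** S ** transpose H + G ** L"
    unfolding K_def predictor_gain_def \<Psi>_def[symmetric]
    by (simp add: matrix_mul_assoc[symmetric] matrix_inv_mult[OF inv])
  have \<Psi>sym: "transpose \<Psi> = \<Psi>"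
    using S V unfolding \<Psi>_def innov_cov_def
    by (simp add: transpose_plus matrix_transpose_mul matrix_mul_assoc)
  have S': "x \<bullet> (S *v y) = y \<bullet> (S *v x)" for x y
    by (metis S inner_commute inner_matrix_vector)
  have P': "x \<bullet> (\<Psi> *v y) = y \<bullet> (\<Psi> *v x)" for x y
    by (metis \<Psi>sym inner_commute inner_matrix_vector)
  have 1: "c \<bullet> (\<Psi> *v c) = (transpose H *v c) \<bullet> (S *v (transpose H *v c)) + c \<bullet> (V *v c)"
    unfolding \<Psi>_def innov_cov_def
    by (simp add: matrix_vector_mult_add_rdistrib inner_add_right matrix_vector_mul_assoc[symmetric]
        inner_transpose_matrix)
  have 2: "b \<bullet> ((K ** \<Psi>) *v c) = (transpose F *v b) \<bullet> (S *v (transpose H *v c)) + (transpose G *v b)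
      \<bullet> (L *v c)"
    unfolding K
    by (simp add: matrix_vector_mult_add_rdistrib inner_add_right matrix_vector_mul_assoc[symmetric]
        inner_transpose_matrix)
  have 3: "b \<bullet> (riccati_step F G H W V L S *v b) = (transpose F *v b) \<bullet> (S *v (transpose F *v b))
     + (transpose G *v b) \<bullet> (W *v (transpose G *v b)) - (transpose K *v b) \<bullet> (\<Psi> *v (transpose K *v b))"
    unfolding riccati_step_def \<Psi>_def[symmetric] K_def[symmetric]
    by (simp add: matrix_vector_mult_add_rdistrib matrix_vector_mult_diff_rdistrib inner_add_right
        inner_diff_right matrix_vector_mul_assoc[symmetric] inner_transpose_matrix)
  have 4: "b \<bullet> ((K ** \<Psi>) *v c) = (transpose K *v b) \<bullet> (\<Psi> *v c)"
    by (simp add: matrix_vector_mul_assoc[symmetric] inner_transpose_matrix)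
  have 5: "a \<bullet> (\<Psi> *v a) = c \<bullet> (\<Psi> *v c) + 2 * ((transpose K *v b) \<bullet> (\<Psi> *v c)) + (transpose K *v b) \<bullet>
      (\<Psi> *v (transpose K *v b))"
  proof -
    have a: "a = c + transpose K *v b" by (simp add: c_def)
    show ?thesis
      unfolding a using P'[of c "transpose K *v b"] by (simp add: matrix_vector_right_distrib
          inner_add_left inner_add_right)
  qed
  have 6: "\<alpha> \<bullet> (S *v \<alpha>) = (transpose H *v c) \<bullet> (S *v (transpose H *v c)) + 2 * ((transpose F *v b) \<bullet>
      (S *v (transpose H *v c)))
      + (transpose F *v b) \<bullet> (S *v (transpose F *v b))"
    unfolding \<alpha>_def using S'[of "transpose H *v c" "transpose F *v b"]
    by (simp add: matrix_vector_right_distrib inner_add_left inner_add_right)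
  show ?thesis using 1 2 3 4 5 6 by linarith
qed

text \<open>\<open>\<rho>\<close> is the law of the prediction error and \<open>\<mu>\<close> that
  of the driving noise. Since S may be singular, \<open>\<rho>\<close> is described by its
  characteristic function; \<open>\<rho>'\<close> has the same form with the next Riccati iterate,
  so the step can be repeated.\<close>

lemma kalman_step_law:
  fixes F :: "real^'d^'d" and G :: "real^'q^'d" and H :: "real^'d^'p"
    and W :: "real^'q^'q" and V :: "real^'p^'p" and L :: "real^'p^'q" and S :: "real^'d^'d"
    and \<rho> :: "(real^'d) measure" and \<mu> :: "((real^'q) \<times> (real^'p)) measure"
  defines "\<Psi> \<equiv> innov_cov H V S" and "K \<equiv> predictor_gain F G H V L S"
  assumes S: "transpose S = S" and W: "transpose W = W" and V: "transpose V = V" and \<Psi>: "pos_def \<Psi>"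
    and \<rho>: "prob_space \<rho>" "sets \<rho> = sets borel" "\<And>t. (CLINT x|\<rho>. iexp (t \<bullet> x)) = exp (- (t \<bullet> (S *v t)) / 2)"
    and \<mu>: "prob_space \<mu>" "sets \<mu> = sets borel"
      "\<And>a b. (CLINT x|\<mu>. iexp ((a, b) \<bullet> x)) = exp (- (a \<bullet> (W *v a) + 2 * (a \<bullet> (L *v b)) + b \<bullet> (V *v b)) / 2)"
  obtains \<rho>' where "prob_space \<rho>'" "sets \<rho>' = sets borel"
    "\<And>t. (CLINT x|\<rho>'. iexp (t \<bullet> x)) = exp (- (t \<bullet> (riccati_step F G H W V L S *v t)) / 2)"
    "distr (\<rho> \<Otimes>\<^sub>M \<mu>) borel (\<lambda>z. (H *v fst z + snd (snd z), F *v fst z + G *v fst (snd z) - K *v (H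
        *v fst z + snd (snd z))))
      = density lborel (\<lambda>x. ennreal (mvn_density \<Psi> x)) \<Otimes>\<^sub>M \<rho>'"
proof -
  note [measurable_cong] = \<rho>(2) \<mu>(2)
  interpret \<rho>: prob_space \<rho> by fact
  interpret \<mu>: prob_space \<mu> by fact
  interpret P: pair_prob_space \<rho> \<mu> ..
  let ?T = "\<lambda>z::(real^'d) \<times> ((real^'q) \<times> (real^'p)). (H *v fst z + snd (snd z), F *v fst z + G *v
      fst (snd z) - K *v (H *v fst z + snd (snd z)))"
  let ?N = "density lborel (\<lambda>x. ennreal (mvn_density \<Psi> x))"
  define \<rho>' where "\<rho>' = distr (\<rho> \<Otimes>\<^sub>M \<mu>) borel (\<lambda>z. snd (?T z))"
  have [measurable]: "(\<lambda>z. fst (snd z)) \<in> borel_measurable (\<rho> \<Otimes>\<^sub>M \<mu>)" "(\<lambda>z. snd (snd z)) \<in>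
      borel_measurable (\<rho> \<Otimes>\<^sub>M \<mu>)"
    by (rule borel_measurable_fst_snd; measurable)+
  have T[measurable]: "?T \<in> borel_measurable (\<rho> \<Otimes>\<^sub>M \<mu>)" by (intro borel_measurable_Pair) measurable
  have inv: "invertible \<Psi>" by (rule pos_def_invertible[OF \<Psi>])
  have ch: "(CLINT z|\<rho> \<Otimes>\<^sub>M \<mu>. iexp ((a, b) \<bullet> ?T z)) = exp (- (a \<bullet> (\<Psi> *v a)) / 2) * exp (- (b \<bullet>
      (riccati_step F G H W V L S *v b)) / 2)" for a b
  proof -
    let ?c = "a - transpose K *v b"
    let ?\<alpha> = "transpose H *v ?c + transpose F *v b"
    have "(a, b) \<bullet> ?T z = (?\<alpha>, (transpose G *v b, ?c)) \<bullet> z" for z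
      by (simp add: inner_prod_def inner_add_left inner_add_right inner_diff_left inner_diff_right
          inner_transpose_matrix
          matrix_vector_right_distrib matrix_vector_mult_diff_distrib del: transpose_matrix_vector)
    then have "(CLINT z|\<rho> \<Otimes>\<^sub>M \<mu>. iexp ((a, b) \<bullet> ?T z)) = (CLINT z|\<rho> \<Otimes>\<^sub>M \<mu>. iexp ((?\<alpha>, (transpose G
        *v b, ?c)) \<bullet> z))"
      by (simp only:)
    also have "\<dots> = complex_of_real (exp (- (a \<bullet> (\<Psi> *v a) + b \<bullet> (riccati_step F G H W V L S *v b)) / 2))"
      unfolding char_pair[OF \<rho>(1) \<mu>(1) \<rho>(2) \<mu>(2)] \<rho>(3) \<mu>(3)
      using quadratic_kalman[OF S W V, where H=H and F=F and G=G and L=L and a=a and b=b, folded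
          \<Psi>_def K_def, OF inv]
      by (simp flip: of_real_mult exp_add add: field_simps del: transpose_matrix_vector)
    finally show ?thesis by (simp flip: of_real_mult exp_add add: diff_divide_distrib)
  qed
  have ch': "(CLINT x|\<rho>'. iexp (t \<bullet> x)) = exp (- (t \<bullet> (riccati_step F G H W V L S *v t)) / 2)" for t
    unfolding \<rho>'_def using ch[of 0 t] by (subst integral_distr) (simp_all add: inner_prod_def)
  have \<rho>': "prob_space \<rho>'" "sets \<rho>' = sets borel"
    unfolding \<rho>'_def by (auto intro!: P.P.prob_space_distr)
  have N: "prob_space ?N" "sets ?N = sets borel" using prob_space_mvn[OF \<Psi>] by auto
  interpret N: prob_space ?N by fact
  interpret \<rho>': prob_space \<rho>' by fact
  interpret P': pair_prob_space ?N \<rho>' ..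
  have "distr (\<rho> \<Otimes>\<^sub>M \<mu>) borel ?T = ?N \<Otimes>\<^sub>M \<rho>'"
  proof (rule char_uniqueness_euclidean)
    show "prob_space (distr (\<rho> \<Otimes>\<^sub>M \<mu>) borel ?T)" by (rule P.P.prob_space_distr) (rule T)
    show "prob_space (?N \<Otimes>\<^sub>M \<rho>')" by (rule P'.P.prob_space_axioms)
    show "sets (?N \<Otimes>\<^sub>M \<rho>') = sets borel"
      using sets_pair_measure_cong[OF N(2) \<rho>'(2)] unfolding borel_prod .
    fix t :: "(real^'p) \<times> (real^'d)"
    have "(CLINT x|distr (\<rho> \<Otimes>\<^sub>M \<mu>) borel ?T. iexp (t \<bullet> x)) = (CLINT z|\<rho> \<Otimes>\<^sub>M \<mu>. iexp (t \<bullet> ?T z))"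
      by (rule integral_distr[OF T]) measurable
    also have "\<dots> = (CLINT x|?N \<Otimes>\<^sub>M \<rho>'. iexp (t \<bullet> x))"
      using ch[of "fst t" "snd t"] char_pair[OF N(1) \<rho>'(1) N(2) \<rho>'(2), of "fst t" "snd t"]
      unfolding char_mvn[OF \<Psi>] ch' by simp
    finally show "(CLINT x|distr (\<rho> \<Otimes>\<^sub>M \<mu>) borel ?T. iexp (t \<bullet> x)) = (CLINT x|?N \<Otimes>\<^sub>M \<rho>'. iexp (t \<bullet> x))" .
  qed simp
  with \<rho>' ch' show thesis by (rule that)
qed

lemma indep_rv_distr:
  assumes "prob_space M" "indep_rv M N X N' Y"
  shows "distr M (N \<Otimes>\<^sub>M N') (\<lambda>\<omega>. (X \<omega>, Y \<omega>)) = distr M N X \<Otimes>\<^sub>M distr M N' Y"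
proof -
  interpret prob_space M by fact
  have X [measurable]: "X \<in> measurable M N" and Y [measurable]: "Y \<in> measurable M N'"
    and ind: "indep_set {X -` A \<inter> space M | A. A \<in> sets N} {Y -` B \<inter> space M | B. B \<in> sets N'}"
    using assms(2) by (auto simp: indep_rv_def)
  interpret X: prob_space "distr M N X" by (rule prob_space_distr) simp
  interpret Y: prob_space "distr M N' Y" by (rule prob_space_distr) simp
  have "distr M N X \<Otimes>\<^sub>M distr M N' Y = distr M (N \<Otimes>\<^sub>M N') (\<lambda>\<omega>. (X \<omega>, Y \<omega>))"
  proof (rule pair_measure_eqI)
    fix A B assume "A \<in> sets (distr M N X)" "B \<in> sets (distr M N' Y)"
    then have [measurable]: "A \<in> sets N" "B \<in> sets N'" by auto
    have "prob ((X -` A \<inter> space M) \<inter> (Y -` B \<inter> space M)) = prob (X -` A \<inter> space M) * prob (Y -` B \<inter> space M)"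
      by (rule indep_setD[OF ind]) auto
    moreover have "(\<lambda>\<omega>. (X \<omega>, Y \<omega>)) -` (A \<times> B) \<inter> space M = (X -` A \<inter> space M) \<inter> (Y -` B \<inter> space M)" by auto
    ultimately show "emeasure (distr M N X) A * emeasure (distr M N' Y) B = emeasure (distr M (N \<Otimes>\<^sub>M
        N') (\<lambda>\<omega>. (X \<omega>, Y \<omega>))) (A \<times> B)"
      by (simp add: emeasure_distr emeasure_eq_measure ennreal_mult[symmetric])
  qed (auto intro: X.sigma_finite_measure_axioms Y.sigma_finite_measure_axioms)
  then show ?thesis by simp
qed

text \<open>The deviation of the noise state from its one-step prediction. It satisfies a recursion
  of its own in the driving noise, in which the prediction does not occur, so its law can be
  propagated by itself.\<close>

primrec pred_error ::
    "real^'d^'d \<Rightarrow> real^'q^'d \<Rightarrow> real^'d^'p \<Rightarrow> (nat \<Rightarrow> real^'p^'d) \<Rightarrow> real^'d \<Rightarrow> (nat \<Rightarrow> real^'q) \<Rightarrow> (nat \<Rightarrow> real^'p)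
     \<Rightarrow> nat \<Rightarrow> real^'d" where
  "pred_error F G H K x w v 0 = x"
| "pred_error F G H K x w v (Suc i) = F *v pred_error F G H K x w v i + G *v w i
     - K i *v (H *v pred_error F G H K x w v i + v i)"

definition innovation ::
    "real^'d^'d \<Rightarrow> real^'q^'d \<Rightarrow> real^'d^'p \<Rightarrow> (nat \<Rightarrow> real^'p^'d) \<Rightarrow> real^'d \<Rightarrow> (nat \<Rightarrow> real^'q) \<Rightarrow> (nat \<Rightarrow> real^'p)
     \<Rightarrow> nat \<Rightarrow> real^'p" where
  "innovation F G H K x w v i = H *v pred_error F G H K x w v i + v i"

lemma riccati_seq_symmetric:
  assumes "transpose S0 = S0" "transpose W = W" and P: "\<And>i. pos_def (innov_cov H V (riccati_seq F G
      H W V L S0 i))"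
  shows "transpose (riccati_seq F G H W V L S0 i) = riccati_seq F G H W V L S0 i"
proof (induction i)
  case (Suc i)
  have tm: "transpose (A - B) = transpose A - transpose B" for A B :: "real^'d^'d"
    by (simp add: transpose_def vec_eq_iff)
  have "transpose (innov_cov H V (riccati_seq F G H W V L S0 i)) = innov_cov H V (riccati_seq F G H
      W V L S0 i)"
    using P by (simp add: pos_def_def)
  with Suc assms(2) show ?case
    by (simp add: riccati_step_def tm transpose_plus matrix_transpose_mul matrix_mul_assoc)
qed (simp add: assms)

text \<open>The induction carries along the whole future of the driving noise, so that independence of the next
  step comes from splitting off the first component of an infinite product measure.\<close>

lemma innovations_distr:
  fixes F :: "real^'d^'d" and G :: "real^'q^'d" and H :: "real^'d^'p"
    and W :: "real^'q^'q" and V :: "real^'p^'p" and L :: "real^'p^'q" and S0 :: "real^'d^'d"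
    and x0 :: "'a \<Rightarrow> real^'d" and w :: "nat \<Rightarrow> 'a \<Rightarrow> real^'q" and v :: "nat \<Rightarrow> 'a \<Rightarrow> real^'p"
  defines "S \<equiv> riccati_seq F G H W V L S0"
  defines "K \<equiv> \<lambda>i. predictor_gain F G H V L (S i)"
  defines "e \<equiv> \<lambda>i \<omega>. innovation F G H K (x0 \<omega>) (\<lambda>i. w i \<omega>) (\<lambda>i. v i \<omega>) i"
  defines "N \<equiv> \<lambda>i. density lborel (\<lambda>x. ennreal (mvn_density (innov_cov H V (S i)) x))"
  assumes M: "prob_space M" and iid: "iid M (\<lambda>i \<omega>. (w i \<omega>, v i \<omega>))"
    and ind: "indep_rv M borel x0 (Pi\<^sub>M UNIV (\<lambda>_. borel)) (\<lambda>\<omega> i. (w i \<omega>, v i \<omega>))"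
    and sym: "transpose S0 = S0" "transpose W = W" "transpose V = V"
    and pos: "\<And>i. pos_def (innov_cov H V (S i))"
    and charx: "\<And>t. (CLINT \<omega>|M. iexp (t \<bullet> x0 \<omega>)) = exp (- (t \<bullet> (S0 *v t)) / 2)"
    and charu: "\<And>a b. (CLINT \<omega>|M. iexp ((a, b) \<bullet> (w 0 \<omega>, v 0 \<omega>))) = exp (- (a \<bullet> (W *v a) + 2 * (a \<bullet>
        (L *v b)) + b \<bullet> (V *v b)) / 2)"
  shows "distr M (Pi\<^sub>M {..<n} (\<lambda>_. borel)) (\<lambda>\<omega>. \<lambda>i\<in>{..<n}. e i \<omega>) = Pi\<^sub>M {..<n} N"
    and "\<And>i. e i \<in> borel_measurable M"
proof -
  interpret prob_space M by fact
  define U where "U = (\<lambda>\<omega> i. (w i \<omega>, v i \<omega>))"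
  let ?B = "Pi\<^sub>M UNIV (\<lambda>_. borel) :: (nat \<Rightarrow> (real^'q) \<times> (real^'p)) measure"
  have indv: "indep_vars (\<lambda>_. borel) (\<lambda>i \<omega>. (w i \<omega>, v i \<omega>)) UNIV"
    and idd: "distr M borel (\<lambda>\<omega>. (w i \<omega>, v i \<omega>)) = distr M borel (\<lambda>\<omega>. (w j \<omega>, v j \<omega>))" for i j
    using iid by (auto simp: iid_def)
  have x0 [measurable]: "x0 \<in> borel_measurable M" and U [measurable]: "U \<in> measurable M ?B"
    using ind by (auto simp: indep_rv_def U_def)
  have Ui: "(\<lambda>\<omega>. (w i \<omega>, v i \<omega>)) \<in> borel_measurable M" for i
    using indv by (auto simp: indep_vars_def)
  have [measurable]: "w i \<in> borel_measurable M" "v i \<in> borel_measurable M" for i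
    using borel_measurable_fst_snd[OF Ui] by auto
  define \<mu> where "\<mu> = distr M borel (\<lambda>\<omega>. (w 0 \<omega>, v 0 \<omega>))"
  have \<mu>: "prob_space \<mu>" "sets \<mu> = sets borel" "space \<mu> = UNIV"
    unfolding \<mu>_def using Ui by (auto intro: prob_space_distr)
  have \<mu>c: "(CLINT x|\<mu>. iexp ((a, b) \<bullet> x)) = exp (- (a \<bullet> (W *v a) + 2 * (a \<bullet> (L *v b)) + b \<bullet> (V *v
      b)) / 2)" for a b
    unfolding \<mu>_def using charu[of a b] by (subst integral_distr[OF Ui]) simp_all
  interpret \<mu>: prob_space \<mu> by fact
  interpret Sq: sequence_space \<mu> ..
  note [measurable_cong] = \<mu>(2)
  have Ss [measurable_cong]: "sets Sq.S = sets ?B" by (rule sets_PiM_cong) (auto simp: \<mu>)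
  interpret NP: product_prob_space N "{..<i}" for i :: nat
    by (intro product_prob_spaceI) (simp add: N_def prob_space_mvn pos)
  have Ns: "sets (N i) = sets borel" "space (N i) = UNIV" for i by (simp_all add: N_def)
  note [measurable_cong] = Ns(1)
  have distrU: "distr M ?B U = Sq.S"
  proof -
    have "distr M ?B (\<lambda>\<omega>. \<lambda>i\<in>UNIV. (w i \<omega>, v i \<omega>)) = Pi\<^sub>M UNIV (\<lambda>i. distr M borel (\<lambda>\<omega>. (w i \<omega>, v i \<omega>)))"
      using indep_vars_iff_distr_eq_PiM[where I=UNIV and M'="\<lambda>_. borel" and X="\<lambda>i \<omega>. (w i \<omega>, v i
          \<omega>)"] indv Ui by simp
    also have "\<dots> = Sq.S" unfolding \<mu>_def by (intro arg_cong[where f="Pi\<^sub>M UNIV"] ext idd)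
    finally show ?thesis by (simp add: U_def restrict_UNIV)
  qed
  define p where "p i \<omega> = pred_error F G H K (x0 \<omega>) (\<lambda>i. w i \<omega>) (\<lambda>i. v i \<omega>) i" for i \<omega>
  have [measurable]: "p i \<in> borel_measurable M" for i
    unfolding p_def by (induction i) simp_all
  show e_meas [measurable]: "e i \<in> borel_measurable M" for i
    unfolding e_def innovation_def p_def[symmetric] by simp
  have ep: "e i \<omega> = H *v p i \<omega> + v i \<omega>" "p (Suc i) \<omega> = F *v p i \<omega> + G *v w i \<omega> - K i *v e i \<omega>" "p 0
      \<omega> = x0 \<omega>" for i \<omega>
    by (simp_all add: e_def p_def innovation_def)
  have eM [measurable]: "(\<lambda>\<omega>. \<lambda>j\<in>{..<i}. e j \<omega>) \<in> measurable M (Pi\<^sub>M {..<i} (\<lambda>_. borel))" for i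
    by measurable
  have [measurable]: "(\<lambda>\<omega>. \<lambda>k. U \<omega> (i + k)) \<in> measurable M ?B" for i :: nat
    using Ui by (intro measurable_abs_UNIV) (simp add: U_def)
  \<comment> \<open>Past innovations, current prediction error and future driving noise are jointly
    independent. Test functions replace an equality of product measures, so that each step is a
    chain of exchanges of integrals.\<close>
  have law: "\<exists>\<rho>. prob_space \<rho> \<and> sets \<rho> = sets borel \<and> (\<forall>t. (CLINT x|\<rho>. iexp (t \<bullet> x)) = exp (- (t \<bullet>
      (S i *v t)) / 2)) \<and>
      (\<forall>\<phi>\<in>borel_measurable (Pi\<^sub>M {..<i} (\<lambda>_. borel) \<Otimes>\<^sub>M (borel \<Otimes>\<^sub>M ?B)).
        (\<integral>\<^sup>+\<omega>. \<phi> (\<lambda>j\<in>{..<i}. e j \<omega>, p i \<omega>, \<lambda>k. U \<omega> (i + k)) \<partial>M) =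
        (\<integral>\<^sup>+h. \<integral>\<^sup>+x. \<integral>\<^sup>+u. \<phi> (h, x, u) \<partial>Sq.S \<partial>\<rho> \<partial>Pi\<^sub>M {..<i} N))" for i
  proof (induction i)
    case 0
    show ?case
    proof (intro exI[of _ "distr M borel x0"] conjI allI ballI)
      show "prob_space (distr M borel x0)" by (rule prob_space_distr) simp
      fix t show "(CLINT x|distr M borel x0. iexp (t \<bullet> x)) = exp (- (t \<bullet> (S 0 *v t)) / 2)"
        using charx[of t] by (simp add: integral_distr S_def)
    next
      fix \<phi> :: "(nat \<Rightarrow> real^'p) \<times> (real^'d) \<times> (nat \<Rightarrow> (real^'q) \<times> (real^'p)) \<Rightarrow> ennreal"
      assume \<phi>[measurable]: "\<phi> \<in> borel_measurable (Pi\<^sub>M {..<0} (\<lambda>_. borel) \<Otimes>\<^sub>M (borel \<Otimes>\<^sub>M ?B))"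
      let ?c = "\<lambda>_. undefined :: real^'p"
      interpret D: prob_space "distr M borel x0" by (rule prob_space_distr) simp
      have D: "distr M (borel \<Otimes>\<^sub>M ?B) (\<lambda>\<omega>. (x0 \<omega>, U \<omega>)) = distr M borel x0 \<Otimes>\<^sub>M Sq.S"
        using indep_rv_distr[OF M ind] distrU by (simp add: U_def)
      \<comment> \<open>With an empty index set the only history is the function that is
        \<open>undefined\<close> everywhere.\<close>
      have c: "?c \<in> space (Pi\<^sub>M {..<0::nat} (\<lambda>_. borel))" by (simp add: space_PiM)
      have [measurable]: "(\<lambda>z. \<phi> (?c, z)) \<in> borel_measurable (borel \<Otimes>\<^sub>M ?B)"
        using c by measurable
      have "(\<integral>\<^sup>+\<omega>. \<phi> (\<lambda>j\<in>{..<0}. e j \<omega>, p 0 \<omega>, \<lambda>k. U \<omega> (0 + k)) \<partial>M) = (\<integral>\<^sup>+\<omega>. \<phi> (?c, x0 \<omega>, U \<omega>) \<partial>M)"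
        by (simp add: ep restrict_def)
      also have "\<dots> = (\<integral>\<^sup>+z. \<phi> (?c, z) \<partial>distr M (borel \<Otimes>\<^sub>M ?B) (\<lambda>\<omega>. (x0 \<omega>, U \<omega>)))"
        by (subst nn_integral_distr) simp_all
      also have "\<dots> = (\<integral>\<^sup>+x. \<integral>\<^sup>+u. \<phi> (?c, x, u) \<partial>Sq.S \<partial>distr M borel x0)"
        unfolding D by (subst Sq.P.nn_integral_fst[symmetric]) simp_all
      also have "\<dots> = (\<integral>\<^sup>+h. \<integral>\<^sup>+x. \<integral>\<^sup>+u. \<phi> (h, x, u) \<partial>Sq.S \<partial>distr M borel x0 \<partial>Pi\<^sub>M {..<0} N)"
        by (simp add: NP.nn_integral_empty)
      finally show "(\<integral>\<^sup>+\<omega>. \<phi> (\<lambda>j\<in>{..<0}. e j \<omega>, p 0 \<omega>, \<lambda>k. U \<omega> (0 + k)) \<partial>M) =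
        (\<integral>\<^sup>+h. \<integral>\<^sup>+x. \<integral>\<^sup>+u. \<phi> (h, x, u) \<partial>Sq.S \<partial>distr M borel x0 \<partial>Pi\<^sub>M {..<0} N)" .
    qed simp
  next
    case (Suc i)
    then obtain \<rho> where \<rho>: "prob_space \<rho>" "sets \<rho> = sets borel" "\<And>t. (CLINT x|\<rho>. iexp (t \<bullet> x)) = exp
        (- (t \<bullet> (S i *v t)) / 2)"
      and IH: "\<And>\<phi>. \<phi>\<in>borel_measurable (Pi\<^sub>M {..<i} (\<lambda>_. borel) \<Otimes>\<^sub>M (borel \<Otimes>\<^sub>M ?B)) \<Longrightarrow>
        (\<integral>\<^sup>+\<omega>. \<phi> (\<lambda>j\<in>{..<i}. e j \<omega>, p i \<omega>, \<lambda>k. U \<omega> (i + k)) \<partial>M) =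
        (\<integral>\<^sup>+h. \<integral>\<^sup>+x. \<integral>\<^sup>+u. \<phi> (h, x, u) \<partial>Sq.S \<partial>\<rho> \<partial>Pi\<^sub>M {..<i} N)" by blast
    interpret \<rho>: prob_space \<rho> by fact
    note [measurable_cong] = \<rho>(2)
    interpret \<rho>\<mu>: pair_prob_space \<rho> \<mu> ..
    have symS: "transpose (S i) = S i" unfolding S_def
      by (rule riccati_seq_symmetric) (use sym pos in \<open>auto simp: S_def\<close>)
    let ?T = "\<lambda>z::(real^'d) \<times> ((real^'q) \<times> (real^'p)). (H *v fst z + snd (snd z), F *v fst z + G *v
        fst (snd z) - K i *v (H *v fst z + snd (snd z)))"
    obtain \<rho>' where \<rho>': "prob_space \<rho>'" "sets \<rho>' = sets borel"
      "\<And>t. (CLINT x|\<rho>'. iexp (t \<bullet> x)) = exp (- (t \<bullet> (S (Suc i) *v t)) / 2)"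
      and T: "distr (\<rho> \<Otimes>\<^sub>M \<mu>) borel ?T = N i \<Otimes>\<^sub>M \<rho>'"
      by (rule kalman_step_law[OF symS sym(2,3) pos \<rho> \<mu>(1,2) \<mu>c, of F G])
         (auto simp: S_def N_def K_def)
    interpret \<rho>': prob_space \<rho>' by fact
    note [measurable_cong] = \<rho>'(2)
    show ?case
    proof (intro exI[of _ \<rho>'] conjI allI ballI)
      fix \<phi> :: "(nat \<Rightarrow> real^'p) \<times> (real^'d) \<times> (nat \<Rightarrow> (real^'q) \<times> (real^'p)) \<Rightarrow> ennreal"
      assume \<phi>: "\<phi> \<in> borel_measurable (Pi\<^sub>M {..<Suc i} (\<lambda>_. borel) \<Otimes>\<^sub>M (borel \<Otimes>\<^sub>M ?B))"
      define g where "g h z = (\<integral>\<^sup>+u. \<phi> (h(i := fst z), snd z, u) \<partial>Sq.S)" for h and z :: "(real^'p) \<times>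
          (real^'d)"
      \<comment> \<open>The test function for the next time, pulled back to the present: the first
        noise term \<open>u 0\<close> is spent on the filter step, the rest is shifted.\<close>
      define \<phi>' where "\<phi>' = (\<lambda>(h, x, u). \<phi> (h(i := fst (?T (x, u 0))), snd (?T (x, u 0)), \<lambda>k. u (Suc k)))"
      have i: "{..<Suc i} = insert i {..<i}" by auto
      have upd: "(\<lambda>z. (f z)(i := y z)) \<in> measurable R (Pi\<^sub>M {..<Suc i} (\<lambda>_. borel))"
        if "f \<in> measurable R (Pi\<^sub>M {..<i} (\<lambda>_. borel))" "y \<in> borel_measurable R"
        for f :: "_ \<Rightarrow> nat \<Rightarrow> real^'p" and y R
        using measurable_fun_upd[of "{..<Suc i}" "{..<i}" i f R "\<lambda>_. borel" y] i that by simp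
      have sh: "(\<lambda>u k. u (Suc k)) \<in> measurable ?B ?B"
        by (intro measurable_abs_UNIV measurable_component_singleton) simp
      have fs: "(\<lambda>z. fst (y z)) \<in> borel_measurable R" "(\<lambda>z. snd (y z)) \<in> borel_measurable R"
        if "y \<in> borel_measurable R" for y :: "_ \<Rightarrow> (real^'q) \<times> (real^'p)" and R
        using borel_measurable_fst_snd[OF that] by auto
      have Tm: "(\<lambda>z. fst (?T (x z, y z))) \<in> borel_measurable R" "(\<lambda>z. snd (?T (x z, y z))) \<in>
          borel_measurable R"
        if "x \<in> borel_measurable R" "y \<in> borel_measurable R" for x :: "_ \<Rightarrow> real^'d" and y R
        using that(1) fs[OF that(2)] by simp_all
      have [measurable]: "?T \<in> borel_measurable (\<rho> \<Otimes>\<^sub>M \<mu>)"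
        using Tm[of fst "\<rho> \<Otimes>\<^sub>M \<mu>" snd] by (simp add: borel_measurable_Pair)
      have \<phi>'m: "\<phi>' \<in> borel_measurable (Pi\<^sub>M {..<i} (\<lambda>_. borel) \<Otimes>\<^sub>M (borel \<Otimes>\<^sub>M ?B))"
        unfolding \<phi>'_def split_beta'
        by (intro measurable_compose[OF _ \<phi>] measurable_Pair upd Tm measurable_compose[OF _ sh]) measurable
      have gm: "(\<lambda>(h, z). g h z) \<in> borel_measurable (Pi\<^sub>M {..<i} (\<lambda>_. borel) \<Otimes>\<^sub>M borel)"
        unfolding g_def split_beta'
      proof (rule Sq.P.borel_measurable_nn_integral)
        have "(\<lambda>(h, u). \<phi> ((fst h)(i := fst (snd h)), snd (snd h), u)) \<in> borel_measurable ((Pi\<^sub>M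
            {..<i} (\<lambda>_. borel) \<Otimes>\<^sub>M borel) \<Otimes>\<^sub>M ?B)"
          (is "_ \<in> borel_measurable ?R")
        proof -
          have *: "(\<lambda>z. fst (snd (fst z))) \<in> borel_measurable ?R" "(\<lambda>z. snd (snd (fst z))) \<in>
              borel_measurable ?R"
            by (rule borel_measurable_fst_snd; measurable)+
          show ?thesis
            unfolding split_beta'
            by (intro measurable_compose[OF _ \<phi>] measurable_Pair upd * measurable_snd
                measurable_compose[OF measurable_fst measurable_fst])
        qed
        then show "(\<lambda>(x, y). \<phi> ((fst x)(i := fst (snd x)), snd (snd x), y)) \<in> borel_measurable
            ((Pi\<^sub>M {..<i} (\<lambda>_. borel) \<Otimes>\<^sub>M borel) \<Otimes>\<^sub>M Sq.S)"
          using measurable_cong_sets[OF sets_pair_measure_cong[OF refl Ss] refl] by blast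
      qed
      have gm1: "g h \<in> borel_measurable borel" if "h \<in> space (Pi\<^sub>M {..<i} (\<lambda>_. borel))" for h
        using measurable_Pair2[OF gm that] by simp
      have step: "(\<integral>\<^sup>+x. \<integral>\<^sup>+u. \<phi>' (h, x, u) \<partial>Sq.S \<partial>\<rho>) = (\<integral>\<^sup>+a. \<integral>\<^sup>+b. g h (a, b) \<partial>\<rho>' \<partial>N i)"
        if h: "h \<in> space (Pi\<^sub>M {..<i} (\<lambda>_. borel))" for h
      proof -
        have "(\<integral>\<^sup>+u. \<phi>' (h, x, u) \<partial>Sq.S) = (\<integral>\<^sup>+y. g h (?T (x, y)) \<partial>\<mu>)" for x
        proof -
          have m1: "(\<lambda>u. \<phi>' (h, x, u)) \<in> borel_measurable Sq.S"
            using measurable_Pair2[OF measurable_Pair2[OF \<phi>'m h], of x] by (simp add: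
                measurable_cong_sets[OF Ss refl])
          have c: "(\<lambda>(y, u). case_nat y u) \<in> measurable (\<mu> \<Otimes>\<^sub>M Sq.S) Sq.S"
            by measurable
          have "(\<integral>\<^sup>+u. \<phi>' (h, x, u) \<partial>Sq.S) = (\<integral>\<^sup>+u. \<phi>' (h, x, u) \<partial>distr (\<mu> \<Otimes>\<^sub>M Sq.S) Sq.S (\<lambda>(y, u).
              case_nat y u))"
            by (simp only: Sq.PiM_iter)
          also have "\<dots> = (\<integral>\<^sup>+z. \<phi>' (h, x, case_nat (fst z) (snd z)) \<partial>(\<mu> \<Otimes>\<^sub>M Sq.S))"
            using m1 by (subst nn_integral_distr[OF c]) (simp_all add: split_beta')
          also have "\<dots> = (\<integral>\<^sup>+y. \<integral>\<^sup>+u. \<phi>' (h, x, case_nat y u) \<partial>Sq.S \<partial>\<mu>)"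
            using measurable_compose[OF c m1]
            by (subst Sq.P.nn_integral_fst[symmetric]) (simp_all add: split_beta')
          finally show ?thesis by (simp add: g_def \<phi>'_def)
        qed
        then have "(\<integral>\<^sup>+x. \<integral>\<^sup>+u. \<phi>' (h, x, u) \<partial>Sq.S \<partial>\<rho>) = (\<integral>\<^sup>+x. \<integral>\<^sup>+y. g h (?T (x, y)) \<partial>\<mu> \<partial>\<rho>)" by simp
        also have "\<dots> = (\<integral>\<^sup>+z. g h (?T z) \<partial>(\<rho> \<Otimes>\<^sub>M \<mu>))"
          using measurable_compose[OF \<open>?T \<in> _\<close> gm1[OF h]]
          by (subst \<mu>.nn_integral_fst[symmetric]) simp_all
        also have "\<dots> = (\<integral>\<^sup>+z. g h z \<partial>distr (\<rho> \<Otimes>\<^sub>M \<mu>) borel ?T)"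
          using gm1[OF h] by (simp add: nn_integral_distr)
        also have "\<dots> = (\<integral>\<^sup>+a. \<integral>\<^sup>+b. g h (a, b) \<partial>\<rho>' \<partial>N i)"
        proof -
          have "g h \<in> borel_measurable (N i \<Otimes>\<^sub>M \<rho>')"
            using gm1[OF h] by (subst T[symmetric]) simp
          then show ?thesis unfolding T by (rule \<rho>'.nn_integral_fst[symmetric])
        qed
        finally show ?thesis .
      qed
      have ins: "(\<lambda>h. \<integral>\<^sup>+b. \<integral>\<^sup>+u. \<phi> (h, b, u) \<partial>Sq.S \<partial>\<rho>') \<in> borel_measurable (Pi\<^sub>M (insert i {..<i}) N)"
      proof -
        have "\<phi> \<in> borel_measurable (Pi\<^sub>M (insert i {..<i}) N \<Otimes>\<^sub>M (\<rho>' \<Otimes>\<^sub>M Sq.S))"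
        proof -
          have eq: "sets (Pi\<^sub>M (insert i {..<i}) N \<Otimes>\<^sub>M (\<rho>' \<Otimes>\<^sub>M Sq.S)) = sets (Pi\<^sub>M {..<Suc i} (\<lambda>_.
              borel) \<Otimes>\<^sub>M (borel \<Otimes>\<^sub>M ?B))"
            unfolding i by (intro sets_pair_measure_cong sets_PiM_cong refl Ns \<rho>' Ss)
          show ?thesis using \<phi> by (simp only: measurable_cong_sets[OF eq refl])
        qed
        then show ?thesis by measurable
      qed
      have "(\<integral>\<^sup>+\<omega>. \<phi> (\<lambda>j\<in>{..<Suc i}. e j \<omega>, p (Suc i) \<omega>, \<lambda>k. U \<omega> (Suc i + k)) \<partial>M) =
         (\<integral>\<^sup>+\<omega>. \<phi>' (\<lambda>j\<in>{..<i}. e j \<omega>, p i \<omega>, \<lambda>k. U \<omega> (i + k)) \<partial>M)"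
      proof (rule nn_integral_cong)
        fix \<omega>
        have "(\<lambda>j\<in>{..<Suc i}. e j \<omega>) = (\<lambda>j\<in>{..<i}. e j \<omega>)(i := e i \<omega>)"
          by (auto simp: fun_eq_iff restrict_def)
        then show "\<phi> (\<lambda>j\<in>{..<Suc i}. e j \<omega>, p (Suc i) \<omega>, \<lambda>k. U \<omega> (Suc i + k)) = \<phi>' (\<lambda>j\<in>{..<i}. e j
            \<omega>, p i \<omega>, \<lambda>k. U \<omega> (i + k))"
          by (simp add: \<phi>'_def ep U_def)
      qed
      also have "\<dots> = (\<integral>\<^sup>+h. \<integral>\<^sup>+x. \<integral>\<^sup>+u. \<phi>' (h, x, u) \<partial>Sq.S \<partial>\<rho> \<partial>Pi\<^sub>M {..<i} N)" by (rule IH[OF \<phi>'m])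
      also have "\<dots> = (\<integral>\<^sup>+h. \<integral>\<^sup>+a. \<integral>\<^sup>+b. g h (a, b) \<partial>\<rho>' \<partial>N i \<partial>Pi\<^sub>M {..<i} N)"
        by (intro nn_integral_cong step) (simp add: space_PiM Ns)
      also have "\<dots> = (\<integral>\<^sup>+h. \<integral>\<^sup>+x. \<integral>\<^sup>+u. \<phi> (h, x, u) \<partial>Sq.S \<partial>\<rho>' \<partial>Pi\<^sub>M {..<Suc i} N)"
        unfolding i by (subst NP.product_nn_integral_insert[OF _ _ ins]) (simp_all add: g_def)
      finally show "(\<integral>\<^sup>+\<omega>. \<phi> (\<lambda>j\<in>{..<Suc i}. e j \<omega>, p (Suc i) \<omega>, \<lambda>k. U \<omega> (Suc i + k)) \<partial>M) =
        (\<integral>\<^sup>+h. \<integral>\<^sup>+x. \<integral>\<^sup>+u. \<phi> (h, x, u) \<partial>Sq.S \<partial>\<rho>' \<partial>Pi\<^sub>M {..<Suc i} N)" .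
    qed (use \<rho>' in auto)
  qed
  show "distr M (Pi\<^sub>M {..<n} (\<lambda>_. borel)) (\<lambda>\<omega>. \<lambda>i\<in>{..<n}. e i \<omega>) = Pi\<^sub>M {..<n} N"
  proof (rule measure_eqI)
    show "sets (distr M (Pi\<^sub>M {..<n} (\<lambda>_. borel)) (\<lambda>\<omega>. \<lambda>i\<in>{..<n}. e i \<omega>)) = sets (Pi\<^sub>M {..<n} N)"
      by (auto intro!: sets_PiM_cong simp: Ns)
    fix E assume "E \<in> sets (distr M (Pi\<^sub>M {..<n} (\<lambda>_. borel)) (\<lambda>\<omega>. \<lambda>i\<in>{..<n}. e i \<omega>))"
    then have E [measurable]: "E \<in> sets (Pi\<^sub>M {..<n} (\<lambda>_. borel))" by simp
    obtain \<rho> where "prob_space \<rho>" and L: "\<And>\<phi>. \<phi>\<in>borel_measurable (Pi\<^sub>M {..<n} (\<lambda>_. borel) \<Otimes>\<^sub>M (borel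
        \<Otimes>\<^sub>M ?B)) \<Longrightarrow>
        (\<integral>\<^sup>+\<omega>. \<phi> (\<lambda>j\<in>{..<n}. e j \<omega>, p n \<omega>, \<lambda>k. U \<omega> (n + k)) \<partial>M) =
        (\<integral>\<^sup>+h. \<integral>\<^sup>+x. \<integral>\<^sup>+u. \<phi> (h, x, u) \<partial>Sq.S \<partial>\<rho> \<partial>Pi\<^sub>M {..<n} N)" using law[of n] by blast
    interpret \<rho>: prob_space \<rho> by fact
    have E': "E \<in> sets (Pi\<^sub>M {..<n} N)"
      using E sets_PiM_cong[of "{..<n}" "{..<n}" N "\<lambda>_. borel"] Ns by simp
    have "emeasure (distr M (Pi\<^sub>M {..<n} (\<lambda>_. borel)) (\<lambda>\<omega>. \<lambda>i\<in>{..<n}. e i \<omega>)) E = (\<integral>\<^sup>+\<omega>. indicator E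
        (\<lambda>i\<in>{..<n}. e i \<omega>) \<partial>M)"
      using nn_integral_distr[OF eM[of n], of "indicator E"] by simp
    also have "\<dots> = (\<integral>\<^sup>+h. \<integral>\<^sup>+x. \<integral>\<^sup>+u. indicator E h \<partial>Sq.S \<partial>\<rho> \<partial>Pi\<^sub>M {..<n} N)"
      using L[of "\<lambda>z. indicator E (fst z)"] by simp
    also have "\<dots> = emeasure (Pi\<^sub>M {..<n} N) E"
      using E' by (simp add: Sq.P.emeasure_space_1 \<rho>.emeasure_space_1)
    finally show "emeasure (distr M (Pi\<^sub>M {..<n} (\<lambda>_. borel)) (\<lambda>\<omega>. \<lambda>i\<in>{..<n}. e i \<omega>)) E = emeasure
        (Pi\<^sub>M {..<n} N) E" .
  qed
qed

section \<open>Change of measure along a feedback code\<close>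

text \<open>The shift of the \<open>i\<close>-th coordinate depends on the earlier coordinates only, so Lebesgue measure is
  invariant. The right-hand side does not depend on the shift, that is, on the message.\<close>

lemma change_of_measure:
  fixes p q :: "nat \<Rightarrow> 'b::euclidean_space \<Rightarrow> real"
  assumes p [measurable]: "\<And>i. p i \<in> borel_measurable borel" and p0: "\<And>i x. 0 < p i x"
    and pp: "\<And>i. prob_space (density lborel (\<lambda>x. ennreal (p i x)))"
    and q [measurable]: "\<And>i. q i \<in> borel_measurable borel" and q0: "\<And>i x. 0 \<le> q i x"
    and qp: "\<And>i. prob_space (density lborel (\<lambda>x. ennreal (q i x)))"
    and sh: "\<And>i. i < n \<Longrightarrow> sh i \<in> borel_measurable (Pi\<^sub>M {..<i} (\<lambda>_. borel))"
    and "\<phi> \<in> borel_measurable (Pi\<^sub>M {..<n} (\<lambda>_. borel))"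
  shows "(\<integral>\<^sup>+h. ennreal (\<Prod>i<n. q i (h i + sh i (restrict h {..<i})) / p i (h i)) * \<phi> (\<lambda>i\<in>{..<n}. h i
      + sh i (restrict h {..<i}))
       \<partial>Pi\<^sub>M {..<n} (\<lambda>i. density lborel (\<lambda>x. ennreal (p i x)))) =
    (\<integral>\<^sup>+h. \<phi> h \<partial>Pi\<^sub>M {..<n} (\<lambda>i. density lborel (\<lambda>x. ennreal (q i x))))"
  using sh assms(8)
proof (induction n arbitrary: \<phi>)
  let ?P = "\<lambda>i. density lborel (\<lambda>x. ennreal (p i x))" and ?Q = "\<lambda>i. density lborel (\<lambda>x. ennreal (q i x))"
  interpret P: product_prob_space ?P "{..<i}" for i :: nat by (intro product_prob_spaceI pp)
  interpret Q: product_prob_space ?Q "{..<i}" for i :: nat by (intro product_prob_spaceI qp)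
  case 0
  show ?case
    using P.nn_integral_empty[of "\<lambda>h. \<phi> (\<lambda>i\<in>{..<0}. h i + sh i (restrict h {..<i}))"]
        Q.nn_integral_empty[of \<phi>]
      P.P.emeasure_space_1[of 0] by simp
next
  let ?P = "\<lambda>i. density lborel (\<lambda>x. ennreal (p i x))" and ?Q = "\<lambda>i. density lborel (\<lambda>x. ennreal (q i x))"
  interpret P: product_prob_space ?P "{..<i}" for i :: nat by (intro product_prob_spaceI pp)
  interpret Q: product_prob_space ?Q "{..<i}" for i :: nat by (intro product_prob_spaceI qp)
  interpret Qn: prob_space "?Q i" for i by (rule qp)
  case (Suc n)
  note sh = Suc.prems(1)
  have \<phi>: "\<phi> \<in> borel_measurable (Pi\<^sub>M {..<Suc n} (\<lambda>_. borel))" by fact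
  have i: "{..<Suc n} = insert n {..<n}" by auto
  have sP: "sets (Pi\<^sub>M I ?P) = sets (Pi\<^sub>M I (\<lambda>_. borel))" and sQ: "sets (Pi\<^sub>M I ?Q) = sets (Pi\<^sub>M I
      (\<lambda>_. borel))" for I
    by (auto intro!: sets_PiM_cong)
  define \<epsilon> where "\<epsilon> k h = (\<lambda>i\<in>{..<k}. h i + sh i (restrict h {..<i}))" for k h
  define Z where "Z k h = (\<Prod>i<k. q i (h i + sh i (restrict h {..<i})) / p i (h i))" for k h
  have Z0: "0 \<le> Z k h" for k h unfolding Z_def by (intro prod_nonneg divide_nonneg_nonneg ballI q0
      less_imp_le p0)
  have upd: "(\<lambda>z. (f z)(n := y z)) \<in> measurable R (Pi\<^sub>M {..<Suc n} (\<lambda>_. borel))"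
    if "f \<in> measurable R (Pi\<^sub>M {..<n} (\<lambda>_. borel))" "y \<in> borel_measurable R"
    for f :: "_ \<Rightarrow> nat \<Rightarrow> 'b" and y R
    using measurable_fun_upd[of "{..<Suc n}" "{..<n}" n f R "\<lambda>_. borel" y] i that by simp
  have comp: "(\<lambda>h. h i) \<in> borel_measurable (Pi\<^sub>M {..<Suc n} (\<lambda>_. borel))" if "i < Suc n" for i
    using that by (intro measurable_component_singleton) simp
  have shm: "(\<lambda>h. sh i (restrict h {..<i})) \<in> borel_measurable (Pi\<^sub>M {..<Suc n} (\<lambda>_. borel))" if "i
      < Suc n" for i
    using that by (intro measurable_compose[OF _ sh] measurable_restrict_subset) auto
  have em: "\<epsilon> (Suc n) \<in> measurable (Pi\<^sub>M {..<Suc n} (\<lambda>_. borel)) (Pi\<^sub>M {..<Suc n} (\<lambda>_. borel))"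
    unfolding \<epsilon>_def using comp shm by (intro measurable_restrict borel_measurable_add) auto
  have Zm: "Z (Suc n) \<in> borel_measurable (Pi\<^sub>M {..<Suc n} (\<lambda>_. borel))"
    unfolding Z_def using comp shm
    by (intro borel_measurable_prod borel_measurable_divide measurable_compose[OF _ p]
        measurable_compose[OF _ q] borel_measurable_add) auto
  \<comment> \<open>The last coordinate is integrated under its target density; a function of the
    first n coordinates remains for the induction hypothesis.\<close>
  define \<phi>' where "\<phi>' h = (\<integral>\<^sup>+y. \<phi> (h(n := y)) \<partial>?Q n)" for h
  have [measurable]: "(\<lambda>(h, y). \<phi> (h(n := y))) \<in> borel_measurable (Pi\<^sub>M {..<n} (\<lambda>_. borel) \<Otimes>\<^sub>M borel)"
    unfolding split_beta' by (intro measurable_compose[OF _ \<phi>] upd) auto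
  have \<phi>'m: "\<phi>' \<in> borel_measurable (Pi\<^sub>M {..<n} (\<lambda>_. borel))"
    unfolding \<phi>'_def by measurable
  have step: "(\<integral>\<^sup>+y. ennreal (Z (Suc n) (h(n := y))) * \<phi> (\<epsilon> (Suc n) (h(n := y))) \<partial>?P n) = ennreal (Z
      n h) * \<phi>' (\<epsilon> n h)"
    if h: "h \<in> space (Pi\<^sub>M {..<n} (\<lambda>_. borel))" for h
  proof -
    \<comment> \<open>Once the earlier coordinates h are fixed the shift is a constant, so the
      integral over the last coordinate is merely translated, after the factor \<open>p n y\<close>
      has cancelled.\<close>
    define s where "s = sh n (restrict h {..<n})"
    have r: "restrict (h(n := y)) {..<i} = restrict h {..<i}" if "i \<le> n" for i y
      using that by (auto simp: restrict_def fun_eq_iff)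
    have e1: "\<epsilon> (Suc n) (h(n := y)) = (\<epsilon> n h)(n := y + s)" for y
    proof (rule ext)
      fix j show "\<epsilon> (Suc n) (h(n := y)) j = ((\<epsilon> n h)(n := y + s)) j"
        by (cases "j < n"; cases "j = n") (simp_all add: \<epsilon>_def s_def r)
    qed
    have z1: "Z (Suc n) (h(n := y)) = Z n h * (q n (y + s) / p n y)" for y
      unfolding Z_def s_def by (simp add: r)
    have eh: "\<epsilon> n h \<in> space (Pi\<^sub>M {..<n} (\<lambda>_. borel))" by (simp add: \<epsilon>_def space_PiM)
    have m1 [measurable]: "(\<lambda>y. \<phi> ((\<epsilon> n h)(n := y))) \<in> borel_measurable borel"
      by (intro measurable_compose[OF _ \<phi>] upd measurable_const eh) auto
    have [measurable]: "(\<lambda>y. \<phi> ((\<epsilon> n h)(n := y + s))) \<in> borel_measurable borel"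
      by (rule measurable_compose[OF _ m1]) simp
    have "(\<integral>\<^sup>+y. ennreal (Z (Suc n) (h(n := y))) * \<phi> (\<epsilon> (Suc n) (h(n := y))) \<partial>?P n)
      = (\<integral>\<^sup>+y. ennreal (Z n h) * (ennreal (q n (y + s)) * \<phi> ((\<epsilon> n h)(n := y + s))) \<partial>lborel)"
    proof -
      have "ennreal (p n y) * (ennreal (Z n h * (q n (y + s) / p n y)) * c) = ennreal (Z n h) *
          (ennreal (q n (y + s)) * c)" for y c
      proof -
        have "ennreal (p n y) * ennreal (Z n h * (q n (y + s) / p n y)) = ennreal (Z n h) * ennreal
            (q n (y + s))"
          using p0[of n y] q0[of n "y + s"] Z0[of n h]
          by (simp add: ennreal_mult[symmetric] del: ennreal_mult)
        then show ?thesis by (metis mult.assoc)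
      qed
      then show ?thesis
        unfolding e1 z1 by (subst nn_integral_density) (simp_all)
    qed
    also have "\<dots> = ennreal (Z n h) * (\<integral>\<^sup>+y. ennreal (q n (y + s)) * \<phi> ((\<epsilon> n h)(n := y + s)) \<partial>lborel)"
      by (rule nn_integral_cmult) simp
    also have "(\<integral>\<^sup>+y. ennreal (q n (y + s)) * \<phi> ((\<epsilon> n h)(n := y + s)) \<partial>lborel) = (\<integral>\<^sup>+y. ennreal (q n
        y) * \<phi> ((\<epsilon> n h)(n := y)) \<partial>distr lborel borel ((+) s))"
      by (subst nn_integral_distr) (simp_all add: add.commute)
    also have "\<dots> = \<phi>' (\<epsilon> n h)"
      unfolding \<phi>'_def lborel_distr_plus by (subst nn_integral_density) simp_all
    finally show ?thesis .
  qed
  have "(\<integral>\<^sup>+h. ennreal (Z (Suc n) h) * \<phi> (\<epsilon> (Suc n) h) \<partial>Pi\<^sub>M {..<Suc n} ?P)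
    = (\<integral>\<^sup>+h. \<integral>\<^sup>+y. ennreal (Z (Suc n) (h(n := y))) * \<phi> (\<epsilon> (Suc n) (h(n := y))) \<partial>?P n \<partial>Pi\<^sub>M {..<n} ?P)"
    unfolding i
  proof (rule P.product_nn_integral_insert)
    show "(\<lambda>h. ennreal (Z (Suc n) h) * \<phi> (\<epsilon> (Suc n) h)) \<in> borel_measurable (Pi\<^sub>M (insert n {..<n}) ?P)"
      unfolding measurable_cong_sets[OF sP refl] i[symmetric]
      using Zm measurable_compose[OF em \<phi>] by measurable
  qed auto
  also have "\<dots> = (\<integral>\<^sup>+h. ennreal (Z n h) * \<phi>' (\<epsilon> n h) \<partial>Pi\<^sub>M {..<n} ?P)"
    by (intro nn_integral_cong step) (simp add: space_PiM)
  also have "\<dots> = (\<integral>\<^sup>+h. \<phi>' h \<partial>Pi\<^sub>M {..<n} ?Q)"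
    unfolding Z_def \<epsilon>_def by (rule Suc.IH[OF _ \<phi>'m]) (simp add: sh)
  also have "\<dots> = (\<integral>\<^sup>+h. \<phi> h \<partial>Pi\<^sub>M {..<Suc n} ?Q)"
    unfolding \<phi>'_def i
    by (rule Q.product_nn_integral_insert[symmetric]) (use \<phi> in \<open>auto simp: measurable_cong_sets[OF
        sQ refl] i[symmetric]\<close>)
  finally show ?case unfolding Z_def \<epsilon>_def .
qed

section \<open>Linear tracking of the noise state\<close>

definition square_integrable :: "'a measure \<Rightarrow> ('a \<Rightarrow> 'b::euclidean_space) \<Rightarrow> bool" where
  "square_integrable M X \<longleftrightarrow> X \<in> borel_measurable M \<and> integrable M (\<lambda>\<omega>. (norm (X \<omega>))\<^sup>2)"

lemma square_integrableI:
  fixes X :: "'a \<Rightarrow> 'b::euclidean_space"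
  assumes "X \<in> borel_measurable M" "\<And>b. integrable M (\<lambda>\<omega>. (b \<bullet> X \<omega>)\<^sup>2)"
  shows "square_integrable M X"
proof -
  have "(norm y)\<^sup>2 = (\<Sum>b\<in>Basis. (b \<bullet> y)\<^sup>2)" for y :: 'b
    by (subst power2_norm_eq_inner, subst euclidean_inner) (simp add: power2_eq_square inner_commute)
  then show ?thesis unfolding square_integrable_def using assms by simp
qed

lemma square_integrable_add:
  assumes "square_integrable M X" "square_integrable M Y"
  shows "square_integrable M (\<lambda>\<omega>. X \<omega> + Y \<omega>)"
proof -
  have [measurable]: "X \<in> borel_measurable M" "Y \<in> borel_measurable M"
    and i: "integrable M (\<lambda>\<omega>. 2 * (norm (X \<omega>))\<^sup>2 + 2 * (norm (Y \<omega>))\<^sup>2)"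
    using assms by (auto simp: square_integrable_def)
  have "(norm (x + y))\<^sup>2 \<le> 2 * (norm x)\<^sup>2 + 2 * (norm y)\<^sup>2" for x y :: 'b
  proof -
    have "(norm (x + y))\<^sup>2 \<le> (norm x + norm y)\<^sup>2" by (intro power_mono norm_triangle_ineq) simp
    also have "\<dots> \<le> 2 * (norm x)\<^sup>2 + 2 * (norm y)\<^sup>2"
      using zero_le_power2[of "norm x - norm y"] by (simp add: power2_eq_square algebra_simps)
    finally show ?thesis .
  qed
  then show ?thesis
    unfolding square_integrable_def by (intro conjI Bochner_Integration.integrable_bound[OF i]) auto
qed

lemma square_integrable_matrix:
  fixes A :: "real^'n^'m"
  assumes "square_integrable M X"
  shows "square_integrable M (\<lambda>\<omega>. A *v X \<omega>)"
proof -
  have [measurable]: "X \<in> borel_measurable M"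
    and i: "integrable M (\<lambda>\<omega>. (onorm ((*v) A))\<^sup>2 * (norm (X \<omega>))\<^sup>2)"
    using assms by (auto simp: square_integrable_def)
  have "(norm (A *v x))\<^sup>2 \<le> (onorm ((*v) A))\<^sup>2 * (norm x)\<^sup>2" for x
    unfolding power_mult_distrib[symmetric]
    by (intro power_mono onorm matrix_vector_mul_bounded_linear) simp
  then show ?thesis
    unfolding square_integrable_def by (intro conjI Bochner_Integration.integrable_bound[OF i]) auto
qed

lemma square_integrable_diff:
  fixes X :: "'a \<Rightarrow> real^'n"
  assumes "square_integrable M X" "square_integrable M Y"
  shows "square_integrable M (\<lambda>\<omega>. X \<omega> - Y \<omega>)"
proof -
  have "(- mat 1 :: real^'n^'n) *v x = - x" for x
    by (metis matrix_vector_mul_lid scaleR_matrix_vector_assoc scaleR_minus1_left)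
  then show ?thesis
    using square_integrable_add[OF assms(1) square_integrable_matrix[OF assms(2), of "- mat 1"]] by simp
qed

lemma integrable_inner_mult:
  assumes "square_integrable M X" "square_integrable M Y"
  shows "integrable M (\<lambda>\<omega>. (a \<bullet> X \<omega>) * (b \<bullet> Y \<omega>))"
proof -
  have [measurable]: "X \<in> borel_measurable M" "Y \<in> borel_measurable M"
    and i: "integrable M (\<lambda>\<omega>. (norm a)\<^sup>2 * (norm (X \<omega>))\<^sup>2 + (norm b)\<^sup>2 * (norm (Y \<omega>))\<^sup>2)"
    using assms by (auto simp: square_integrable_def)
  have "\<bar>(a \<bullet> x) * (b \<bullet> y)\<bar> \<le> (norm a)\<^sup>2 * (norm x)\<^sup>2 + (norm b)\<^sup>2 * (norm y)\<^sup>2" for x y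
  proof -
    have "\<bar>(a \<bullet> x) * (b \<bullet> y)\<bar> \<le> (norm a * norm x) * (norm b * norm y)"
      unfolding abs_mult by (intro mult_mono Cauchy_Schwarz_ineq2) auto
    also have "\<dots> \<le> (norm a * norm x)\<^sup>2 + (norm b * norm y)\<^sup>2"
    proof -
      have "u * v \<le> u\<^sup>2 + v\<^sup>2" if "0 \<le> u * v" for u v :: real
        using sum_squares_bound[of u v] that by linarith
      then show ?thesis by simp
    qed
    finally show ?thesis by (simp add: power_mult_distrib)
  qed
  then show ?thesis by (intro Bochner_Integration.integrable_bound[OF i]) auto
qed

lemma inner_cross_moment:
  fixes X :: "'a \<Rightarrow> real^'n" and Y :: "'a \<Rightarrow> real^'m"
  assumes "square_integrable M X" "square_integrable M Y"
  shows "(\<integral>\<omega>. (a \<bullet> X \<omega>) * (b \<bullet> Y \<omega>) \<partial>M) = a \<bullet> (cross_moment M X Y *v b)"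
proof -
  have [simp]: "integrable M (\<lambda>\<omega>. X \<omega> $ i * Y \<omega> $ j)" for i j
    using integrable_inner_mult[OF assms, of "axis i 1" "axis j 1"] by (simp add: inner_axis')
  have "(\<integral>\<omega>. (a \<bullet> X \<omega>) * (b \<bullet> Y \<omega>) \<partial>M) = (\<integral>\<omega>. (\<Sum>i\<in>UNIV. \<Sum>j\<in>UNIV. a $ i * b $ j * (X \<omega> $ i * Y \<omega> $ j)) \<partial>M)"
    unfolding inner_vec_def inner_real_def sum_product
    by (intro Bochner_Integration.integral_cong sum.cong refl) (simp add: mult_ac)
  also have "\<dots> = (\<Sum>i\<in>UNIV. \<Sum>j\<in>UNIV. a $ i * b $ j * (\<integral>\<omega>. X \<omega> $ i * Y \<omega> $ j \<partial>M))" by simp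
  also have "\<dots> = a \<bullet> (cross_moment M X Y *v b)"
    by (simp add: cross_moment_def inner_vec_def matrix_vector_mult_def sum_distrib_left mult_ac)
  finally show ?thesis .
qed

lemma matrix_eq_inner:
  fixes A B :: "real^'n^'m"
  assumes "\<And>a b. a \<bullet> (A *v b) = a \<bullet> (B *v b)" shows "A = B"
  unfolding matrix_eq by (metis assms vector_eq_ldot)

text \<open>Polarisation: the values on the diagonal recover the whole symmetric bilinear
  form.\<close>

lemma symmetric_matrix_eqI:
  fixes A B :: "real^'n^'n"
  assumes sym: "transpose A = A" "transpose B = B" and q: "\<And>a. a \<bullet> (A *v a) = a \<bullet> (B *v a)"
  shows "A = B"
proof (rule matrix_eq_inner)
  fix a b
  have pol: "4 * (a \<bullet> (C *v b)) = (a + b) \<bullet> (C *v (a + b)) - (a - b) \<bullet> (C *v (a - b))" if "transpose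
      C = C" for C :: "real^'n^'n"
  proof -
    have "b \<bullet> (C *v a) = a \<bullet> (C *v b)" by (metis that inner_commute inner_matrix_vector)
    then show ?thesis
      by (simp add: matrix_vector_right_distrib matrix_vector_mult_diff_distrib inner_add_left
          inner_add_right inner_diff_left inner_diff_right)
  qed
  show "a \<bullet> (A *v b) = a \<bullet> (B *v b)"
    using pol[OF sym(1)] pol[OF sym(2)] q[of "a + b"] q[of "a - b"] by simp
qed

lemma integral_inner_matrix:
  fixes X :: "'a \<Rightarrow> real^'n"
  assumes "square_integrable M X"
  shows "integrable M (\<lambda>\<omega>. X \<omega> \<bullet> (C *v X \<omega>))" "(\<integral>\<omega>. X \<omega> \<bullet> (C *v X \<omega>) \<partial>M) = trace (C ** cross_moment M X X)"
proof -
  have I [simp]: "integrable M (\<lambda>\<omega>. X \<omega> $ i * X \<omega> $ j)" for i j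
    using integrable_inner_mult[OF assms assms, of "axis i 1" "axis j 1"] by (simp add: inner_axis')
  have e: "X \<omega> \<bullet> (C *v X \<omega>) = (\<Sum>i\<in>UNIV. \<Sum>j\<in>UNIV. C $ i $ j * (X \<omega> $ j * X \<omega> $ i))" for \<omega>
    by (simp add: inner_vec_def matrix_vector_mult_def sum_distrib_left mult_ac)
  show "integrable M (\<lambda>\<omega>. X \<omega> \<bullet> (C *v X \<omega>))" unfolding e by simp
  show "(\<integral>\<omega>. X \<omega> \<bullet> (C *v X \<omega>) \<partial>M) = trace (C ** cross_moment M X X)"
    unfolding e by (simp add: trace_def matrix_matrix_mult_def cross_moment_def)
qed

text \<open>The quadratic form of the block matrix with diagonal blocks P, S and off-diagonal block
  \<open>\<Gamma>\<close>: \<open>\<alpha>\<close> pairs with the state block S and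
  \<open>\<beta>\<close> with the input block P. For second moments it is the mean square of
  \<open>\<alpha> \<bullet> D + \<beta> \<bullet> X\<close>, and it is linear in the three
  matrices.\<close>

definition joint_form :: "real^'m^'m \<Rightarrow> real^'d^'d \<Rightarrow> real^'d^'m \<Rightarrow> real^'d \<Rightarrow> real^'m \<Rightarrow> real" where
  "joint_form P S \<Gamma> \<alpha> \<beta> = \<alpha> \<bullet> (S *v \<alpha>) + 2 * (\<beta> \<bullet> (\<Gamma> *v \<alpha>)) + \<beta> \<bullet> (P *v \<beta>)"

lemma joint_form_moments:
  assumes D: "square_integrable M D" and X: "square_integrable M X"
  shows "(\<integral>\<omega>. (\<alpha> \<bullet> D \<omega> + \<beta> \<bullet> X \<omega>)\<^sup>2 \<partial>M) = joint_form (cross_moment M X X) (cross_moment M D D)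
      (cross_moment M X D) \<alpha> \<beta>"
proof -
  have "(\<alpha> \<bullet> D \<omega> + \<beta> \<bullet> X \<omega>)\<^sup>2 = (\<alpha> \<bullet> D \<omega>) * (\<alpha> \<bullet> D \<omega>) + 2 * ((\<beta> \<bullet> X \<omega>) * (\<alpha> \<bullet> D \<omega>)) + (\<beta> \<bullet> X \<omega>) * (\<beta>
      \<bullet> X \<omega>)" for \<omega>
    by (simp add: power2_eq_square algebra_simps)
  then show ?thesis
    using integrable_inner_mult[OF D D] integrable_inner_mult[OF X D] integrable_inner_mult[OF X X]
    by (simp add: joint_form_def inner_cross_moment D X)
qed

lemma cross_moment_symmetric: "transpose (cross_moment M X X) = cross_moment M X X"
  by (simp add: cross_moment_def transpose_def vec_eq_iff mult.commute)

lemma inner_Psi_Y: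
  "a \<bullet> (Psi_Y \<Lambda> H \<Psi> (P, S, \<Gamma>) *v b) = (transpose H *v a) \<bullet> (S *v (transpose H *v b)) + (transpose \<Lambda>
      *v a) \<bullet> (\<Gamma> *v (transpose H *v b))
     + (transpose \<Lambda> *v b) \<bullet> (\<Gamma> *v (transpose H *v a)) + (transpose \<Lambda> *v a) \<bullet> (P *v (transpose \<Lambda> *v
         b)) + a \<bullet> (\<Psi> *v b)"
proof -
  have "(transpose \<Lambda> *v b) \<bullet> (\<Gamma> *v (transpose H *v a)) = (transpose H *v a) \<bullet> (transpose \<Gamma> *v
      (transpose \<Lambda> *v b))"
    by (simp only: inner_matrix_vector[of _ \<Gamma>] inner_commute)
  then show ?thesis
    unfolding Psi_Y_def
    by (simp add: matrix_vector_mult_add_rdistrib inner_add_right matrix_vector_mul_assoc[symmetric]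
        inner_transpose_matrix del: transpose_matrix_vector)
qed

lemma Psi_Y_quadratic:
  "b \<bullet> (Psi_Y \<Lambda> H \<Psi> (P, S, \<Gamma>) *v b) = joint_form P S \<Gamma> (transpose H *v b) (transpose \<Lambda> *v b) + b \<bullet> (\<Psi> *v b)"
  unfolding inner_Psi_Y joint_form_def by simp

lemma Psi_Y_symmetric:
  assumes "transpose P = P" "transpose S = S" "transpose \<Psi> = \<Psi>"
  shows "transpose (Psi_Y \<Lambda> H \<Psi> (P, S, \<Gamma>)) = Psi_Y \<Lambda> H \<Psi> (P, S, \<Gamma>)"
  using assms unfolding Psi_Y_def
  by (simp add: transpose_plus matrix_transpose_mul matrix_mul_assoc add_ac)

lemma pos_def_Psi_Y:
  assumes "transpose P = P" "transpose S = S" "\<And>\<alpha> \<beta>. 0 \<le> joint_form P S \<Gamma> \<alpha> \<beta>" "pos_def \<Psi>"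
  shows "pos_def (Psi_Y \<Lambda> H \<Psi> (P, S, \<Gamma>))"
  unfolding pos_def_def Psi_Y_quadratic
  using assms by (auto simp: pos_def_def intro!: Psi_Y_symmetric add_nonneg_pos)

text \<open>The prediction of the noise state from the true innovations, minus the prediction that
  the receiver forms with the gains \<open>KY\<close> from its own residuals. Both predictions start
  at 0, hence so does the difference.\<close>

primrec track_error ::
    "real^'d^'d \<Rightarrow> real^'d^'p \<Rightarrow> real^'m^'p \<Rightarrow> (nat \<Rightarrow> real^'p^'d) \<Rightarrow> (nat \<Rightarrow> real^'p^'d) \<Rightarrow> (nat \<Rightarrow>
        real^'m) \<Rightarrow> (nat \<Rightarrow> real^'p)
     \<Rightarrow> nat \<Rightarrow> real^'d" where
  "track_error F H \<Lambda> K KY x e 0 = 0"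
| "track_error F H \<Lambda> K KY x e (Suc i) = F *v track_error F H \<Lambda> K KY x e i + K i *v e i
     - KY i *v (\<Lambda> *v x i + H *v track_error F H \<Lambda> K KY x e i + e i)"

text \<open>The last conclusion would be an equality for \<open>b\<close> chosen as minus the transposed gain applied to \<open>a\<close>;
  for other \<open>b\<close> one drops a square, since the new error is orthogonal to \<open>\<epsilon> i\<close>.\<close>

lemma regression_gains:
  fixes F :: "real^'d^'d" and H :: "real^'d^'p" and \<Lambda> :: "real^'m^'p" and K :: "nat \<Rightarrow> real^'p^'d"
    and X :: "nat \<Rightarrow> 'a \<Rightarrow> real^'m" and e :: "nat \<Rightarrow> 'a \<Rightarrow> real^'p" and \<Psi> :: "nat \<Rightarrow> real^'p^'p"
  assumes M: "prob_space M"
    and X: "\<And>i. i < n \<Longrightarrow> square_integrable M (X i)" and e: "\<And>i. i < n \<Longrightarrow> square_integrable M (e i)"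
    and ee: "\<And>i. i < n \<Longrightarrow> cross_moment M (e i) (e i) = \<Psi> i" and pos: "\<And>i. i < n \<Longrightarrow> pos_def (\<Psi> i)"
    and orth_e: "\<And>i j a b. j < i \<Longrightarrow> i < n \<Longrightarrow> (\<integral>\<omega>. (a \<bullet> e j \<omega>) * (b \<bullet> e i \<omega>) \<partial>M) = 0"
    and orth_X: "\<And>i j a b. j \<le> i \<Longrightarrow> i < n \<Longrightarrow> (\<integral>\<omega>. (a \<bullet> X j \<omega>) * (b \<bullet> e i \<omega>) \<partial>M) = 0"
  obtains KY :: "nat \<Rightarrow> real^'p^'d" and D :: "nat \<Rightarrow> 'a \<Rightarrow> real^'d" and \<epsilon> :: "nat \<Rightarrow> 'a \<Rightarrow> real^'p" where
    "\<And>i \<omega>. D i \<omega> = track_error F H \<Lambda> K KY (\<lambda>i. X i \<omega>) (\<lambda>i. e i \<omega>) i"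
    "\<And>i \<omega>. \<epsilon> i \<omega> = \<Lambda> *v X i \<omega> + H *v D i \<omega> + e i \<omega>"
    "\<And>i. i \<le> n \<Longrightarrow> square_integrable M (D i)" "\<And>i. i < n \<Longrightarrow> square_integrable M (\<epsilon> i)"
    "\<And>i. i < n \<Longrightarrow> cross_moment M (\<epsilon> i) (\<epsilon> i) = Psi_Y \<Lambda> H (\<Psi> i) (cross_moment M (X i) (X i),
        cross_moment M (D i) (D i), cross_moment M (X i) (D i))"
    "\<And>i a b. i < n \<Longrightarrow> a \<bullet> (cross_moment M (D (Suc i)) (D (Suc i)) *v a) \<le>
      joint_form (cross_moment M (X i) (X i)) (cross_moment M (D i) (D i)) (cross_moment M (X i) (D i))
         (transpose F *v a + transpose H *v b) (transpose \<Lambda> *v b)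
      + (transpose (K i) *v a + b) \<bullet> (\<Psi> i *v (transpose (K i) *v a + b))"
proof -
  note [simp del] = transpose_matrix_vector
  interpret prob_space M by fact
  define pr where "pr i d = (\<lambda>\<omega>. F *v d \<omega> + K i *v e i \<omega>)" for i and d :: "'a \<Rightarrow> real^'d"
  define ep where "ep i d = (\<lambda>\<omega>. \<Lambda> *v X i \<omega> + H *v d \<omega> + e i \<omega>)" for i and d :: "'a \<Rightarrow> real^'d"
  \<comment> \<open>The matrix that makes the best linear estimate of the uncorrected next error
    from \<open>ep\<close>. It is computed from moments averaged over the messages as well, so it is
    a fixed matrix known to the receiver.\<close>
  define G where "G i d = cross_moment M (pr i d) (ep i d) ** matrix_inv (cross_moment M (ep i d)
      (ep i d))" for i d
  \<comment> \<open>The gain at time i depends on the law of the error at time i, so errors are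
    constructed as random variables first; the gains are read off afterwards and
    \<open>track_error\<close> is recovered.\<close>
  define D where "D = rec_nat (\<lambda>\<omega>. 0) (\<lambda>i d \<omega>. pr i d \<omega> - G i d *v ep i d \<omega>)"
  define KY where "KY i = G i (D i)" for i
  define \<epsilon> where "\<epsilon> i = ep i (D i)" for i
  have D0: "D 0 = (\<lambda>\<omega>. 0)" and DS: "D (Suc i) = (\<lambda>\<omega>. pr i (D i) \<omega> - KY i *v \<epsilon> i \<omega>)" for i
    by (simp_all add: D_def KY_def \<epsilon>_def)
  have te: "D i \<omega> = track_error F H \<Lambda> K KY (\<lambda>i. X i \<omega>) (\<lambda>i. e i \<omega>) i" for i \<omega>
    by (induction i) (simp_all add: D0 DS pr_def ep_def \<epsilon>_def)
  have eps: "\<epsilon> i \<omega> = \<Lambda> *v X i \<omega> + H *v D i \<omega> + e i \<omega>" for i \<omega>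
    by (simp add: \<epsilon>_def ep_def)
  have sD: "square_integrable M (D i)" if "i \<le> n" for i
    using that
  proof (induction i)
    case 0 show ?case by (simp add: D0 square_integrable_def)
  next
    case (Suc i)
    then have "square_integrable M (D i)" "i < n" by auto
    with X e show ?case
      unfolding DS pr_def eps[abs_def] by (intro square_integrable_add square_integrable_diff
          square_integrable_matrix) auto
  qed
  have s\<epsilon>: "square_integrable M (\<epsilon> i)" if "i < n" for i
    using X e sD that unfolding eps[abs_def] by (intro square_integrable_add square_integrable_matrix) auto
  have spr: "square_integrable M (pr i (D i))" if "i < n" for i
    using e sD that unfolding pr_def by (intro square_integrable_add square_integrable_matrix) auto
  \<comment> \<open>An error at time j is a linear combination of inputs and innovations before j,
    all of which are orthogonal to \<open>e i\<close>.\<close>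
  have orth_D: "(\<integral>\<omega>. (a \<bullet> D j \<omega>) * (b \<bullet> e i \<omega>) \<partial>M) = 0" if "j \<le> i" "i < n" for i j a b
    using that(1)
  proof (induction j arbitrary: a)
    case 0 show ?case by (simp add: D0)
  next
    case (Suc j)
    let ?c = "- transpose (KY j) *v a"
    have *: "a \<bullet> D (Suc j) \<omega> = (transpose F *v a + transpose H *v ?c) \<bullet> D j \<omega> + (transpose (K j) *v
        a + ?c) \<bullet> e j \<omega> + (transpose \<Lambda> *v ?c) \<bullet> X j \<omega>" for \<omega>
    proof -
      have "(- transpose (KY j) *v a) = - (transpose (KY j) *v a)"
        by (metis scaleR_matrix_vector_assoc scaleR_minus1_left)
      then show ?thesis
        by (simp add: DS pr_def eps inner_add_left inner_add_right inner_diff_left inner_diff_right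
            inner_transpose_matrix matrix_vector_right_distrib)
    qed
    have "(\<integral>\<omega>. (a \<bullet> D (Suc j) \<omega>) * (b \<bullet> e i \<omega>) \<partial>M) =
       (\<integral>\<omega>. ((transpose F *v a + transpose H *v ?c) \<bullet> D j \<omega>) * (b \<bullet> e i \<omega>) \<partial>M)
       + (\<integral>\<omega>. ((transpose (K j) *v a + ?c) \<bullet> e j \<omega>) * (b \<bullet> e i \<omega>) \<partial>M)
       + (\<integral>\<omega>. ((transpose \<Lambda> *v ?c) \<bullet> X j \<omega>) * (b \<bullet> e i \<omega>) \<partial>M)"
      unfolding * using Suc.prems that(2) sD[of j] X[of j] e[of j] e[of i]
      by (simp add: distrib_right integrable_inner_mult)
    then show ?case
      using Suc that(2) by (simp add: orth_e orth_X)
  qed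
  define PX where "PX i = cross_moment M (X i) (X i)" for i
  define S where "S i = cross_moment M (D i) (D i)" for i
  define \<Gamma> where "\<Gamma> i = cross_moment M (X i) (D i)" for i
  have sym: "transpose (PX i) = PX i" "transpose (S i) = S i" for i
    by (simp_all add: PX_def S_def cross_moment_symmetric)
  have form: "(\<integral>\<omega>. (\<alpha> \<bullet> D i \<omega> + \<beta> \<bullet> X i \<omega>)\<^sup>2 \<partial>M) = joint_form (PX i) (S i) (\<Gamma> i) \<alpha> \<beta>" if "i < n" for i \<alpha> \<beta>
    unfolding PX_def S_def \<Gamma>_def using that by (intro joint_form_moments sD X) auto
  have sq: "(\<integral>\<omega>. (\<alpha> \<bullet> D i \<omega> + \<beta> \<bullet> X i \<omega> + c \<bullet> e i \<omega>)\<^sup>2 \<partial>M) = joint_form (PX i) (S i) (\<Gamma> i) \<alpha> \<beta> + c \<bullet>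
      (\<Psi> i *v c)"
    if i: "i < n" for i \<alpha> \<beta> c
  proof -
    note s = sD[OF less_imp_le[OF i]] X[OF i] e[OF i]
    note I = integrable_inner_mult[OF s(1) s(1)] integrable_inner_mult[OF s(2) s(2)]
        integrable_inner_mult[OF s(2) s(1)]
      integrable_inner_mult[OF s(1) s(2)] integrable_inner_mult[OF s(1) s(3)]
          integrable_inner_mult[OF s(2) s(3)] integrable_inner_mult[OF s(3) s(3)]
    have 1: "(\<alpha> \<bullet> D i \<omega> + \<beta> \<bullet> X i \<omega> + c \<bullet> e i \<omega>)\<^sup>2 = (\<alpha> \<bullet> D i \<omega> + \<beta> \<bullet> X i \<omega>)\<^sup>2 + 2 * ((\<alpha> \<bullet> D i \<omega>) *
        (c \<bullet> e i \<omega>))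
      + 2 * ((\<beta> \<bullet> X i \<omega>) * (c \<bullet> e i \<omega>)) + (c \<bullet> e i \<omega>) * (c \<bullet> e i \<omega>)" for \<omega>
      by (simp add: power2_eq_square algebra_simps)
    have J: "integrable M (\<lambda>\<omega>. (\<alpha> \<bullet> D i \<omega> + \<beta> \<bullet> X i \<omega>)\<^sup>2)"
      unfolding power2_eq_square distrib_left distrib_right by (intro Bochner_Integration.integrable_add I)
    show ?thesis
      unfolding 1 using i
      by (simp add: I J form orth_D orth_X inner_cross_moment[OF s(3) s(3)] ee)
  qed
  have PY: "cross_moment M (\<epsilon> i) (\<epsilon> i) = Psi_Y \<Lambda> H (\<Psi> i) (PX i, S i, \<Gamma> i)" if i: "i < n" for i
  proof (rule symmetric_matrix_eqI)
    let ?A = "cross_moment M (\<epsilon> i) (\<epsilon> i)" and ?B = "Psi_Y \<Lambda> H (\<Psi> i) (PX i, S i, \<Gamma> i)"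
    show "a \<bullet> (?A *v a) = a \<bullet> (?B *v a)" for a
    proof -
      have "a \<bullet> \<epsilon> i \<omega> = (transpose H *v a) \<bullet> D i \<omega> + (transpose \<Lambda> *v a) \<bullet> X i \<omega> + a \<bullet> e i \<omega>" for \<omega>
        by (simp add: eps inner_add_right inner_transpose_matrix)
      then have "(\<integral>\<omega>. (a \<bullet> \<epsilon> i \<omega>) * (a \<bullet> \<epsilon> i \<omega>) \<partial>M) = (\<integral>\<omega>. ((transpose H *v a) \<bullet> D i \<omega> + (transpose
          \<Lambda> *v a) \<bullet> X i \<omega> + a \<bullet> e i \<omega>)\<^sup>2 \<partial>M)"
        by (simp only: power2_eq_square)
      then show ?thesis
        unfolding Psi_Y_quadratic using sq[OF i] inner_cross_moment[OF s\<epsilon>[OF i] s\<epsilon>[OF i]] by simp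
    qed
    show "transpose ?B = ?B"
      using pos[OF i] by (intro Psi_Y_symmetric sym) (simp add: pos_def_def)
    show "transpose ?A = ?A" by (rule cross_moment_symmetric)
  qed
  \<comment> \<open>The gain solves the normal equations, so the residual \<open>D (Suc i)\<close>
    is orthogonal to \<open>\<epsilon> i\<close>. They are solvable because the second moment of
    \<open>\<epsilon> i\<close> inherits positive definiteness from \<open>\<Psi> i\<close>.\<close>
  have KYorth: "(\<integral>\<omega>. (a \<bullet> D (Suc i) \<omega>) * (c \<bullet> \<epsilon> i \<omega>) \<partial>M) = 0" if i: "i < n" for i a c
  proof -
    have f0: "0 \<le> joint_form (PX i) (S i) (\<Gamma> i) \<alpha> \<beta>" for \<alpha> \<beta>
      by (subst form[OF i, symmetric]) (intro integral_nonneg_AE AE_I2 zero_le_power2)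
    have "pos_def (cross_moment M (\<epsilon> i) (\<epsilon> i))"
      unfolding PY[OF i] by (intro pos_def_Psi_Y sym f0 pos i)
    then have inv: "invertible (cross_moment M (\<epsilon> i) (\<epsilon> i))" by (rule pos_def_invertible)
    have KYm: "KY i ** cross_moment M (\<epsilon> i) (\<epsilon> i) = cross_moment M (pr i (D i)) (\<epsilon> i)"
      unfolding KY_def G_def \<epsilon>_def[symmetric]
      by (simp add: matrix_mul_assoc[symmetric] matrix_inv_mult[OF inv])
    have "(\<integral>\<omega>. (a \<bullet> D (Suc i) \<omega>) * (c \<bullet> \<epsilon> i \<omega>) \<partial>M) =
       (\<integral>\<omega>. (a \<bullet> pr i (D i) \<omega>) * (c \<bullet> \<epsilon> i \<omega>) - ((transpose (KY i) *v a) \<bullet> \<epsilon> i \<omega>) * (c \<bullet> \<epsilon> i \<omega>) \<partial>M)"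
      by (simp add: DS inner_diff_right inner_transpose_matrix left_diff_distrib)
    also have "\<dots> = a \<bullet> (cross_moment M (pr i (D i)) (\<epsilon> i) *v c) - (transpose (KY i) *v a) \<bullet>
        (cross_moment M (\<epsilon> i) (\<epsilon> i) *v c)"
      using i by (simp add: integrable_inner_mult inner_cross_moment spr s\<epsilon>)
    also have "\<dots> = 0"
      unfolding KYm[symmetric] by (simp add: matrix_vector_mul_assoc[symmetric] inner_transpose_matrix)
    finally show ?thesis .
  qed
  have step: "a \<bullet> (S (Suc i) *v a) \<le> joint_form (PX i) (S i) (\<Gamma> i) (transpose F *v a + transpose H
      *v b) (transpose \<Lambda> *v b)
      + (transpose (K i) *v a + b) \<bullet> (\<Psi> i *v (transpose (K i) *v a + b))" if i: "i < n" for i a b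
  proof -
    let ?c = "transpose (KY i) *v a + b"
    have sS: "square_integrable M (D (Suc i))" using sD[of "Suc i"] i by simp
    note I = integrable_inner_mult[OF sS sS] integrable_inner_mult[OF sS s\<epsilon>[OF i]]
        integrable_inner_mult[OF s\<epsilon>[OF i] s\<epsilon>[OF i]]
    \<comment> \<open>The variable whose mean square is the right-hand side of the claim, rewritten
      as an orthogonal sum by adding and subtracting the correction
      \<open>KY i *v \<epsilon> i\<close>.\<close>
    have eq: "(transpose F *v a + transpose H *v b) \<bullet> D i \<omega> + (transpose \<Lambda> *v b) \<bullet> X i \<omega> +
        (transpose (K i) *v a + b) \<bullet> e i \<omega>
       = a \<bullet> D (Suc i) \<omega> + ?c \<bullet> \<epsilon> i \<omega>" for \<omega>
      by (simp add: DS pr_def eps inner_add_left inner_add_right inner_diff_right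
          inner_transpose_matrix matrix_vector_right_distrib)
    have "joint_form (PX i) (S i) (\<Gamma> i) (transpose F *v a + transpose H *v b) (transpose \<Lambda> *v b)
      + (transpose (K i) *v a + b) \<bullet> (\<Psi> i *v (transpose (K i) *v a + b))
      = (\<integral>\<omega>. (a \<bullet> D (Suc i) \<omega> + ?c \<bullet> \<epsilon> i \<omega>)\<^sup>2 \<partial>M)"
      unfolding sq[OF i, symmetric] eq ..
    also have "\<dots> = (\<integral>\<omega>. (a \<bullet> D (Suc i) \<omega>) * (a \<bullet> D (Suc i) \<omega>) + 2 * ((a \<bullet> D (Suc i) \<omega>) * (?c \<bullet> \<epsilon> i
        \<omega>)) + (?c \<bullet> \<epsilon> i \<omega>) * (?c \<bullet> \<epsilon> i \<omega>) \<partial>M)"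
      by (simp add: power2_eq_square algebra_simps)
    also have "\<dots> = a \<bullet> (S (Suc i) *v a) + (\<integral>\<omega>. (?c \<bullet> \<epsilon> i \<omega>) * (?c \<bullet> \<epsilon> i \<omega>) \<partial>M)"
      using i by (simp add: I KYorth S_def inner_cross_moment[OF sS sS])
    finally show ?thesis
      using integral_nonneg_AE[of "\<lambda>\<omega>. (?c \<bullet> \<epsilon> i \<omega>) * (?c \<bullet> \<epsilon> i \<omega>)" M] by simp
  qed
  show thesis
    using te eps sD s\<epsilon> PY[unfolded PX_def S_def \<Gamma>_def] step[unfolded PX_def S_def \<Gamma>_def] by (rule that)
qed

section \<open>Stable matrices\<close>

text \<open>The vector p(A) x, evaluated by Horner's rule.\<close>

definition poly_mat :: "'a::field^'n^'n \<Rightarrow> 'a poly \<Rightarrow> 'a^'n \<Rightarrow> 'a^'n" where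
  "poly_mat A p x = fold_coeffs (\<lambda>a y. a *s x + A *v y) p 0"

lemma poly_mat_0 [simp]: "poly_mat A 0 x = 0"
  by (simp add: poly_mat_def)

lemma poly_mat_pCons: "poly_mat A (pCons a p) x = a *s x + A *v poly_mat A p x"
  unfolding poly_mat_def by (cases "p = 0 \<and> a = 0") auto

lemma poly_mat_1 [simp]: "poly_mat A 1 x = x"
  unfolding one_pCons by (simp add: poly_mat_pCons)

lemma poly_mat_add: "poly_mat A (p + q) x = poly_mat A p x + poly_mat A q x"
  by (induction p q rule: poly_induct2) (simp_all add: poly_mat_pCons vec.scale_left_distrib
      matrix_vector_right_distrib)

lemma poly_mat_smult: "poly_mat A (smult c p) x = c *s poly_mat A p x"
  by (induction p) (simp_all add: poly_mat_pCons vec.scale_right_distrib vector_scalar_commute)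

lemma poly_mat_mult: "poly_mat A (p * q) x = poly_mat A p (poly_mat A q x)"
  by (induction p) (simp_all add: poly_mat_pCons poly_mat_add poly_mat_smult)

lemma poly_mat_eigenvector:
  assumes "A *v x = k *s x" shows "poly_mat A p x = poly p k *s x"
  by (induction p) (simp_all add: poly_mat_pCons vec.scale_left_distrib vector_scalar_commute assms
      mult.commute)

lemma poly_mat_linear: "poly_mat A p (x + y) = poly_mat A p x + poly_mat A p y"
    "poly_mat A p (c *s x) = c *s poly_mat A p x" "poly_mat A p 0 = 0"
  by (induction p; simp add: poly_mat_pCons vec.scale_right_distrib matrix_vector_right_distrib
      vector_scalar_commute mult.commute)+

lemma poly_mat_sum: "poly_mat A p (\<Sum>i\<in>I. f i) = (\<Sum>i\<in>I. poly_mat A p (f i))"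
  by (induction I rule: infinite_finite_induct) (simp_all add: poly_mat_linear)

lemma poly_mat_sum_left: "poly_mat A (\<Sum>i\<in>I. f i) x = (\<Sum>i\<in>I. poly_mat A (f i) x)"
  by (induction I rule: infinite_finite_induct) (simp_all add: poly_mat_add)

lemma poly_mat_monom: "poly_mat A (monom c i) x = c *s ((*v) A ^^ i) x"
  by (induction i) (simp_all add: monom_0 monom_Suc poly_mat_pCons vector_scalar_commute)

text \<open>The vectors x, A x, ..., A^n x are one more than the dimension; the coefficients of a
  linear relation between them form the polynomial.\<close>

lemma annihilating_poly:
  fixes A :: "'a::field^'n^'n"
  shows "\<exists>p. p \<noteq> 0 \<and> poly_mat A p x = 0"
proof -
  let ?n = "CARD('n)" and ?f = "\<lambda>i. ((*v) A ^^ i) x"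
  show ?thesis
  \<comment> \<open>Dependence is a property of a set of vectors, so a repetition in the list of
    iterates is treated apart; it gives a difference of two monomials.\<close>
  proof (cases "inj_on ?f {..?n}")
    case False
    then obtain i j where "i \<noteq> j" "?f i = ?f j" by (auto simp: inj_on_def)
    then have "poly_mat A (monom 1 i + monom (- 1) j) x = 0"
      by (simp add: poly_mat_add poly_mat_monom)
    moreover have "coeff (monom 1 i + monom (- 1) j) i = (1::'a)" using \<open>i \<noteq> j\<close> by simp
    then have "monom 1 i + monom (- 1) j \<noteq> (0 :: 'a poly)" by (metis coeff_0 zero_neq_one)
    ultimately show ?thesis by blast
  next
    case True
    then have "card (?f ` {..?n}) = ?n + 1" by (simp add: card_image)
    have "vec.dependent (?f ` {..?n})"
    proof (rule ccontr)
      assume "vec.independent (?f ` {..?n})"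
      from vec.independent_card_le_dim[OF subset_UNIV this]
      have "card (?f ` {..?n}) \<le> CARD('n)" unfolding vec_dim_card .
      then show False using \<open>card (?f ` {..?n}) = ?n + 1\<close> by linarith
    qed
    then obtain u where u: "\<exists>v\<in>?f ` {..?n}. u v \<noteq> 0" "(\<Sum>v\<in>?f ` {..?n}. u v *s v) = 0"
      by (subst (asm) vec.dependent_finite) auto
    define p where "p = (\<Sum>i\<le>?n. monom (u (?f i)) i)"
    have "poly_mat A p x = (\<Sum>i\<le>?n. u (?f i) *s ?f i)"
      by (simp add: p_def poly_mat_sum_left poly_mat_monom)
    also have "\<dots> = 0" using u(2) True by (simp add: sum.reindex)
    finally have "poly_mat A p x = 0" .
    moreover obtain i where "i \<le> ?n" "u (?f i) \<noteq> 0" using u(1) by auto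
    then have "coeff p i \<noteq> 0" by (simp add: p_def coeff_sum)
    then have "p \<noteq> 0" by auto
    ultimately show ?thesis by blast
  qed
qed

text \<open>The product of annihilating polynomials of the axis vectors annihilates every vector, so
  each eigenvalue is one of its roots. Finiteness makes the \<open>Max\<close> in
  \<open>spectral_radius\<close> an upper bound for the moduli.\<close>

lemma finite_eigenvalues:
  fixes A :: "complex^'n^'n"
  shows "finite {k. \<exists>x. x \<noteq> 0 \<and> A *v x = k *s x}"
proof -
  have "\<exists>p. \<forall>i::'n. p i \<noteq> 0 \<and> poly_mat A (p i) (axis i 1) = 0"
    by (rule choice) (use annihilating_poly in blast)
  then obtain p where p: "\<And>i::'n. p i \<noteq> 0" "\<And>i. poly_mat A (p i) (axis i 1) = 0" by blast
  define P where "P = (\<Prod>i\<in>UNIV. p i)"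
  have "P \<noteq> 0" using p(1) by (simp add: P_def)
  have z: "poly_mat A P x = 0" for x
  proof -
    have "poly_mat A P (axis i 1) = 0" for i
    proof -
      have "P = (\<Prod>j\<in>UNIV - {i}. p j) * p i"
        unfolding P_def by (subst prod.remove[of UNIV i]) (simp_all add: mult.commute)
      then show ?thesis by (simp add: poly_mat_mult p(2) poly_mat_linear)
    qed
    then have "poly_mat A P (\<Sum>i\<in>UNIV. x $ i *s axis i 1) = 0"
      by (simp add: poly_mat_sum poly_mat_linear)
    then show ?thesis by (simp add: basis_expansion)
  qed
  have "{k. \<exists>x. x \<noteq> 0 \<and> A *v x = k *s x} \<subseteq> {k. poly P k = 0}"
    using z poly_mat_eigenvector[of A _ _ P] by auto
  then show ?thesis using poly_roots_finite[OF \<open>P \<noteq> 0\<close>] finite_subset by blast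
qed

lemma linear_recurrence_tendsto_0:
  fixes u y :: "nat \<Rightarrow> complex"
  assumes rec: "\<And>k. u (Suc k) = a * u k + y k" and a: "cmod a < 1" and y: "y \<longlonglongrightarrow> 0"
  shows "u \<longlonglongrightarrow> 0"
proof (rule LIMSEQ_I)
  fix r :: real assume "0 < r"
  \<comment> \<open>The perturbation size for which r/2 is the fixed point of the map t -> |a| t +
    d, so that r/2 reproduces itself in the induction below.\<close>
  let ?d = "r / 2 * (1 - cmod a)"
  have "0 < ?d" using \<open>0 < r\<close> a by simp
  then obtain K where K: "\<And>k. K \<le> k \<Longrightarrow> cmod (y k) < ?d"
    using LIMSEQ_D[OF y] by (metis diff_zero)
  have b: "cmod (u (K + j)) \<le> cmod a ^ j * cmod (u K) + r / 2" for j
  proof (induction j)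
    case (Suc j)
    have "cmod (u (K + Suc j)) \<le> cmod a * cmod (u (K + j)) + cmod (y (K + j))"
      using norm_triangle_ineq[of "a * u (K + j)" "y (K + j)"] by (simp add: rec norm_mult)
    also have "\<dots> \<le> cmod a * (cmod a ^ j * cmod (u K) + r / 2) + ?d"
      using K[of "K + j"] Suc by (intro add_mono mult_left_mono) auto
    also have "\<dots> = cmod a ^ Suc j * cmod (u K) + r / 2" by (simp add: field_simps)
    finally show ?case .
  qed (use \<open>0 < r\<close> in simp)
  have "(\<lambda>j. cmod a ^ j * cmod (u K)) \<longlonglongrightarrow> 0 * cmod (u K)"
    using a by (intro tendsto_intros LIMSEQ_power_zero) simp
  then obtain J where J: "\<And>j. J \<le> j \<Longrightarrow> cmod a ^ j * cmod (u K) < r / 2"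
    using LIMSEQ_D[of "\<lambda>j. cmod a ^ j * cmod (u K)" 0 "r / 2"] \<open>0 < r\<close> by (auto simp: abs_mult)
  have "norm (u k - 0) < r" if "K + J \<le> k" for k
  proof -
    have "J \<le> k - K" "K + (k - K) = k" using that by linarith+
    then show ?thesis using b[of "k - K"] J[of "k - K"] by simp
  qed
  then show "\<exists>no. \<forall>n\<ge>no. norm (u n - 0) < r" by blast
qed

text \<open>Every vector is annihilated by a product of factors \<open>A - a\<close>. A factor with \<open>a\<close> not an eigenvalue
  can be dropped; each of the others contributes a linear recurrence with ratio of modulus below 1.\<close>

lemma power_matrix_tendsto_0:
  fixes A :: "real^'n^'n"
  assumes "spectral_radius A < 1"
  shows "(\<lambda>k. ((*v) A ^^ k) x) \<longlonglongrightarrow> 0"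
proof -
  let ?T = "complex_mat A"
  have ev: "cmod k < 1" if "x \<noteq> 0" "?T *v x = k *s x" for k x
  proof -
    have "finite {cmod k | k. \<exists>x. x \<noteq> 0 \<and> ?T *v x = k *s x}"
      using finite_imageI[OF finite_eigenvalues[of ?T], of cmod] by (simp add: setcompr_eq_image)
    then have "cmod k \<le> spectral_radius A"
      unfolding spectral_radius_def using that by (intro Max_ge) auto
    then show ?thesis using assms by simp
  qed
  have main: "(\<lambda>k. ((*v) ?T ^^ k) x $ i) \<longlonglongrightarrow> 0"
    if "poly_mat ?T (\<Prod>a\<in>#B. [:- a, 1:]) x = 0" for B x i
    using that
  proof (induction "size B" arbitrary: B x)
    case 0
    have "((*v) ?T ^^ k) 0 = 0" for k by (induction k) simp_all
    with 0 show ?case by simp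
  next
    case (Suc n)
    then obtain a C where B: "B = add_mset a C" "size C = n" by (cases B) auto
    let ?q = "\<Prod>a\<in>#C. [:- a, 1:]"
    have eq: "(\<Prod>a\<in>#B. [:- a, 1:]) = [:- a, 1:] * ?q"
      unfolding B by (simp only: image_mset_add_mset prod_mset.add_mset)
    have lin: "poly_mat ?T [:- a, 1:] x = ?T *v x - a *s x" for x
      by (simp add: poly_mat_pCons)
    show ?case
    proof (cases "poly_mat ?T ?q x = 0")
      case True
      with Suc(1)[of C] B show ?thesis by simp
    next
      case False
      have "poly_mat ?T [:- a, 1:] (poly_mat ?T ?q x) = 0"
        using Suc.prems unfolding eq poly_mat_mult .
      then have "?T *v poly_mat ?T ?q x = a *s poly_mat ?T ?q x" by (simp add: lin)
      then have a: "cmod a < 1" using ev False by blast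
      \<comment> \<open>The factors commute, so ?q annihilates this vector and the induction
        hypothesis gives its decay. The iterates of x obey the recurrence with ratio a and this
        decaying inhomogeneity.\<close>
      let ?y = "?T *v x - a *s x"
      have "poly_mat ?T ?q ?y = poly_mat ?T (?q * [:- a, 1:]) x"
        unfolding poly_mat_mult lin ..
      also have "\<dots> = 0" using Suc.prems unfolding eq mult.commute[of ?q] .
      finally have y: "(\<lambda>k. ((*v) ?T ^^ k) ?y $ i) \<longlonglongrightarrow> 0" using Suc(1)[of C ?y] B by simp
      have l: "((*v) ?T ^^ k) (v - a *s w) = ((*v) ?T ^^ k) v - a *s ((*v) ?T ^^ k) w" for k v w
        by (induction k) (simp_all add: matrix_vector_mult_diff_distrib vector_scalar_commute)
      have "((*v) ?T ^^ Suc k) x $ i = a * ((*v) ?T ^^ k) x $ i + ((*v) ?T ^^ k) ?y $ i" for k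
        unfolding l by (simp add: funpow_swap1)
      then show ?thesis using a y by (rule linear_recurrence_tendsto_0)
    qed
  qed
  have cl: "(\<lambda>k. ((*v) ?T ^^ k) x $ i) \<longlonglongrightarrow> 0" for x i
  proof -
    obtain p where p: "p \<noteq> 0" "poly_mat ?T p x = 0" using annihilating_poly[of ?T] by blast
    obtain B where B: "p = smult (lead_coeff p) (\<Prod>x\<in>#B. [:- x, 1:])" using
        alg_closed_imp_factorization[OF p(1)] by blast
    have "lead_coeff p *s poly_mat ?T (\<Prod>x\<in>#B. [:- x, 1:]) x = 0"
      using p(2) by (subst (asm) B) (simp only: poly_mat_smult)
    then have "poly_mat ?T (\<Prod>x\<in>#B. [:- x, 1:]) x = 0" using p(1) by simp
    then show ?thesis by (rule main)
  qed
  let ?c = "\<lambda>x::real^'n. (\<chi> i. complex_of_real (x $ i))"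
  have "((*v) ?T ^^ k) (?c x) = ?c (((*v) A ^^ k) x)" for k
    by (induction k) (simp_all add: complex_mat_def map_matrix_def matrix_vector_mult_def vec_eq_iff)
  then have "(\<lambda>k. complex_of_real (((*v) A ^^ k) x $ i)) \<longlonglongrightarrow> complex_of_real 0" for i
    using cl[of "?c x" i] by simp
  then have "(\<lambda>k. ((*v) A ^^ k) x $ i) \<longlonglongrightarrow> 0" for i
    by (simp only: tendsto_of_real_iff)
  then show ?thesis by (intro vec_tendstoI) simp
qed

section \<open>The feasible set\<close>

definition join_vec :: "real^'m \<Rightarrow> real^'n \<Rightarrow> real^('m + 'n)" where
  "join_vec a b = (\<chi> i. case i of Inl k \<Rightarrow> a $ k | Inr k \<Rightarrow> b $ k)"

lemma join_vec_cases: obtains a b where "x = join_vec a b"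
  by (rule that[of "\<chi> k. x $ Inl k" "\<chi> k. x $ Inr k"]) (simp add: join_vec_def vec_eq_iff split: sum.split)

lemma sum_UNIV_sum: "(\<Sum>i\<in>(UNIV :: ('a::finite + 'b::finite) set). f i) = (\<Sum>i\<in>UNIV. f (Inl i)) +
    (\<Sum>i\<in>UNIV. f (Inr i))"
  unfolding UNIV_Plus_UNIV[symmetric] by (subst sum.Plus) simp_all

lemma inner_block_mat:
  "join_vec a b \<bullet> (block_mat A B C D *v join_vec c d) = a \<bullet> (A *v c) + a \<bullet> (B *v d) + b \<bullet> (C *v c) +
      b \<bullet> (D *v d)"
  by (simp add: join_vec_def block_mat_def inner_vec_def matrix_vector_mult_def sum_UNIV_sum
      distrib_left sum.distrib)

lemma transpose_block_mat:
  "transpose (block_mat A B C D) = block_mat (transpose A) (transpose C) (transpose B) (transpose D)"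
  by (simp add: block_mat_def transpose_def vec_eq_iff split: sum.split)

lemma block_mat_eq_iff: "block_mat A B C D = block_mat A' B' C' D' \<longleftrightarrow> A = A' \<and> B = B' \<and> C = C' \<and> D = D'"
proof
  assume "block_mat A B C D = block_mat A' B' C' D'"
  then have "block_mat A B C D $ i $ j = block_mat A' B' C' D' $ i $ j" for i j by simp
  note this[of "Inl _" "Inl _"] this[of "Inl _" "Inr _"] this[of "Inr _" "Inl _"] this[of "Inr _" "Inr _"]
  then show "A = A' \<and> B = B' \<and> C = C' \<and> D = D'" by (simp add: block_mat_def vec_eq_iff)
qed simp

lemma psd_block_mat:
  "psd (block_mat A B C D) \<longleftrightarrow> transpose A = A \<and> transpose D = D \<and> C = transpose B \<and>
     (\<forall>a b. 0 \<le> a \<bullet> (A *v a) + 2 * (a \<bullet> (B *v b)) + b \<bullet> (D *v b))"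
proof -
  have 1: "b \<bullet> (transpose B *v a) = a \<bullet> (B *v b)" for a b
    by (metis inner_commute inner_matrix_vector)
  have 2: "(\<forall>x. Q x) \<longleftrightarrow> (\<forall>a b. Q (join_vec a b))" for Q :: "real^('a + 'b) \<Rightarrow> bool"
    by (metis join_vec_cases)
  have 3: "join_vec a b \<bullet> (block_mat A B (transpose B) D *v join_vec a b) = a \<bullet> (A *v a) + 2 * (a \<bullet>
      (B *v b)) + b \<bullet> (D *v b)" for a b
    unfolding inner_block_mat 1 by simp
  have "psd (block_mat A B C D) \<longleftrightarrow> transpose A = A \<and> transpose D = D \<and> C = transpose B \<and>
     (\<forall>a b. 0 \<le> join_vec a b \<bullet> (block_mat A B C D *v join_vec a b))"
    unfolding psd_def transpose_block_mat block_mat_eq_iff 2 by auto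
  then show ?thesis using 3 by auto
qed

lemma transpose_minus: "transpose (A - B) = transpose A - transpose (B :: real^'n^'m)"
  by (simp add: transpose_def vec_eq_iff)

text \<open>The first constraint and \<open>\<Psi>\<close> make \<open>Psi_Y\<close> invertible, so
  the product \<open>K_Y ** Psi_Y\<close> contains no inverse. The quadratic form of the second
  block matrix at (a, b) is then the difference of the two sides of the last inequality. In this
  form all constraints are linear in the decision variables up to a constant.\<close>

lemma feasible_set_iff:
  assumes \<Psi>: "pos_def \<Psi>"
  shows "(PX, S, \<Gamma>) \<in> feasible_set \<Lambda> F H Kp \<Psi> c \<longleftrightarrow>
    transpose PX = PX \<and> transpose S = S \<and> (\<forall>\<alpha> \<beta>. 0 \<le> joint_form PX S \<Gamma> \<alpha> \<beta>) \<and> trace PX \<le> c \<and>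
    (\<forall>a b. a \<bullet> (S *v a) \<le> joint_form PX S \<Gamma> (transpose F *v a + transpose H *v b) (transpose \<Lambda> *v b)
       + (transpose Kp *v a + b) \<bullet> (\<Psi> *v (transpose Kp *v a + b)))" (is "?L \<longleftrightarrow> ?R")
proof -
  note [simp del] = transpose_matrix_vector
  have \<Psi>s: "transpose \<Psi> = \<Psi>" using \<Psi> by (simp add: pos_def_def)
  have b1: "psd (block_mat PX \<Gamma> (transpose \<Gamma>) S) \<longleftrightarrow> transpose PX = PX \<and> transpose S = S \<and> (\<forall>\<alpha> \<beta>. 0 \<le>
      joint_form PX S \<Gamma> \<alpha> \<beta>)"
    unfolding psd_block_mat joint_form_def by (auto simp: add.commute add.left_commute)
  have b2: "psd (block_mat (F ** S ** transpose F + Kp ** \<Psi> ** transpose Kp - S) (K_Y \<Lambda> F H Kp \<Psi>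
      (PX, S, \<Gamma>) ** Psi_Y \<Lambda> H \<Psi> (PX, S, \<Gamma>))
         (Psi_Y \<Lambda> H \<Psi> (PX, S, \<Gamma>) ** transpose (K_Y \<Lambda> F H Kp \<Psi> (PX, S, \<Gamma>))) (Psi_Y \<Lambda> H \<Psi> (PX, S, \<Gamma>))) \<longleftrightarrow>
    (\<forall>a b. a \<bullet> (S *v a) \<le> joint_form PX S \<Gamma> (transpose F *v a + transpose H *v b) (transpose \<Lambda> *v b)
       + (transpose Kp *v a + b) \<bullet> (\<Psi> *v (transpose Kp *v a + b)))"
    if sym: "transpose PX = PX" "transpose S = S" and nn: "\<forall>\<alpha> \<beta>. 0 \<le> joint_form PX S \<Gamma> \<alpha> \<beta>"
  proof -
    let ?PY = "Psi_Y \<Lambda> H \<Psi> (PX, S, \<Gamma>)"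
    have PY: "pos_def ?PY" using nn by (intro pos_def_Psi_Y sym \<Psi>) auto
    have PYs: "transpose ?PY = ?PY" using PY by (simp add: pos_def_def)
    have K: "K_Y \<Lambda> F H Kp \<Psi> (PX, S, \<Gamma>) ** ?PY = F ** transpose \<Gamma> ** transpose \<Lambda> + F ** S **
        transpose H + Kp ** \<Psi>"
      unfolding K_Y_def by (simp add: matrix_mul_assoc[symmetric] matrix_inv_mult[OF
          pos_def_invertible[OF PY]])
    have s1: "transpose (F ** S ** transpose F + Kp ** \<Psi> ** transpose Kp - S) = F ** S ** transpose
        F + Kp ** \<Psi> ** transpose Kp - S"
      by (simp add: transpose_plus transpose_minus matrix_transpose_mul matrix_mul_assoc sym \<Psi>s)
    have s2: "?PY ** transpose (K_Y \<Lambda> F H Kp \<Psi> (PX, S, \<Gamma>)) = transpose (K_Y \<Lambda> F H Kp \<Psi> (PX, S, \<Gamma>) ** ?PY)"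
      by (simp add: matrix_transpose_mul PYs)
    have S': "x \<bullet> (S *v y) = y \<bullet> (S *v x)" for x y
      by (metis sym(2) inner_commute inner_matrix_vector)
    have P': "x \<bullet> (\<Psi> *v y) = y \<bullet> (\<Psi> *v x)" for x y
      by (metis \<Psi>s inner_commute inner_matrix_vector)
    have G': "x \<bullet> (transpose \<Gamma> *v y) = y \<bullet> (\<Gamma> *v x)" for x y
      by (metis inner_commute inner_matrix_vector)
    have q: "a \<bullet> ((F ** S ** transpose F + Kp ** \<Psi> ** transpose Kp - S) *v a)
        + 2 * (a \<bullet> ((F ** transpose \<Gamma> ** transpose \<Lambda> + F ** S ** transpose H + Kp ** \<Psi>) *v b)) + b \<bullet>
            (?PY *v b)
      = joint_form PX S \<Gamma> (transpose F *v a + transpose H *v b) (transpose \<Lambda> *v b)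
       + (transpose Kp *v a + b) \<bullet> (\<Psi> *v (transpose Kp *v a + b)) - a \<bullet> (S *v a)" for a b
      unfolding Psi_Y_quadratic joint_form_def
      using S'[of "transpose H *v b" "transpose F *v a"] P'[of b "transpose Kp *v a"] G'[of
          "transpose F *v a" "transpose \<Lambda> *v b"]
      by (simp add: matrix_vector_mult_add_rdistrib matrix_vector_mult_diff_rdistrib
          matrix_vector_right_distrib inner_add_left inner_add_right inner_diff_right
          matrix_vector_mul_assoc[symmetric] inner_transpose_matrix[symmetric, of _ F]
              inner_transpose_matrix[symmetric, of _ Kp])
    show ?thesis unfolding psd_block_mat s2 K using s1 PYs by (simp add: q)
  qed
  show ?thesis
    unfolding feasible_set_def Let_def using b1 b2 by auto
qed

section \<open>Bounds for feasible points\<close>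

lemma discriminant_le:
  fixes u x y :: real
  assumes "\<And>t. 0 \<le> u + 2 * t * x + t\<^sup>2 * y" and "0 \<le> y" shows "x\<^sup>2 \<le> u * y"
proof (cases "y = 0")
  case True
  have "x = 0"
  proof (rule ccontr)
    assume "x \<noteq> 0"
    \<comment> \<open>With y = 0 this value of t makes the expression equal to -1.\<close>
    then show False using assms(1)[of "- (u + 1) / (2 * x)"] True by (simp add: field_simps)
  qed
  then show ?thesis using True by simp
next
  case False
  with assms(2) have y: "0 < y" by simp
  have "0 \<le> (u + 2 * (- x / y) * x + (- x / y)\<^sup>2 * y) * y"
    using assms(1)[of "- x / y"] y by (intro mult_nonneg_nonneg) auto
  also have "\<dots> = u * y - x\<^sup>2" using y by (simp add: power2_eq_square field_simps)
  finally show ?thesis by simp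
qed

text \<open>Scaling \<open>\<beta>\<close> alone turns the form into a nonnegative quadratic
  polynomial in one variable. Its discriminant gives a Cauchy-Schwarz inequality between the two
  blocks, and this in turn the triangle inequality in the last part.\<close>

lemma joint_form_facts:
  assumes nn: "\<And>\<alpha> \<beta>. 0 \<le> joint_form PX S \<Gamma> \<alpha> \<beta>"
  shows "0 \<le> \<alpha> \<bullet> (S *v \<alpha>)" "0 \<le> \<beta> \<bullet> (PX *v \<beta>)"
    "\<bar>\<beta> \<bullet> (\<Gamma> *v \<alpha>)\<bar> \<le> sqrt (\<beta> \<bullet> (PX *v \<beta>)) * sqrt (\<alpha> \<bullet> (S *v \<alpha>))"
    "joint_form PX S \<Gamma> \<alpha> \<beta> \<le> (sqrt (\<alpha> \<bullet> (S *v \<alpha>)) + sqrt (\<beta> \<bullet> (PX *v \<beta>)))\<^sup>2"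
proof -
  show s: "0 \<le> \<alpha> \<bullet> (S *v \<alpha>)" using nn[of \<alpha> 0] by (simp add: joint_form_def)
  show p: "0 \<le> \<beta> \<bullet> (PX *v \<beta>)" using nn[of 0 \<beta>] by (simp add: joint_form_def)
  have "0 \<le> \<alpha> \<bullet> (S *v \<alpha>) + 2 * t * (\<beta> \<bullet> (\<Gamma> *v \<alpha>)) + t\<^sup>2 * (\<beta> \<bullet> (PX *v \<beta>))" for t
    using nn[of \<alpha> "t *\<^sub>R \<beta>"] by (simp add: joint_form_def matrix_vector_mult_scaleR power2_eq_square mult_ac)
  from discriminant_le[OF this p] show c: "\<bar>\<beta> \<bullet> (\<Gamma> *v \<alpha>)\<bar> \<le> sqrt (\<beta> \<bullet> (PX *v \<beta>)) * sqrt (\<alpha> \<bullet> (S *v \<alpha>))"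
    unfolding real_sqrt_mult[symmetric] by (intro real_le_rsqrt) (simp add: mult.commute)
  show "joint_form PX S \<Gamma> \<alpha> \<beta> \<le> (sqrt (\<alpha> \<bullet> (S *v \<alpha>)) + sqrt (\<beta> \<bullet> (PX *v \<beta>)))\<^sup>2"
    using c s p by (simp add: joint_form_def power2_sum abs_le_iff mult_ac)
qed

text \<open>Cauchy-Schwarz for the semidefinite form of A. At axis vectors it bounds an entry by the
  two diagonal entries of its row and column.\<close>

lemma psd_entry_le:
  fixes A :: "real^'n^'n"
  assumes sym: "transpose A = A" and nn: "\<And>x. 0 \<le> x \<bullet> (A *v x)"
  shows "\<bar>x \<bullet> (A *v y)\<bar> \<le> sqrt (x \<bullet> (A *v x)) * sqrt (y \<bullet> (A *v y))"
proof -
  have s: "y \<bullet> (A *v x) = x \<bullet> (A *v y)" by (metis sym inner_commute inner_matrix_vector)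
  have "0 \<le> x \<bullet> (A *v x) + 2 * t * (x \<bullet> (A *v y)) + t\<^sup>2 * (y \<bullet> (A *v y))" for t
    using nn[of "x + t *\<^sub>R y"] s by (simp add: matrix_vector_right_distrib matrix_vector_mult_scaleR
        inner_add_left inner_add_right power2_eq_square algebra_simps)
  from discriminant_le[OF this nn] show ?thesis
    unfolding real_sqrt_mult[symmetric] by (intro real_le_rsqrt) simp
qed

lemma matrix_norm_le:
  fixes A :: "real^'n^'m" and c :: real
  assumes "\<And>i j. \<bar>A $ i $ j\<bar> \<le> c"
  shows "norm A \<le> CARD('m) * (CARD('n) * c)"
proof -
  have "norm A \<le> (\<Sum>i\<in>UNIV. norm (A $ i))" unfolding norm_vec_def by (rule L2_set_le_sum) simp
  also have "\<dots> \<le> (\<Sum>i\<in>(UNIV::'m set). CARD('n) * c)"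
  proof (rule sum_mono)
    fix i
    have "norm (A $ i) \<le> (\<Sum>j\<in>UNIV. \<bar>A $ i $ j\<bar>)" by (rule norm_le_l1_cart)
    also have "\<dots> \<le> (\<Sum>j\<in>(UNIV::'n set). c)" by (intro sum_mono assms)
    finally show "norm (A $ i) \<le> CARD('n) * c" by simp
  qed
  finally show ?thesis by simp
qed

lemma inner_matrix_le_entries:
  fixes A :: "real^'n^'n" and c :: real
  assumes c: "\<And>i j. \<bar>A $ i $ j\<bar> \<le> c"
  shows "x \<bullet> (A *v x) \<le> (CARD('n) * (CARD('n) * c)) * (norm x)\<^sup>2"
proof -
  have c0: "0 \<le> c" using c[of undefined undefined] by linarith
  have "x \<bullet> (A *v x) = (\<Sum>i\<in>UNIV. \<Sum>j\<in>UNIV. A $ i $ j * (x $ i * x $ j))"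
    by (simp add: inner_vec_def matrix_vector_mult_def sum_distrib_left mult_ac)
  also have "\<dots> \<le> (\<Sum>i\<in>(UNIV::'n set). \<Sum>j\<in>(UNIV::'n set). c * (norm x * norm x))"
  proof (intro sum_mono)
    fix i j
    have "A $ i $ j * (x $ i * x $ j) \<le> \<bar>A $ i $ j\<bar> * (\<bar>x $ i\<bar> * \<bar>x $ j\<bar>)"
      unfolding abs_mult[symmetric] by (rule abs_ge_self)
    also have "\<dots> \<le> c * (norm x * norm x)"
      by (intro mult_mono c component_le_norm_cart) (simp_all add: c0)
    finally show "A $ i $ j * (x $ i * x $ j) \<le> c * (norm x * norm x)" .
  qed
  finally show ?thesis by (simp add: power2_eq_square mult_ac)
qed

text \<open>Iterate the recursion until the power of the matrix has norm at most 1/2, then evaluate at a maximum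
  of \<open>g\<close> on the unit sphere.\<close>

lemma stable_bound:
  fixes A :: "real^'n^'n"
  assumes "spectral_radius A < 1"
  obtains C where "0 \<le> C" "\<And>g c a. continuous_on UNIV g \<Longrightarrow> (\<And>t a. g (t *\<^sub>R a) = \<bar>t\<bar> * g a) \<Longrightarrow> 0 \<le> c \<Longrightarrow>
     (\<And>a. g a \<le> g (transpose A *v a) + c * norm a) \<Longrightarrow> g a \<le> C * c * norm a"
proof -
  let ?B = "\<lambda>k. ((*v) (transpose A)) ^^ k"
  \<comment> \<open>The pairing moves powers of the transpose to powers of A, so their decay carries
    over coordinate by coordinate.\<close>
  have dual: "(?B k x) \<bullet> y = x \<bullet> (((*v) A ^^ k) y)" for k x y
  proof (induction k arbitrary: x)
    case (Suc k)
    have "(?B (Suc k) x) \<bullet> y = (?B k (transpose A *v x)) \<bullet> y" by (simp add: funpow_swap1 del: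
        transpose_matrix_vector)
    also have "\<dots> = x \<bullet> (((*v) A ^^ Suc k) y)" by (simp add: Suc inner_transpose_matrix del:
        transpose_matrix_vector)
    finally show ?case .
  qed simp
  have lim: "(\<lambda>k. ?B k x) \<longlonglongrightarrow> 0" for x
  proof (rule vec_tendstoI)
    fix i
    have "(\<lambda>k. x \<bullet> (((*v) A ^^ k) (axis i 1))) \<longlonglongrightarrow> x \<bullet> 0"
      by (intro tendsto_intros power_matrix_tendsto_0 assms)
    then show "(\<lambda>k. ?B k x $ i) \<longlonglongrightarrow> 0 $ i"
      unfolding dual[symmetric] by (simp add: inner_axis del: transpose_matrix_vector)
  qed
  have lin: "linear (?B k)" for k
    by (induction k) (simp_all add: linear_id[unfolded id_def] linear_compose[unfolded o_def]
        matrix_vector_mul_linear del: transpose_matrix_vector)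
  have "(\<lambda>k. \<Sum>i\<in>UNIV. norm (?B k (axis i 1))) \<longlonglongrightarrow> (\<Sum>i\<in>(UNIV::'n set). 0)"
    by (intro tendsto_intros tendsto_norm_zero lim)
  then have "(\<lambda>k. \<Sum>i\<in>UNIV. norm (?B k (axis i 1))) \<longlonglongrightarrow> 0"
    unfolding sum.neutral_const .
  then have "eventually (\<lambda>k. (\<Sum>i\<in>UNIV. norm (?B k (axis i 1))) < 1 / 2) sequentially"
    by (rule order_tendstoD(2)) simp
  then obtain k where k: "(\<Sum>i\<in>UNIV. norm (?B k (axis i 1))) < 1 / 2"
    unfolding eventually_sequentially by blast
  have half: "norm (?B k x) \<le> norm x / 2" for x
  proof -
    have "x = (\<Sum>i\<in>UNIV. (x $ i) *\<^sub>R axis i 1)" by (simp add: basis_expansion[of x, unfolded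
        scalar_mult_eq_scaleR])
    then have "?B k x = ?B k (\<Sum>i\<in>UNIV. (x $ i) *\<^sub>R axis i 1)" by (rule arg_cong)
    also have "\<dots> = (\<Sum>i\<in>UNIV. (x $ i) *\<^sub>R ?B k (axis i 1))"
      unfolding linear_sum[OF lin] by (simp only: linear_scale[OF lin])
    also have "norm \<dots> \<le> (\<Sum>i\<in>UNIV. norm x * norm (?B k (axis i 1)))"
      by (rule sum_norm_le) (auto simp del: transpose_matrix_vector intro!: mult_right_mono
          component_le_norm_cart)
    also have "\<dots> \<le> norm x * (1 / 2)" unfolding sum_distrib_left[symmetric] using k by (intro
        mult_left_mono) simp_all
    finally show ?thesis by simp
  qed
  \<comment> \<open>The accumulated cost of the first k iterations. It depends on A only, not on g
    or c, which is what later makes the bound uniform along a sequence of feasible points.\<close>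
  define C0 where "C0 = (\<Sum>j<k. onorm (?B j))"
  have bl: "bounded_linear (?B j)" for j using lin linear_conv_bounded_linear by blast
  have C0: "0 \<le> C0" unfolding C0_def by (intro sum_nonneg onorm_pos_le bl)
  show thesis
  proof (rule that)
    show "0 \<le> 2 * C0" using C0 by simp
    fix g :: "real^'n \<Rightarrow> real" and c a
    assume cont: "continuous_on UNIV g" and hom: "\<And>t a. g (t *\<^sub>R a) = \<bar>t\<bar> * g a" and c: "0 \<le> c"
      and rec: "\<And>a. g a \<le> g (transpose A *v a) + c * norm a"
    have it: "g a \<le> g (?B j a) + c * (\<Sum>i<j. onorm (?B i)) * norm a" for j a
    proof (induction j)
      case (Suc j)
      have "g (?B j a) \<le> g (?B (Suc j) a) + c * norm (?B j a)" using rec[of "?B j a"] by simp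
      moreover have "c * norm (?B j a) \<le> c * (onorm (?B j) * norm a)" by (intro mult_left_mono onorm bl c)
      ultimately show ?case using Suc by (simp add: algebra_simps del: transpose_matrix_vector)
    qed simp
    have "compact (sphere (0::real^'n) 1)" by simp
    moreover have "(axis undefined 1 :: real^'n) \<in> sphere 0 1" by simp
    ultimately obtain s where s: "s \<in> sphere 0 1" "\<And>x. x \<in> sphere 0 1 \<Longrightarrow> g x \<le> g s"
      using continuous_attains_sup[of "sphere (0::real^'n) 1" g] continuous_on_subset[OF cont] by blast
    have gs: "g x \<le> g s * norm x" for x
    proof (cases "x = 0")
      case True then show ?thesis using hom[of 0 0] by simp
    next
      case False
      have "g x = norm x * g (x /\<^sub>R norm x)" using hom[of "norm x" "x /\<^sub>R norm x"] False by simp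
      moreover have "g (x /\<^sub>R norm x) \<le> g s" using False by (intro s) simp
      ultimately show ?thesis using mult_left_mono[of "g (x /\<^sub>R norm x)" "g s" "norm x"] by (simp
          add: mult.commute)
    qed
    show "g a \<le> 2 * C0 * c * norm a"
    proof (cases "g s \<le> 0")
      case True
      then have "g s * norm a \<le> 0" by (simp add: mult_nonpos_nonneg)
      moreover have "0 \<le> 2 * C0 * c * norm a" using C0 c by (intro mult_nonneg_nonneg) simp_all
      ultimately show ?thesis using gs[of a] by linarith
    next
      case False
      \<comment> \<open>Half of \<open>g s\<close> is absorbed on the left, which is the origin of
        the factor 2 in the final constant.\<close>
      have "g s \<le> g s * norm (?B k s) + c * C0"
        using it[of s k] gs[of "?B k s"] s(1) by (simp add: C0_def del: transpose_matrix_vector)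
      also have "\<dots> \<le> g s * (1 / 2) + c * C0"
        using half[of s] s(1) False by (intro add_right_mono mult_left_mono) (simp_all del:
            transpose_matrix_vector)
      finally have "g s \<le> 2 * C0 * c" by (simp add: field_simps)
      then show ?thesis using gs[of a] mult_right_mono[of "g s" "2 * C0 * c" "norm a"] by simp
    qed
  qed
qed

lemma tendsto_inner_matrix:
  fixes A :: "'a \<Rightarrow> real^'n^'m"
  assumes "(A \<longlongrightarrow> B) F"
  shows "((\<lambda>x. a \<bullet> (A x *v b)) \<longlongrightarrow> a \<bullet> (B *v b)) F"
  using assms unfolding inner_vec_def matrix_vector_mult_def
  by (auto intro!: tendsto_intros)

lemma tendsto_joint_form:
  assumes "(P \<longlongrightarrow> P0) F" "(S \<longlongrightarrow> S0) F" "(\<Gamma> \<longlongrightarrow> \<Gamma>0) F"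
  shows "((\<lambda>x. joint_form (P x) (S x) (\<Gamma> x) \<alpha> \<beta>) \<longlongrightarrow> joint_form P0 S0 \<Gamma>0 \<alpha> \<beta>) F"
  unfolding joint_form_def by (intro tendsto_intros tendsto_inner_matrix assms)

lemma symmetric_limit:
  fixes A :: "nat \<Rightarrow> real^'n^'n"
  assumes "A \<longlonglongrightarrow> B" "\<And>n. transpose (A n) = A n" shows "transpose B = B"
proof -
  have 1: "(\<lambda>n. A n $ i $ j) \<longlonglongrightarrow> B $ i $ j" for i j by (intro tendsto_vec_nth assms)
  have "A n $ j $ i = A n $ i $ j" for n i j
    using arg_cong[OF assms(2)[of n], of "\<lambda>X. X $ i $ j"] by (simp add: transpose_def)
  then have "B $ i $ j = B $ j $ i" for i j using LIMSEQ_unique[OF 1[of i j]] 1[of j i] by simp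
  then show ?thesis by (simp add: transpose_def vec_eq_iff)
qed

text \<open>The choice \<open>b = -Kp\<^sup>Ta\<close> removes the noise term from the matrix inequality and leaves the recursion
  of the closed-loop matrix \<open>F - Kp H\<close>, which bounds \<open>S n\<close>.\<close>

lemma feasible_limit:
  fixes P :: "nat \<Rightarrow> real^'m^'m" and S :: "nat \<Rightarrow> real^'d^'d" and \<Gamma> :: "nat \<Rightarrow> real^'d^'m"
    and \<Lambda> :: "real^'m^'p" and F :: "real^'d^'d" and H :: "real^'d^'p" and Kp :: "real^'p^'d" and \<Psi>
        :: "real^'p^'p"
    and N :: "nat \<Rightarrow> real^'d \<Rightarrow> real^'p \<Rightarrow> real"
  assumes \<Psi>: "pos_def \<Psi>" and stab: "spectral_radius (F - Kp ** H) < 1"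
    and sym: "\<And>n. transpose (P n) = P n" "\<And>n. transpose (S n) = S n"
    and nn: "\<And>n \<alpha> \<beta>. 0 \<le> joint_form (P n) (S n) (\<Gamma> n) \<alpha> \<beta>" and tr: "\<And>n. trace (P n) \<le> c"
    and lmi: "\<And>n a b. a \<bullet> (S n *v a) \<le> joint_form (P n) (S n) (\<Gamma> n) (transpose F *v a + transpose H
        *v b) (transpose \<Lambda> *v b) + N n a b"
    and N: "\<And>a b. (\<lambda>n. N n a b) \<longlonglongrightarrow> (transpose Kp *v a + b) \<bullet> (\<Psi> *v (transpose Kp *v a + b))"
    and Nb: "\<And>n a. N n a (- (transpose Kp *v a)) \<le> \<kappa>\<^sup>2 * (norm a)\<^sup>2" and \<kappa>: "0 \<le> \<kappa>"
  obtains r PX S' G' where "strict_mono r" "(PX, S', G') \<in> feasible_set \<Lambda> F H Kp \<Psi> c"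
    "(\<lambda>n. P (r n)) \<longlonglongrightarrow> PX" "(\<lambda>n. S (r n)) \<longlonglongrightarrow> S'" "(\<lambda>n. \<Gamma> (r n)) \<longlonglongrightarrow> G'"
proof -
  note [simp del] = transpose_matrix_vector
  note jf = joint_form_facts[OF nn]
  have ent: "(A :: real^'k^'l) $ i $ j = axis i 1 \<bullet> (A *v axis j 1)" for A i j
    by (simp add: inner_axis' matrix_vector_mul_component inner_axis)
  have diag: "0 \<le> P n $ i $ i" for n i unfolding ent by (rule jf)
  have "P n $ i $ i \<le> trace (P n)" for n i
    unfolding trace_def by (rule member_le_sum) (auto simp: diag)
  then have Pd: "P n $ i $ i \<le> c" for n i using tr[of n] by (meson order_trans)
  have c0: "0 \<le> c" using diag[of 0 undefined] Pd[of 0 undefined] by linarith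
  \<comment> \<open>The trace bounds the diagonal entries, and these bound all others.\<close>
  have Pe: "\<bar>P n $ i $ j\<bar> \<le> c" for n i j
  proof -
    have "\<bar>P n $ i $ j\<bar> \<le> sqrt (P n $ i $ i) * sqrt (P n $ j $ j)"
      unfolding ent by (rule psd_entry_le[OF sym(1)]) (rule jf)
    also have "\<dots> \<le> sqrt c * sqrt c" by (intro mult_mono real_sqrt_le_mono Pd) (auto simp: c0 diag)
    finally show ?thesis using c0 by simp
  qed
  define p where "p = CARD('m) * (CARD('m) * c)"
  have p0: "0 \<le> p" using c0 by (simp add: p_def)
  have Pn: "\<beta> \<bullet> (P n *v \<beta>) \<le> p * (norm \<beta>)\<^sup>2" for n \<beta>
    unfolding p_def by (rule inner_matrix_le_entries[OF Pe])
  obtain C where C: "0 \<le> C" "\<And>g c a. continuous_on UNIV g \<Longrightarrow> (\<And>t a. g (t *\<^sub>R a) = \<bar>t\<bar> * g a) \<Longrightarrow> 0 \<le> c \<Longrightarrow>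
     (\<And>a. g a \<le> g (transpose (F - Kp ** H) *v a) + c * norm a) \<Longrightarrow> g a \<le> C * c * norm a"
    using stable_bound[OF stab] by blast
  define B where "B = onorm ((*v) (transpose \<Lambda> ** transpose Kp))"
  have Bp: "0 \<le> B" unfolding B_def by (intro onorm_pos_le matrix_vector_mul_bounded_linear)
  \<comment> \<open>The additive constant in the recursion for
    \<open>sqrt (a \<bullet> (S n *v a))\<close>: the first summand bounds the contribution of the
    input, seen through \<open>transpose \<Lambda> ** transpose Kp\<close>, the second that of the
    noise term.\<close>
  define q where "q = sqrt p * B + \<kappa>"
  have q0: "0 \<le> q" using p0 Bp \<kappa> by (simp add: q_def)
  have Sb: "sqrt (a \<bullet> (S n *v a)) \<le> C * q * norm a" for n a
  proof (rule C(2)[OF _ _ q0])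
    show "continuous_on UNIV (\<lambda>a. sqrt (a \<bullet> (S n *v a)))"
      by (intro continuous_intros matrix_vector_mult_linear_continuous_on)
    show "sqrt ((t *\<^sub>R a) \<bullet> (S n *v (t *\<^sub>R a))) = \<bar>t\<bar> * sqrt (a \<bullet> (S n *v a))" for t a
      by (simp add: matrix_vector_mult_scaleR real_sqrt_mult[symmetric] mult.assoc[symmetric]) (simp
          add: real_sqrt_mult)
    fix a
    let ?b = "- (transpose Kp *v a)" and ?g = "\<lambda>a. sqrt (a \<bullet> (S n *v a))"
    let ?A = "transpose (F - Kp ** H)"
    have e1: "transpose F *v a + transpose H *v ?b = ?A *v a"
      by (simp add: transpose_minus matrix_transpose_mul matrix_vector_mult_diff_rdistrib
          matrix_vector_mul_assoc[symmetric] linear_neg[OF matrix_vector_mul_linear])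
    have e2: "transpose \<Lambda> *v ?b = - ((transpose \<Lambda> ** transpose Kp) *v a)"
      by (simp add: matrix_vector_mul_assoc[symmetric] linear_neg[OF matrix_vector_mul_linear])
    have "sqrt ((transpose \<Lambda> *v ?b) \<bullet> (P n *v (transpose \<Lambda> *v ?b))) \<le> sqrt (p * (norm (transpose \<Lambda> *v ?b))\<^sup>2)"
      by (intro real_sqrt_le_mono Pn)
    also have "\<dots> = sqrt p * norm ((transpose \<Lambda> ** transpose Kp) *v a)" unfolding e2 by (simp add:
        real_sqrt_mult)
    also have "\<dots> \<le> sqrt p * (B * norm a)"
      unfolding B_def by (intro mult_left_mono onorm matrix_vector_mul_bounded_linear) (simp add: p0)
    finally have b1: "sqrt ((transpose \<Lambda> *v ?b) \<bullet> (P n *v (transpose \<Lambda> *v ?b))) \<le> sqrt p * B * norm a" by simp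
    have "a \<bullet> (S n *v a) \<le> (?g (?A *v a) + sqrt ((transpose \<Lambda> *v ?b) \<bullet> (P n *v (transpose \<Lambda> *v
        ?b))))\<^sup>2 + \<kappa>\<^sup>2 * (norm a)\<^sup>2"
      using lmi[of a n ?b] jf(4)[of n "?A *v a" "transpose \<Lambda> *v ?b"] Nb[of n a] unfolding e1 by linarith
    also have "\<dots> \<le> (?g (?A *v a) + sqrt p * B * norm a)\<^sup>2 + (\<kappa> * norm a)\<^sup>2"
      using b1 jf(1,2) by (intro add_mono power_mono add_left_mono) (auto simp: power_mult_distrib)
    also have "\<dots> \<le> (?g (?A *v a) + sqrt p * B * norm a + \<kappa> * norm a)\<^sup>2"
      using jf(1)[of "?A *v a" n] p0 Bp \<kappa> by (simp add: power2_sum)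
    finally have "?g a \<le> ?g (?A *v a) + sqrt p * B * norm a + \<kappa> * norm a"
      using jf(1)[of "?A *v a" n] p0 Bp \<kappa> by (intro real_le_lsqrt) (simp_all add: jf)
    then show "?g a \<le> ?g (?A *v a) + q * norm a" by (simp add: q_def algebra_simps)
  qed
  define u where "u = C * q"
  have u0: "0 \<le> u" using C(1) q0 by (simp add: u_def)
  have Sd: "sqrt (S n $ i $ i) \<le> u" for n i
    using Sb[of "axis i 1" n] unfolding ent u_def by simp
  have Se: "\<bar>S n $ i $ j\<bar> \<le> u * u" for n i j
  proof -
    have "\<bar>S n $ i $ j\<bar> \<le> sqrt (S n $ i $ i) * sqrt (S n $ j $ j)"
      unfolding ent by (rule psd_entry_le[OF sym(2)]) (rule jf)
    also have "\<dots> \<le> u * u" by (intro mult_mono Sd u0) (simp add: ent jf)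
    finally show ?thesis .
  qed
  have Ge: "\<bar>\<Gamma> n $ i $ j\<bar> \<le> sqrt c * u" for n i j
  proof -
    have "\<bar>\<Gamma> n $ i $ j\<bar> \<le> sqrt (P n $ i $ i) * sqrt (S n $ j $ j)"
      unfolding ent by (rule jf)
    also have "\<dots> \<le> sqrt c * u" by (intro mult_mono real_sqrt_le_mono Sd Pd) (simp_all add: c0 ent jf)
    finally show ?thesis .
  qed
  have "bounded (range P)" "bounded (range S)" "bounded (range \<Gamma>)"
    using matrix_norm_le[OF Pe] matrix_norm_le[OF Se] matrix_norm_le[OF Ge] by (auto intro!: boundedI)
  then have "bounded (range P \<times> (range S \<times> range \<Gamma>))" by (intro bounded_Times)
  then have "bounded (range (\<lambda>n. (P n, S n, \<Gamma> n)))" by (rule bounded_subset) auto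
  then obtain l r where r: "strict_mono r" "((\<lambda>n. (P n, S n, \<Gamma> n)) \<circ> r) \<longlonglongrightarrow> l"
    using bounded_imp_convergent_subsequence by blast
  obtain PX S' G' where l: "l = (PX, S', G')" by (cases l)
  have lim: "(\<lambda>n. P (r n)) \<longlonglongrightarrow> PX" "(\<lambda>n. S (r n)) \<longlonglongrightarrow> S'" "(\<lambda>n. \<Gamma> (r n)) \<longlonglongrightarrow> G'"
    using tendsto_fst[OF r(2)] tendsto_fst[OF tendsto_snd[OF r(2)]] tendsto_snd[OF tendsto_snd[OF r(2)]]
    by (simp_all add: l o_def)
  have "(PX, S', G') \<in> feasible_set \<Lambda> F H Kp \<Psi> c"
    unfolding feasible_set_iff[OF \<Psi>]
  proof (intro conjI allI)
    show "transpose PX = PX" "transpose S' = S'" using symmetric_limit lim sym by blast+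
    show "0 \<le> joint_form PX S' G' \<alpha> \<beta>" for \<alpha> \<beta>
      by (rule LIMSEQ_le_const[OF tendsto_joint_form[OF lim]]) (auto simp: nn)
    have "(\<lambda>n. trace (P (r n))) \<longlonglongrightarrow> trace PX"
      unfolding trace_def by (intro tendsto_intros lim)
    then show "trace PX \<le> c" by (rule LIMSEQ_le_const2) (auto simp: tr)
    fix a b
    have "(\<lambda>n. joint_form (P (r n)) (S (r n)) (\<Gamma> (r n)) (transpose F *v a + transpose H *v b)
        (transpose \<Lambda> *v b) + N (r n) a b) \<longlonglongrightarrow>
      joint_form PX S' G' (transpose F *v a + transpose H *v b) (transpose \<Lambda> *v b) + (transpose Kp
          *v a + b) \<bullet> (\<Psi> *v (transpose Kp *v a + b))"
      by (intro tendsto_add tendsto_joint_form lim LIMSEQ_subseq_LIMSEQ[OF N r(1), unfolded o_def])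
    from LIMSEQ_le[OF tendsto_inner_matrix[OF lim(2)] this]
    show "a \<bullet> (S' *v a) \<le> joint_form PX S' G' (transpose F *v a + transpose H *v b) (transpose \<Lambda> *v
        b) + (transpose Kp *v a + b) \<bullet> (\<Psi> *v (transpose Kp *v a + b))"
      using lmi by blast
  qed
  with r(1) show thesis using lim by (rule that)
qed

section \<open>The converse for a fixed block length\<close>

text \<open>The one-step prediction of the noise state from the innovations e. It starts at 0, the
  mean of the initial state.\<close>

primrec state_pred :: "real^'d^'d \<Rightarrow> (nat \<Rightarrow> real^'p^'d) \<Rightarrow> (nat \<Rightarrow> real^'p) \<Rightarrow> nat \<Rightarrow> real^'d" where
  "state_pred F K e 0 = 0"
| "state_pred F K e (Suc i) = F *v state_pred F K e i + K i *v e i"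

text \<open>The inverse of whitening. It is used with two sets of gains: the Riccati gains turn the
  true innovations into the noise, the gains of the receiver turn its residuals into the channel
  output.\<close>

definition noise_of :: "real^'d^'d \<Rightarrow> real^'d^'p \<Rightarrow> (nat \<Rightarrow> real^'p^'d) \<Rightarrow> (nat \<Rightarrow> real^'p) \<Rightarrow> nat \<Rightarrow> real^'p" where
  "noise_of F H K e i = H *v state_pred F K e i + e i"

lemma state_pred_cong: "(\<And>j. j < i \<Longrightarrow> e j = e' j) \<Longrightarrow> state_pred F K e i = state_pred F K e' i"
  by (induction i) simp_all

lemma noise_of_cong: "(\<And>j. j \<le> i \<Longrightarrow> e j = e' j) \<Longrightarrow> noise_of F H K e i = noise_of F H K e' i"
  unfolding noise_of_def by (metis state_pred_cong less_imp_le order_refl)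

text \<open>State equals prediction plus prediction error at every time, whatever the gains.\<close>

lemma noise_of_innovation:
  fixes F :: "real^'d^'d" and H :: "real^'d^'p"
  assumes "\<And>i. s (Suc i) = F *v s i + G *v w i"
  shows "H *v s i + v i = noise_of F H K (innovation F G H K (s 0) w v) i"
proof -
  have "s i = pred_error F G H K (s 0) w v i + state_pred F K (innovation F G H K (s 0) w v) i" for i
  proof (induction i)
    case (Suc i)
    have "s (Suc i) = F *v (pred_error F G H K (s 0) w v i + state_pred F K (innovation F G H K (s
        0) w v) i) + G *v w i"
      unfolding assms[of i] by (subst Suc) (rule refl)
    then show ?case
      by (simp only: pred_error.simps state_pred.simps innovation_def[symmetric]
          matrix_vector_right_distrib) simp
  qed simp
  then have "H *v s i = H *v (pred_error F G H K (s 0) w v i + state_pred F K (innovation F G H K (s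
      0) w v) i)"
    by (rule arg_cong)
  then show ?thesis
    by (simp only: noise_of_def matrix_vector_right_distrib) (simp add: innovation_def)
qed

lemma outputs_cong: "(\<And>j. j < i \<Longrightarrow> z j = z' j) \<Longrightarrow> outputs \<Lambda> f z i = outputs \<Lambda> f z' i"
  by (induction i) simp_all

lemma channel_input_cong: "(\<And>j. j < i \<Longrightarrow> z j = z' j) \<Longrightarrow> channel_input \<Lambda> f z i = channel_input \<Lambda> f z' i"
  unfolding channel_input_def by (metis outputs_cong)

lemma outputs_eq: "outputs \<Lambda> f z n = (\<lambda>i\<in>{..<n}. \<Lambda> *v channel_input \<Lambda> f z i + z i)"
  by (induction n) (auto simp: fun_eq_iff channel_input_def restrict_def)

lemma track_error_cong:
  "(\<And>j. j < i \<Longrightarrow> x j = x' j) \<Longrightarrow> (\<And>j. j < i \<Longrightarrow> e j = e' j) \<Longrightarrow> track_error F H \<Lambda> K KY x e i = track_error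
      F H \<Lambda> K KY x' e' i"
  by (induction i) simp_all

text \<open>The prediction from the true innovations is the tracking error plus the prediction from
  the residuals. Hence the output is a function of the residuals in which neither the message nor
  the input occurs, and this holds for every choice of \<open>KY\<close>.\<close>

lemma channel_output_noise_of:
  fixes F :: "real^'d^'d" and H :: "real^'d^'p" and \<Lambda> :: "real^'m^'p"
  defines "\<epsilon> \<equiv> \<lambda>x K KY e i. \<Lambda> *v x i + H *v track_error F H \<Lambda> K KY x e i + e i"
  shows "\<Lambda> *v x i + noise_of F H K e i = noise_of F H KY (\<epsilon> x K KY e) i"
proof -
  have "state_pred F K e i = track_error F H \<Lambda> K KY x e i + state_pred F KY (\<epsilon> x K KY e) i" for i
    by (induction i) (simp_all add: \<epsilon>_def matrix_vector_right_distrib)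
  then show ?thesis by (simp add: noise_of_def \<epsilon>_def matrix_vector_right_distrib)
qed

lemma state_pred_measurable:
  assumes "\<And>j. j < i \<Longrightarrow> (\<lambda>x. e x j) \<in> borel_measurable R"
  shows "(\<lambda>x. state_pred F K (e x) i) \<in> borel_measurable R"
  using assms by (induction i) simp_all

lemma noise_of_measurable:
  assumes "\<And>j. j \<le> i \<Longrightarrow> (\<lambda>x. e x j) \<in> borel_measurable R"
  shows "(\<lambda>x. noise_of F H K (e x) i) \<in> borel_measurable R"
  unfolding noise_of_def
  by (intro borel_measurable_add borel_measurable_matrix_vector state_pred_measurable assms) simp_all

lemma outputs_measurable:
  assumes f: "\<And>j. j < i \<Longrightarrow> f j \<in> measurable (Pi\<^sub>M {..<j} (\<lambda>_. borel)) borel"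
    and z: "\<And>j. j < i \<Longrightarrow> (\<lambda>x. z x j) \<in> borel_measurable R"
  shows "(\<lambda>x. outputs \<Lambda> f (z x) i) \<in> measurable R (Pi\<^sub>M {..<i} (\<lambda>_. borel))"
  using assms
proof (induction i)
  case (Suc i)
  then have o: "(\<lambda>x. outputs \<Lambda> f (z x) i) \<in> measurable R (Pi\<^sub>M {..<i} (\<lambda>_. borel))" by simp
  have "(\<lambda>x. \<Lambda> *v f i (outputs \<Lambda> f (z x) i) + z x i) \<in> borel_measurable R"
    by (intro borel_measurable_add borel_measurable_matrix_vector measurable_compose[OF o] Suc.prems) simp_all
  with o show ?case
    unfolding outputs.simps by (intro measurable_fun_upd[where J="{..<i}"]) auto
qed (auto simp: space_PiM intro!: measurable_const)

lemma channel_input_measurable: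
  assumes "\<And>j. j \<le> i \<Longrightarrow> f j \<in> measurable (Pi\<^sub>M {..<j} (\<lambda>_. borel)) borel"
    and "\<And>j. j < i \<Longrightarrow> (\<lambda>x. z x j) \<in> borel_measurable R"
  shows "(\<lambda>x. channel_input \<Lambda> f (z x) i) \<in> borel_measurable R"
  unfolding channel_input_def
  by (rule measurable_compose[OF outputs_measurable]) (simp_all add: assms)

lemma track_error_measurable:
  assumes "\<And>j. j < i \<Longrightarrow> (\<lambda>x. X x j) \<in> borel_measurable R" "\<And>j. j < i \<Longrightarrow> (\<lambda>x. e x j) \<in> borel_measurable R"
  shows "(\<lambda>x. track_error F H \<Lambda> K KY (X x) (e x) i) \<in> borel_measurable R"
  using assms by (induction i) simp_all

section \<open>Averaging over the message\<close>

lemma message_noise_space_measurable: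
  assumes "\<And>m. m \<in> {1..N} \<Longrightarrow> (\<lambda>\<omega>. h (m, \<omega>)) \<in> measurable M R"
  shows "h \<in> measurable (message_noise_space N M) R"
proof -
  have h: "h \<in> measurable (count_space {1..N} \<Otimes>\<^sub>M M) R"
    by (rule measurable_pair_measure_countable1) (use assms in auto)
  have eq: "sets (message_noise_space N M) = sets (count_space {1..N} \<Otimes>\<^sub>M M)"
    unfolding message_noise_space_def by (intro sets_pair_measure_cong) (simp_all add:
        sets_uniform_count_measure)
  show ?thesis using h unfolding measurable_cong_sets[OF eq refl] .
qed

lemma prob_space_message_noise:
  assumes "prob_space M" "1 \<le> N"
  shows "prob_space (message_noise_space N M)"
proof -
  interpret M: prob_space M by fact
  interpret U: prob_space "uniform_count_measure {1..N}"
    by (rule prob_space_uniform_count_measure) (use assms(2) in auto)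
  interpret pair_prob_space "uniform_count_measure {1..N}" M ..
  show ?thesis unfolding message_noise_space_def by (rule P.prob_space_axioms)
qed

lemma nn_integral_message_noise:
  assumes "prob_space M" "1 \<le> N" and h: "\<And>m. m \<in> {1..N} \<Longrightarrow> (\<lambda>\<omega>. h (m, \<omega>)) \<in> borel_measurable M"
  shows "(\<integral>\<^sup>+x. h x \<partial>message_noise_space N M) = (\<Sum>m\<in>{1..N}. ennreal (1 / N) * (\<integral>\<^sup>+\<omega>. h (m, \<omega>) \<partial>M))"
proof -
  interpret M: prob_space M by fact
  have "(\<integral>\<^sup>+x. h x \<partial>message_noise_space N M) = (\<integral>\<^sup>+m. \<integral>\<^sup>+\<omega>. h (m, \<omega>) \<partial>M \<partial>uniform_count_measure {1..N})"
    using message_noise_space_measurable[of N h M borel, OF h] unfolding message_noise_space_def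
    by (rule M.nn_integral_fst[symmetric])
  also have "\<dots> = (\<Sum>m\<in>{1..N}. ennreal (1 / N) * (\<integral>\<^sup>+\<omega>. h (m, \<omega>) \<partial>M))"
    unfolding uniform_count_measure_def by (subst nn_integral_point_measure_finite) simp_all
  finally show ?thesis .
qed

text \<open>Integrate over the noise first, for each message. A non-integrable h has integral 0 by
  convention, which settles the other case.\<close>

lemma integral_message_noise_0:
  fixes h :: "nat \<times> 'a \<Rightarrow> real"
  assumes "prob_space M" "1 \<le> N" and z: "\<And>m. m \<in> {1..N} \<Longrightarrow> (\<integral>\<omega>. h (m, \<omega>) \<partial>M) = 0"
  shows "(\<integral>x. h x \<partial>message_noise_space N M) = 0"
proof (cases "integrable (message_noise_space N M) h")
  case True
  interpret M: prob_space M by fact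
  interpret U: prob_space "uniform_count_measure {1..N}"
    by (rule prob_space_uniform_count_measure) (use assms(2) in auto)
  interpret pair_prob_space "uniform_count_measure {1..N}" M ..
  have "(\<integral>x. h x \<partial>message_noise_space N M) = (\<integral>m. \<integral>\<omega>. h (m, \<omega>) \<partial>M \<partial>uniform_count_measure {1..N})"
    using True unfolding message_noise_space_def by (rule integral_fst'[symmetric])
  also have "\<dots> = (\<integral>m. 0 \<partial>uniform_count_measure {1..N})"
    by (intro Bochner_Integration.integral_cong refl z) (simp add: space_uniform_count_measure)
  finally show ?thesis by simp
qed (simp add: not_integrable_integral_eq)

text \<open>Jensen's inequality by induction: the average of n + 1 matrices combines the average of
  the first n with weight n/(n+1) and the last with weight 1/(n+1).\<close>

lemma ln_det_sum_le:
  fixes A :: "nat \<Rightarrow> real^'n^'n"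
  assumes "0 < n" "\<And>i. i < n \<Longrightarrow> pos_def (A i)"
  shows "pos_def ((1 / real n) *\<^sub>R (\<Sum>i<n. A i)) \<and> (\<Sum>i<n. ln (det (A i))) \<le> n * ln (det ((1 / real n)
      *\<^sub>R (\<Sum>i<n. A i)))"
  using assms
proof (induction n)
  case (Suc n)
  show ?case
  proof (cases "n = 0")
    case True with Suc show ?thesis by simp
  next
    case False
    define B' where "B' = (1 / real n) *\<^sub>R (\<Sum>i<n. A i)"
    let ?t = "real n / real (Suc n)" and ?u = "1 / real (Suc n)"
    have B: "pos_def B'" "(\<Sum>i<n. ln (det (A i))) \<le> n * ln (det B')" and An: "pos_def (A n)"
      using Suc False unfolding B'_def by auto
    have tu: "0 \<le> ?t" "0 \<le> ?u" "?t + ?u = 1" by (auto simp: field_simps)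
    have e: "(1 / real (Suc n)) *\<^sub>R (\<Sum>i<Suc n. A i) = ?t *\<^sub>R B' + ?u *\<^sub>R A n"
      using False by (simp add: scaleR_add_right B'_def)
    have "pos_def (?t *\<^sub>R B' + ?u *\<^sub>R A n)"
      unfolding pos_def_def
    proof (intro conjI allI impI)
      show "transpose (?t *\<^sub>R B' + ?u *\<^sub>R A n) = ?t *\<^sub>R B' + ?u *\<^sub>R A n"
      proof -
        have "transpose B' = B'" "transpose (A n) = A n" using B(1) An unfolding pos_def_def by blast+
        then show ?thesis unfolding transpose_plus transpose_scalar by simp
      qed
      fix x :: "real^'n" assume "x \<noteq> 0"
      then have "0 < x \<bullet> (B' *v x)" "0 < x \<bullet> (A n *v x)" using B(1) An unfolding pos_def_def by blast+
      then have "0 < ?t * (x \<bullet> (B' *v x)) + ?u * (x \<bullet> (A n *v x))"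
        by (intro add_nonneg_pos mult_nonneg_nonneg mult_pos_pos) auto
      then show "0 < x \<bullet> ((?t *\<^sub>R B' + ?u *\<^sub>R A n) *v x)"
        unfolding matrix_vector_mult_add_rdistrib scaleR_matrix_vector_assoc[symmetric]
            inner_add_right inner_scaleR_right .
    qed
    moreover have "?t * ln (det B') + ?u * ln (det (A n)) \<le> ln (det (?t *\<^sub>R B' + ?u *\<^sub>R A n))"
      by (rule ln_det_concave[OF B(1) An tu])
    then have "real (Suc n) * (?t * ln (det B') + ?u * ln (det (A n))) \<le> real (Suc n) * ln (det (?t
        *\<^sub>R B' + ?u *\<^sub>R A n))"
      by (rule mult_left_mono) simp
    then have "real n * ln (det B') + ln (det (A n)) \<le> real (Suc n) * ln (det (?t *\<^sub>R B' + ?u *\<^sub>R A n))"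
      by (simp add: distrib_left del: of_nat_Suc)
    ultimately show ?thesis unfolding e using B(2) by simp
  qed
qed simp

text \<open>Takes the place of Fano's inequality: \<open>Z\<close> is the likelihood ratio of the output law without message
  to the true one, and \<open>C\<close> the event of correct decoding. Only \<open>ln x \<le> x - 1\<close> is used.\<close>

lemma mult_ln_card_le:
  fixes Z :: "'a \<Rightarrow> real"
  assumes M: "prob_space M" and [measurable]: "Z \<in> borel_measurable M" "C \<in> sets M" and pos: "\<And>x. 0 < Z x"
    and Z1: "(\<integral>\<^sup>+x. ennreal (Z x) \<partial>M) \<le> 1"
    and ZC: "(\<integral>\<^sup>+x. ennreal (Z x) * indicator C x \<partial>M) \<le> ennreal (1 / N)" and N: "1 \<le> N"
    and int: "integrable M (\<lambda>x. ln (Z x))"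
  shows "measure M C * ln N \<le> - (\<integral>x. ln (Z x) \<partial>M) + 1"
proof -
  interpret prob_space M by fact
  have iZ: "integrable M Z"
  proof (rule integrableI_bounded)
    have "(\<integral>\<^sup>+x. ennreal (norm (Z x)) \<partial>M) = (\<integral>\<^sup>+x. ennreal (Z x) \<partial>M)"
      using pos by (simp add: less_imp_le)
    also have "\<dots> < \<infinity>" using Z1 by (rule le_less_trans) simp
    finally show "(\<integral>\<^sup>+x. ennreal (norm (Z x)) \<partial>M) < \<infinity>" .
  qed simp
  have iZC: "integrable M (\<lambda>x. Z x * indicator C x)"
    by (rule integrable_real_mult_indicator) (simp_all add: iZ)
  have "ennreal (\<integral>x. Z x \<partial>M) \<le> 1"
    using Z1 nn_integral_eq_integral[OF iZ] pos by (simp add: less_imp_le)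
  then have E1: "(\<integral>x. Z x \<partial>M) \<le> 1" by simp
  have "(\<integral>\<^sup>+x. ennreal (Z x * indicator C x) \<partial>M) = (\<integral>\<^sup>+x. ennreal (Z x) * indicator C x \<partial>M)"
    by (intro nn_integral_cong) (auto simp: indicator_def)
  then have "ennreal (\<integral>x. Z x * indicator C x \<partial>M) \<le> ennreal (1 / N)"
    using ZC nn_integral_eq_integral[OF iZC] pos by (simp add: less_imp_le)
  then have EC: "(\<integral>x. Z x * indicator C x \<partial>M) \<le> 1 / N"
    using N by (simp add: ennreal_le_iff)
  \<comment> \<open>The inequality for the logarithm is taken at N Z on the event C and at Z outside
    it; the jump by ln N is what produces the factor on the left.\<close>
  have pt: "ln (Z x) + indicator C x * ln N \<le> Z x + N * (Z x * indicator C x) - 1" for x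
  proof (cases "x \<in> C")
    case True
    have "ln (Z x * N) \<le> Z x * N - 1" using pos[of x] N by (intro ln_le_minus_one mult_pos_pos) auto
    moreover have "ln (Z x * N) = ln (Z x) + ln N" using pos[of x] N by (intro ln_mult_pos) auto
    ultimately show ?thesis using True pos[of x] by (simp add: mult.commute)
  next
    case False
    then show ?thesis using ln_le_minus_one[OF pos[of x]] by simp
  qed
  have iC: "integrable M (\<lambda>x. indicator C x * ln N)"
    by (intro integrable_mult_left integrable_real_indicator) (simp_all add: emeasure_eq_measure)
  have "(\<integral>x. ln (Z x) + indicator C x * ln N \<partial>M) \<le> (\<integral>x. Z x + N * (Z x * indicator C x) - 1 \<partial>M)"
    using int iZ iZC iC by (intro integral_mono pt) auto
  also have "\<dots> = (\<integral>x. Z x \<partial>M) + N * (\<integral>x. Z x * indicator C x \<partial>M) - 1"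
    using iZ iZC by (simp add: prob_space)
  also have "\<dots> \<le> 1 + N * (1 / N) - 1"
    using E1 EC N by (intro diff_right_mono add_mono mult_left_mono) auto
  finally have "(\<integral>x. ln (Z x) \<partial>M) + (\<integral>x. indicator C x * ln N \<partial>M) \<le> 1"
    using int iC N by simp
  then show ?thesis by (simp add: mult.commute)
qed

text \<open>All that the converse uses of the noise law: its innovations are independent centred
  normal vectors with positive definite covariances.\<close>

locale innovations = prob_space M for M :: "'a measure" +
  fixes e :: "nat \<Rightarrow> 'a \<Rightarrow> real^'p" and \<Psi> :: "nat \<Rightarrow> real^'p^'p"
  assumes e_measurable [measurable]: "\<And>i. e i \<in> borel_measurable M"
    and pos_def_innovation: "\<And>i. pos_def (\<Psi> i)"
    and law: "\<And>n. distr M (Pi\<^sub>M {..<n} (\<lambda>_. borel)) (\<lambda>\<omega>. \<lambda>i\<in>{..<n}. e i \<omega>)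
      = Pi\<^sub>M {..<n} (\<lambda>i. density lborel (\<lambda>x. ennreal (mvn_density (\<Psi> i) x)))"
begin

abbreviation "nu i \<equiv> density lborel (\<lambda>x. ennreal (mvn_density (\<Psi> i) x))"

lemma past_measurable [measurable]: "(\<lambda>\<omega>. \<lambda>j\<in>{..<i}. e j \<omega>) \<in> measurable M (Pi\<^sub>M {..<i} (\<lambda>_. borel))"
  by measurable

lemma distr_innovation: "distr M borel (e i) = nu i"
proof -
  have "nu i = distr (Pi\<^sub>M {..<Suc i} nu) (nu i) (\<lambda>h. h i)"
    by (rule distr_PiM_component[symmetric]) (auto intro: prob_space_mvn pos_def_innovation)
  also have "\<dots> = distr (distr M (Pi\<^sub>M {..<Suc i} (\<lambda>_. borel)) (\<lambda>\<omega>. \<lambda>j\<in>{..<Suc i}. e j \<omega>)) borel (\<lambda>h. h i)"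
    unfolding law by (rule distr_cong) auto
  also have "\<dots> = distr M borel (e i)"
    by (subst distr_distr) (auto simp: o_def intro!: measurable_component_singleton)
  finally show ?thesis by simp
qed

text \<open>Encoders are arbitrary measurable maps, so orthogonality is required against every
  function of the past, not just linear ones. Integrating over the last coordinate first gives mean
  0; in the non-integrable case the integral is 0 by convention.\<close>

lemma innovation_orthogonal_past:
  assumes U [measurable]: "U \<in> borel_measurable (Pi\<^sub>M {..<i} (\<lambda>_. borel))"
  shows "(\<integral>\<omega>. U (\<lambda>j\<in>{..<i}. e j \<omega>) * (b \<bullet> e i \<omega>) \<partial>M) = 0"
proof (cases "integrable M (\<lambda>\<omega>. U (\<lambda>j\<in>{..<i}. e j \<omega>) * (b \<bullet> e i \<omega>))")
  case True
  interpret P: product_prob_space nu "{..<k}" for k :: nat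
    by (intro product_prob_spaceI prob_space_mvn pos_def_innovation)
  let ?f = "\<lambda>h. U (restrict h {..<i}) * (b \<bullet> h i)"
  have ins: "{..<Suc i} = insert i {..<i}" by auto
  have sN: "sets (Pi\<^sub>M I nu) = sets (Pi\<^sub>M I (\<lambda>_. borel))" for I
    by (intro sets_PiM_cong) auto
  have fm: "?f \<in> borel_measurable (Pi\<^sub>M {..<Suc i} (\<lambda>_. borel))"
    by (intro borel_measurable_times measurable_compose[OF _ U] measurable_restrict_subset
        borel_measurable_inner measurable_component_singleton) auto
  have feq: "?f (\<lambda>j\<in>{..<Suc i}. e j \<omega>) = U (\<lambda>j\<in>{..<i}. e j \<omega>) * (b \<bullet> e i \<omega>)" for \<omega>
  proof -
    have "restrict (\<lambda>j\<in>{..<Suc i}. e j \<omega>) {..<i} = (\<lambda>j\<in>{..<i}. e j \<omega>)" by (auto simp: restrict_def fun_eq_iff)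
    then show ?thesis by simp
  qed
  have "integrable (distr M (Pi\<^sub>M {..<Suc i} (\<lambda>_. borel)) (\<lambda>\<omega>. \<lambda>j\<in>{..<Suc i}. e j \<omega>)) ?f"
    using True by (subst integrable_distr_eq[OF past_measurable fm]) (simp only: feq)
  then have "integrable (Pi\<^sub>M {..<Suc i} nu) ?f" unfolding law .
  then have I: "integrable (Pi\<^sub>M (insert i {..<i}) nu) ?f" unfolding ins .
  have "(\<integral>\<omega>. U (\<lambda>j\<in>{..<i}. e j \<omega>) * (b \<bullet> e i \<omega>) \<partial>M) = (\<integral>h. ?f h \<partial>distr M (Pi\<^sub>M {..<Suc i} (\<lambda>_.
      borel)) (\<lambda>\<omega>. \<lambda>j\<in>{..<Suc i}. e j \<omega>))"
    by (subst integral_distr[OF past_measurable fm]) (simp only: feq)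
  also have "\<dots> = (\<integral>h. \<integral>y. ?f (h(i := y)) \<partial>nu i \<partial>Pi\<^sub>M {..<i} nu)"
    unfolding law unfolding ins by (rule P.product_integral_insert[OF _ _ I]) auto
  also have "\<dots> = (\<integral>h. 0 \<partial>Pi\<^sub>M {..<i} nu)"
  proof (rule Bochner_Integration.integral_cong[OF refl])
    fix h :: "nat \<Rightarrow> real^'p"
    have "restrict (h(i := y)) {..<i} = restrict h {..<i}" for y by (auto simp: restrict_def fun_eq_iff)
    then have "(\<integral>y. ?f (h(i := y)) \<partial>nu i) = (\<integral>y. U (restrict h {..<i}) * (b \<bullet> y) \<partial>nu i)" by simp
    also have "\<dots> = U (restrict h {..<i}) * (\<integral>y. b \<bullet> y \<partial>nu i)" by (rule integral_mult_right_zero)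
    also have "\<dots> = 0" unfolding mvn_second_moment(4)[OF pos_def_innovation] by simp
    finally show "(\<integral>y. ?f (h(i := y)) \<partial>nu i) = 0" .
  qed
  finally show ?thesis by simp
qed (simp add: not_integrable_integral_eq)

text \<open>Formulated through a measure-preserving T because the moments are wanted on the product
  with the message space, where T is the projection to the noise.\<close>

lemma innovation_moments:
  fixes B :: "'b measure"
  assumes T: "T \<in> measurable B M" and D: "distr B M T = M"
  shows "square_integrable B (\<lambda>x. e i (T x))" "cross_moment B (\<lambda>x. e i (T x)) (\<lambda>x. e i (T x)) = \<Psi> i"
proof -
  have [measurable]: "(\<lambda>x. e i (T x)) \<in> borel_measurable B" by (rule measurable_compose[OF T e_measurable])
  have DB: "distr B borel (\<lambda>x. e i (T x)) = nu i"
  proof -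
    have "distr B borel (\<lambda>x. e i (T x)) = distr (distr B M T) borel (e i)"
      by (subst distr_distr) (auto simp: o_def T)
    then show ?thesis by (simp add: D distr_innovation)
  qed
  have int: "integrable B (\<lambda>x. (a \<bullet> e i (T x))\<^sup>2)" and q: "(\<integral>x. (a \<bullet> e i (T x))\<^sup>2 \<partial>B) = a \<bullet> (\<Psi> i *v a)" for a
  proof -
    have "integrable (distr B borel (\<lambda>x. e i (T x))) (\<lambda>x. (a \<bullet> x)\<^sup>2)"
      unfolding DB by (rule mvn_second_moment[OF pos_def_innovation])
    then show "integrable B (\<lambda>x. (a \<bullet> e i (T x))\<^sup>2)" by (subst (asm) integrable_distr_eq) simp_all
    have "(\<integral>x. (a \<bullet> x)\<^sup>2 \<partial>distr B borel (\<lambda>x. e i (T x))) = a \<bullet> (\<Psi> i *v a)"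
      unfolding DB by (rule mvn_second_moment[OF pos_def_innovation])
    then show "(\<integral>x. (a \<bullet> e i (T x))\<^sup>2 \<partial>B) = a \<bullet> (\<Psi> i *v a)" by (subst (asm) integral_distr) simp_all
  qed
  show s: "square_integrable B (\<lambda>x. e i (T x))"
    by (rule square_integrableI) (simp_all add: int)
  show "cross_moment B (\<lambda>x. e i (T x)) (\<lambda>x. e i (T x)) = \<Psi> i" (is "?A = _")
  proof (rule symmetric_matrix_eqI)
    show "a \<bullet> (?A *v a) = a \<bullet> (\<Psi> i *v a)" for a
      using q[of a] inner_cross_moment[OF s s, of a a] by (simp add: power2_eq_square)
    show "transpose ?A = ?A" by (rule cross_moment_symmetric)
    show "transpose (\<Psi> i) = \<Psi> i" using pos_def_innovation[of i] by (simp add: pos_def_def)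
  qed
qed

end

text \<open>The logarithm of the density is quadratic, so its mean involves second moments only;
  when they match A, the quadratic part has mean \<open>trace (mat 1)\<close>. The lemma is applied
  to residuals of a possibly nonlinear code, whose law may be non-Gaussian.\<close>

lemma expectation_ln_mvn:
  fixes X :: "'a \<Rightarrow> real^'n"
  assumes "prob_space M" "square_integrable M X" "pos_def A" "cross_moment M X X = A"
  shows "integrable M (\<lambda>\<omega>. ln (mvn_density A (X \<omega>)))"
    "(\<integral>\<omega>. ln (mvn_density A (X \<omega>)) \<partial>M) = - CARD('n) / 2 - (CARD('n) * ln (2 * pi) + ln (det A)) / 2"
proof -
  interpret prob_space M by fact
  note i = integral_inner_matrix[OF assms(2), of "matrix_inv A"]
  have "trace (mat 1 :: real^'n^'n) = CARD('n)" by (simp add: trace_def mat_def)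
  then have t: "(\<integral>\<omega>. X \<omega> \<bullet> (matrix_inv A *v X \<omega>) \<partial>M) = CARD('n)"
    unfolding i(2) assms(4) by (simp add: matrix_inv_mult[OF pos_def_invertible[OF assms(3)]])
  show "integrable M (\<lambda>\<omega>. ln (mvn_density A (X \<omega>)))"
    unfolding ln_mvn_density[OF assms(3)] using i(1) by simp
  show "(\<integral>\<omega>. ln (mvn_density A (X \<omega>)) \<partial>M) = - CARD('n) / 2 - (CARD('n) * ln (2 * pi) + ln (det A)) / 2"
    unfolding ln_mvn_density[OF assms(3)] using i(1) by (simp add: t prob_space)
qed

section \<open>Averages over the block\<close>

lemma inner_avg:
  fixes A :: "nat \<Rightarrow> real^'n^'m"
  shows "a \<bullet> ((r *\<^sub>R (\<Sum>i<n. A i)) *v b) = r * (\<Sum>i<n. a \<bullet> (A i *v b))"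
proof -
  have "a \<bullet> ((\<Sum>i<n. A i) *v b) = (\<Sum>i<n. a \<bullet> (A i *v b))"
    by (induction n) (simp_all add: matrix_vector_mult_add_rdistrib inner_add_right)
  then show ?thesis by (simp add: scaleR_matrix_vector_assoc[symmetric])
qed

lemma joint_form_avg:
  fixes n :: nat
  shows "joint_form (r *\<^sub>R (\<Sum>i<n. P i)) (r *\<^sub>R (\<Sum>i<n. S i)) (r *\<^sub>R (\<Sum>i<n. \<Gamma> i)) \<alpha> \<beta> = r * (\<Sum>i<n.
      joint_form (P i) (S i) (\<Gamma> i) \<alpha> \<beta>)"
  unfolding joint_form_def inner_avg by (simp add: sum.distrib sum_distrib_left algebra_simps)

text \<open>\<open>Psi_Y\<close> is linear in all four matrices jointly, so the innovation
  covariances are averaged along with the moments.\<close>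

lemma Psi_Y_avg:
  fixes n :: nat
  shows "Psi_Y \<Lambda> H (r *\<^sub>R (\<Sum>i<n. \<Psi> i)) (r *\<^sub>R (\<Sum>i<n. P i), r *\<^sub>R (\<Sum>i<n. S i), r *\<^sub>R (\<Sum>i<n. \<Gamma> i))
    = r *\<^sub>R (\<Sum>i<n. Psi_Y \<Lambda> H (\<Psi> i) (P i, S i, \<Gamma> i))"
  by (rule matrix_eq_inner) (simp only: inner_avg inner_Psi_Y sum.distrib distrib_left)

lemma transpose_avg:
  fixes n :: nat
  assumes "\<And>i. i < n \<Longrightarrow> transpose (A i) = A i"
  shows "transpose (r *\<^sub>R (\<Sum>i<n. A i)) = r *\<^sub>R (\<Sum>i<n. A i)"
proof -
  have "transpose (\<Sum>i<n. A i) = (\<Sum>i<n. A i)"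
    using assms by (induction n) (auto simp: transpose_plus, simp add: transpose_def vec_eq_iff)
  then show ?thesis by (simp add: transpose_scalar)
qed

lemma trace_avg:
  fixes n :: nat
  shows "trace (r *\<^sub>R (\<Sum>i<n. A i)) = r * (\<Sum>i<n. trace (A i))"
proof -
  have "trace (\<Sum>i<n. A i) = (\<Sum>i<n. trace (A i))"
    by (induction n) (auto simp: trace_def sum.distrib)
  then show ?thesis by (simp add: trace_def sum_distrib_left[symmetric])
qed

context innovations
begin

text \<open>The witnesses are time averages of the second moments of input and tracking error. They
  meet the constraints of the optimization except that time averages of noise terms and innovation
  covariances stand in place of the stationary ones.\<close>

lemma converse_bound:
  fixes \<Lambda> :: "real^'m^'p" and F :: "real^'d^'d" and H :: "real^'d^'p" and K :: "nat \<Rightarrow> real^'p^'d"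
    and f :: "nat \<Rightarrow> nat \<Rightarrow> (nat \<Rightarrow> real^'p) \<Rightarrow> real^'m"
  defines "z \<equiv> \<lambda>t \<omega>. noise_of F H K (\<lambda>i. e i \<omega>) t"
  assumes code: "feedback_code M \<Lambda> z P n N f g" and n: "0 < n" and N: "1 \<le> N" and P: "0 \<le> P"
  obtains PX S \<Gamma> where "transpose PX = PX" "transpose S = S" "\<And>\<alpha> \<beta>. 0 \<le> joint_form PX S \<Gamma> \<alpha> \<beta>" "trace PX \<le> P"
    "\<And>a b. a \<bullet> (S *v a) \<le> joint_form PX S \<Gamma> (transpose F *v a + transpose H *v b) (transpose \<Lambda> *v b)
      + 1 / n * (\<Sum>i<n. (transpose (K i) *v a + b) \<bullet> (\<Psi> i *v (transpose (K i) *v a + b)))"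
    "(1 - error_prob M \<Lambda> z n N f g) * ln N
      \<le> n * (ln (det (Psi_Y \<Lambda> H ((1 / n) *\<^sub>R (\<Sum>i<n. \<Psi> i)) (PX, S, \<Gamma>))) / 2) - (\<Sum>i<n. ln (det (\<Psi> i))) / 2 + 1"
proof -
  define B where "B = message_noise_space N M"
  interpret B: prob_space B unfolding B_def by (rule prob_space_message_noise[OF prob_space_axioms N])
  have spB: "space B = {1..N} \<times> space M"
    by (simp add: B_def message_noise_space_def space_pair_measure space_uniform_count_measure)
  have f: "f m i \<in> measurable (Pi\<^sub>M {..<i} (\<lambda>_. borel)) borel" if "m \<in> {1..N}" "i < n" for m i
    using code that by (simp add: feedback_code_def)
  have g: "g \<in> measurable (Pi\<^sub>M {..<n} (\<lambda>_. borel)) (count_space UNIV)"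
    using code by (simp add: feedback_code_def)
  define pth where "pth x i = e i (snd x)" for x :: "nat \<times> 'a" and i
  have pth_eq: "pth x = (\<lambda>i. e i (snd x))" for x by (simp add: pth_def fun_eq_iff)
  \<comment> \<open>The input as a function of the innovation path instead of the outputs: with the
    message fixed, the innovations carry all the randomness.\<close>
  define xf where "xf m h i = channel_input \<Lambda> (f m) (noise_of F H K h) i" for m h i
  define X where "X i x = xf (fst x) (pth x) i" for i x
  define E where "E i x = e i (snd x)" for i and x :: "nat \<times> 'a"
  have zp: "channel_input \<Lambda> (f m) (\<lambda>t. z t \<omega>) i = xf m (\<lambda>i. e i \<omega>) i" for m \<omega> i
    by (simp add: xf_def z_def)
  have xf_cong: "xf m h i = xf m h' i" if "\<And>j. j < i \<Longrightarrow> h j = h' j" for m h h' i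
    unfolding xf_def by (intro channel_input_cong noise_of_cong) (use that in auto)
  have xf_meas: "(\<lambda>x. xf m (h x) i) \<in> borel_measurable R"
    if "m \<in> {1..N}" "i < n" "\<And>j. j < i \<Longrightarrow> (\<lambda>x. h x j) \<in> borel_measurable R" for m i h R
    unfolding xf_def by (intro channel_input_measurable noise_of_measurable f) (use that in auto)
  have comp: "(\<lambda>h. h j :: real^'p) \<in> borel_measurable (Pi\<^sub>M {..<i} (\<lambda>_. borel))" if "j < i" for i j :: nat
    using that by (intro measurable_component_singleton) simp
  have Bmeas: "h \<in> borel_measurable B" if "\<And>m. m \<in> {1..N} \<Longrightarrow> (\<lambda>\<omega>. h (m, \<omega>)) \<in> borel_measurable M" for
      h :: "_ \<Rightarrow> 'z::topological_space"
    unfolding B_def by (rule message_noise_space_measurable[OF that])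
  have X_meas: "X i \<in> borel_measurable B" if "i < n" for i
    by (rule Bmeas) (simp add: X_def pth_def xf_meas that)
  have sndm: "snd \<in> measurable B M" by (simp add: B_def message_noise_space_def)
  have dsnd: "distr B M snd = M"
  proof (rule measure_eqI)
    fix A assume A: "A \<in> sets (distr B M snd)"
    then have "emeasure (distr B M snd) A = (\<integral>\<^sup>+x. indicator A (snd x) \<partial>B)"
      using nn_integral_distr[OF sndm, of "indicator A"] by simp
    also have "\<dots> = (\<Sum>m\<in>{1..N}. ennreal (1 / N) * emeasure M A)"
      unfolding B_def using A by (subst nn_integral_message_noise[OF prob_space_axioms N]) auto
    also have "\<dots> = emeasure M A"
      using N by (simp add: ennreal_of_nat_eq_real_of_nat ennreal_mult[symmetric]
          mult.assoc[symmetric] del: ennreal_mult)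
    finally show "emeasure (distr B M snd) A = emeasure M A" .
  qed simp
  have sE: "square_integrable B (E i)" and EE: "cross_moment B (E i) (E i) = \<Psi> i" for i
    unfolding E_def using innovation_moments[OF sndm dsnd] by auto
  have pw: "(\<Sum>i<n. \<integral>\<^sup>+x. ennreal (X i x \<bullet> X i x) \<partial>B) / of_nat n \<le> ennreal P"
    using code unfolding feedback_code_def by (simp add: zp Let_def split_beta' B_def X_def pth_eq)
  have nn0: "of_nat n \<noteq> (0::ennreal)" "of_nat n \<noteq> (top::ennreal)" using n by auto
  have pw': "(\<Sum>i<n. \<integral>\<^sup>+x. ennreal (X i x \<bullet> X i x) \<partial>B) \<le> ennreal (n * P)"
  proof -
    have "(\<Sum>i<n. \<integral>\<^sup>+x. ennreal (X i x \<bullet> X i x) \<partial>B) \<le> ennreal P * of_nat n"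
      using mult_right_mono[OF pw, of "of_nat n"] nn0
      by (simp add: ennreal_divide_times ennreal_divide_self less_top[symmetric])
    then show ?thesis using P by (simp add: ennreal_of_nat_eq_real_of_nat ennreal_mult[symmetric]
        mult.commute del: ennreal_mult)
  qed
  \<comment> \<open>The total power is an extended nonnegative integral with a finite bound, so each
    summand is finite and every input in the block is square integrable.\<close>
  have sX: "square_integrable B (X i)" if i: "i < n" for i
  proof -
    have "(\<integral>\<^sup>+x. ennreal (X i x \<bullet> X i x) \<partial>B) \<le> (\<Sum>i<n. \<integral>\<^sup>+x. ennreal (X i x \<bullet> X i x) \<partial>B)"
      using i by (intro member_le_sum) auto
    also have "\<dots> < \<infinity>" using pw' by (rule le_less_trans) simp
    finally show ?thesis
      unfolding square_integrable_def power2_norm_eq_inner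
      using X_meas[OF i] by (intro conjI integrableI_bounded) auto
  qed
  \<comment> \<open>The input at time j uses innovations before j only, so the path may be cut off
    at any later time.\<close>
  have past: "xf m (pth (m', \<omega>)) j = xf m (\<lambda>k\<in>{..<i}. e k \<omega>) j" if "j \<le> i" for m m' \<omega> i j
    by (rule xf_cong) (use that in \<open>simp add: pth_def\<close>)
  have orth_X: "(\<integral>x. (a \<bullet> X j x) * (b \<bullet> E i x) \<partial>B) = 0" if "j \<le> i" "i < n" for i j a b
    unfolding B_def
  proof (rule integral_message_noise_0[OF prob_space_axioms N])
    fix m assume m: "m \<in> {1..N}"
    have "(\<lambda>h. a \<bullet> xf m h j) \<in> borel_measurable (Pi\<^sub>M {..<i} (\<lambda>_. borel))"
      using m that comp by (intro borel_measurable_inner borel_measurable_const xf_meas) auto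
    from innovation_orthogonal_past[OF this, of b]
    show "(\<integral>\<omega>. (a \<bullet> X j (m, \<omega>)) * (b \<bullet> E i (m, \<omega>)) \<partial>M) = 0"
      by (simp add: X_def E_def past[OF that(1)])
  qed
  have orth_E: "(\<integral>x. (a \<bullet> E j x) * (b \<bullet> E i x) \<partial>B) = 0" if "j < i" "i < n" for i j a b
    unfolding B_def
  proof (rule integral_message_noise_0[OF prob_space_axioms N])
    fix m
    have "(\<lambda>h. a \<bullet> h j) \<in> borel_measurable (Pi\<^sub>M {..<i} (\<lambda>_. borel))"
      using comp[OF that(1)] by simp
    from innovation_orthogonal_past[OF this, of b]
    show "(\<integral>\<omega>. (a \<bullet> E j (m, \<omega>)) * (b \<bullet> E i (m, \<omega>)) \<partial>M) = 0" using that by (simp add: E_def)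
  qed
  obtain KY :: "nat \<Rightarrow> real^'p^'d" and D :: "nat \<Rightarrow> nat \<times> 'a \<Rightarrow> real^'d" and \<epsilon> :: "nat \<Rightarrow> nat \<times> 'a \<Rightarrow>
      real^'p" where
    D: "\<And>i x. D i x = track_error F H \<Lambda> K KY (\<lambda>i. X i x) (\<lambda>i. E i x) i"
    and \<epsilon>: "\<And>i x. \<epsilon> i x = \<Lambda> *v X i x + H *v D i x + E i x"
    and sD: "\<And>i. i \<le> n \<Longrightarrow> square_integrable B (D i)" and s\<epsilon>: "\<And>i. i < n \<Longrightarrow> square_integrable B (\<epsilon> i)"
    and PY: "\<And>i. i < n \<Longrightarrow> cross_moment B (\<epsilon> i) (\<epsilon> i) = Psi_Y \<Lambda> H (\<Psi> i) (cross_moment B (X i) (X i),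
        cross_moment B (D i) (D i), cross_moment B (X i) (D i))"
    and step: "\<And>i a b. i < n \<Longrightarrow> a \<bullet> (cross_moment B (D (Suc i)) (D (Suc i)) *v a) \<le>
      joint_form (cross_moment B (X i) (X i)) (cross_moment B (D i) (D i)) (cross_moment B (X i) (D i))
         (transpose F *v a + transpose H *v b) (transpose \<Lambda> *v b)
      + (transpose (K i) *v a + b) \<bullet> (\<Psi> i *v (transpose (K i) *v a + b))"
    by (rule regression_gains[where M=B and X=X and e=E and \<Psi>=\<Psi> and n=n and K=K and F=F and H=H and \<Lambda>=\<Lambda>];
        (rule B.prob_space_axioms sE EE pos_def_innovation | erule sX | erule (1) orth_E orth_X |
            (rule that, assumption+)))
  define Pc where "Pc i = cross_moment B (X i) (X i)" for i
  define Sc where "Sc i = cross_moment B (D i) (D i)" for i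
  define Gc where "Gc i = cross_moment B (X i) (D i)" for i
  \<comment> \<open>The value beyond the block is a filler: \<open>change_of_measure\<close> asks
    for a probability density at every index, and \<open>\<Psi> i\<close> is positive
    definite.\<close>
  define Yc where "Yc i = (if i < n then Psi_Y \<Lambda> H (\<Psi> i) (Pc i, Sc i, Gc i) else \<Psi> i)" for i
  have sym: "transpose (Pc i) = Pc i" "transpose (Sc i) = Sc i" for i
    by (simp_all add: Pc_def Sc_def cross_moment_symmetric)
  have nnf: "0 \<le> joint_form (Pc i) (Sc i) (Gc i) \<alpha> \<beta>" if "i < n" for i \<alpha> \<beta>
    unfolding Pc_def Sc_def Gc_def using that sD sX
    by (subst joint_form_moments[symmetric]) auto
  have Yc: "pos_def (Yc i)" for i
    unfolding Yc_def using nnf sym pos_def_innovation by (auto intro!: pos_def_Psi_Y)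
  \<comment> \<open>\<open>\<epsilon> i\<close> is the innovation at time i plus this function of
    the earlier innovations, the shape that \<open>change_of_measure\<close> requires.\<close>
  define sh where "sh m i h = \<Lambda> *v xf m h i + H *v track_error F H \<Lambda> K KY (xf m h) h i" for m i h
  have sh_meas: "sh m i \<in> borel_measurable (Pi\<^sub>M {..<i} (\<lambda>_. borel))" if "m \<in> {1..N}" "i < n" for m i
    unfolding sh_def using that comp
    by (intro borel_measurable_add borel_measurable_matrix_vector track_error_measurable xf_meas) auto
  have \<epsilon>_sh: "\<epsilon> i x = pth x i + sh (fst x) i (restrict (pth x) {..<i})" for i x
  proof -
    have "xf (fst x) (restrict (pth x) {..<i}) j = xf (fst x) (pth x) j" if "j \<le> i" for j
      by (rule xf_cong) (use that in simp)
    moreover from this have "track_error F H \<Lambda> K KY (xf (fst x) (restrict (pth x) {..<i})) (restrict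
        (pth x) {..<i}) i
      = track_error F H \<Lambda> K KY (xf (fst x) (pth x)) (pth x) i"
      by (intro track_error_cong) auto
    moreover have "D i x = track_error F H \<Lambda> K KY (xf (fst x) (pth x)) (pth x) i"
      unfolding D by (simp add: X_def E_def pth_eq)
    ultimately show ?thesis unfolding \<epsilon> sh_def by (simp add: X_def E_def pth_eq)
  qed
  define Y where "Y h = (\<lambda>i\<in>{..<n}. noise_of F H KY h i)" for h
  have Ym: "Y \<in> measurable (Pi\<^sub>M {..<n} (\<lambda>_. borel)) (Pi\<^sub>M {..<n} (\<lambda>_. borel))"
    unfolding Y_def by (intro measurable_restrict noise_of_measurable comp) auto
  \<comment> \<open>The received block is a function of the residuals alone, and the same map Y
    serves all messages.\<close>
  have out: "outputs \<Lambda> (f m) (\<lambda>t. z t \<omega>) n = Y (\<lambda>i\<in>{..<n}. \<epsilon> i (m, \<omega>))" for m \<omega>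
  proof -
    let ?e = "\<lambda>i. e i \<omega>"
    have "\<epsilon> i (m, \<omega>) = \<Lambda> *v xf m ?e i + H *v track_error F H \<Lambda> K KY (xf m ?e) ?e i + ?e i" for i
      unfolding \<epsilon> D by (simp add: X_def E_def pth_eq)
    then have *: "\<Lambda> *v xf m ?e i + noise_of F H K ?e i = noise_of F H KY (\<lambda>i. \<epsilon> i (m, \<omega>)) i" for i
      using channel_output_noise_of[of \<Lambda> "xf m ?e" i F H K ?e KY] by simp
    have "outputs \<Lambda> (f m) (\<lambda>t. z t \<omega>) n = (\<lambda>i\<in>{..<n}. \<Lambda> *v xf m ?e i + noise_of F H K ?e i)"
      unfolding outputs_eq zp by (simp add: z_def)
    also have "\<dots> = Y (\<lambda>i\<in>{..<n}. \<epsilon> i (m, \<omega>))"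
      unfolding * Y_def by (intro restrict_ext noise_of_cong) auto
    finally show ?thesis .
  qed
  define Z where "Z x = (\<Prod>i<n. mvn_density (Yc i) (\<epsilon> i x) / mvn_density (\<Psi> i) (E i x))" for x
  have Zpos: "0 < Z x" for x
    unfolding Z_def by (intro prod_pos divide_pos_pos ballI mvn_density_pos Yc pos_def_innovation)
  have \<epsilon>m: "\<epsilon> i \<in> borel_measurable B" "E i \<in> borel_measurable B" if "i < n" for i
    using s\<epsilon>[OF that] sE by (auto simp: square_integrable_def)
  have Zm [measurable]: "Z \<in> borel_measurable B"
    unfolding Z_def using \<epsilon>m by (intro borel_measurable_prod borel_measurable_divide
        measurable_compose[OF _ mvn_density_measurable]) auto
  \<comment> \<open>The comparison law: independent Gaussian residuals that have, at each time, the
    second moment of the actual ones. It does not depend on the message.\<close>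
  define Q where "Q = Pi\<^sub>M {..<n} (\<lambda>i. density lborel (\<lambda>x. ennreal (mvn_density (Yc i) x)))"
  have Q: "prob_space Q" unfolding Q_def by (intro prob_space_PiM prob_space_mvn Yc)
  interpret Q: prob_space Q by fact
  have sQ [measurable_cong]: "sets Q = sets (Pi\<^sub>M {..<n} (\<lambda>_. borel))" unfolding Q_def by (intro
      sets_PiM_cong) auto
  have change: "(\<integral>\<^sup>+\<omega>. ennreal (Z (m, \<omega>)) * \<phi> (\<lambda>i\<in>{..<n}. \<epsilon> i (m, \<omega>)) \<partial>M) = (\<integral>\<^sup>+h. \<phi> h \<partial>Q)"
    if m: "m \<in> {1..N}" and \<phi>: "\<phi> \<in> borel_measurable (Pi\<^sub>M {..<n} (\<lambda>_. borel))" for m \<phi>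
  proof -
    let ?W = "\<lambda>h. ennreal (\<Prod>i<n. mvn_density (Yc i) (h i + sh m i (restrict h {..<i})) / mvn_density
        (\<Psi> i) (h i))
      * \<phi> (\<lambda>i\<in>{..<n}. h i + sh m i (restrict h {..<i}))"
    have shm: "(\<lambda>h. sh m i (restrict h {..<i})) \<in> borel_measurable (Pi\<^sub>M {..<n} (\<lambda>_. borel))" if "i < n" for i
      using that m by (intro measurable_compose[OF _ sh_meas] measurable_restrict_subset) auto
    have Wm: "?W \<in> borel_measurable (Pi\<^sub>M {..<n} (\<lambda>_. borel))"
      using shm comp
      by (intro borel_measurable_times_ennreal measurable_compose[OF _ measurable_ennreal]
          borel_measurable_prod borel_measurable_divide
          measurable_compose[OF _ mvn_density_measurable] measurable_compose[OF _ \<phi>]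
              measurable_restrict borel_measurable_add) auto
    have Weq: "?W (\<lambda>i\<in>{..<n}. e i \<omega>) = ennreal (Z (m, \<omega>)) * \<phi> (\<lambda>i\<in>{..<n}. \<epsilon> i (m, \<omega>))" for \<omega>
    proof -
      have "(\<lambda>i\<in>{..<n}. e i \<omega>) i + sh m i (restrict (\<lambda>i\<in>{..<n}. e i \<omega>) {..<i}) = \<epsilon> i (m, \<omega>)" if "i < n" for i
      proof -
        have "restrict (\<lambda>i\<in>{..<n}. e i \<omega>) {..<i} = restrict (pth (m, \<omega>)) {..<i}"
          using that by (auto simp: restrict_def fun_eq_iff pth_def)
        then show ?thesis using that by (simp add: \<epsilon>_sh pth_def)
      qed
      then have 1: "(\<lambda>i\<in>{..<n}. (\<lambda>i\<in>{..<n}. e i \<omega>) i + sh m i (restrict (\<lambda>i\<in>{..<n}. e i \<omega>) {..<i}))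
          = (\<lambda>i\<in>{..<n}. \<epsilon> i (m, \<omega>))"
        and 2: "(\<Prod>i<n. mvn_density (Yc i) ((\<lambda>i\<in>{..<n}. e i \<omega>) i + sh m i (restrict (\<lambda>i\<in>{..<n}. e i
            \<omega>) {..<i})) / mvn_density (\<Psi> i) ((\<lambda>i\<in>{..<n}. e i \<omega>) i)) = Z (m, \<omega>)"
        unfolding Z_def E_def by (auto intro!: restrict_ext prod.cong)
      show ?thesis unfolding 1 2 ..
    qed
    have "(\<integral>\<^sup>+\<omega>. ennreal (Z (m, \<omega>)) * \<phi> (\<lambda>i\<in>{..<n}. \<epsilon> i (m, \<omega>)) \<partial>M) = (\<integral>\<^sup>+h. ?W h \<partial>distr M (Pi\<^sub>M
        {..<n} (\<lambda>_. borel)) (\<lambda>\<omega>. \<lambda>i\<in>{..<n}. e i \<omega>))"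
      unfolding Weq[symmetric] by (rule nn_integral_distr[symmetric, OF past_measurable]) (use Wm in simp)
    also have "\<dots> = (\<integral>\<^sup>+h. \<phi> h \<partial>Q)"
      unfolding law Q_def
      by (rule change_of_measure) (auto intro: mvn_density_pos less_imp_le prob_space_mvn Yc
          pos_def_innovation sh_meas[OF m] \<phi>)
    finally show ?thesis .
  qed
  define C where "C = {x \<in> space B. g (Y (\<lambda>i\<in>{..<n}. \<epsilon> i x)) = fst x}"
  have gY: "(\<lambda>h. g (Y h)) \<in> measurable (Pi\<^sub>M {..<n} (\<lambda>_. borel)) (count_space UNIV)"
    by (rule measurable_compose[OF Ym g])
  have \<epsilon>nm: "(\<lambda>x. \<lambda>i\<in>{..<n}. \<epsilon> i x) \<in> measurable B (Pi\<^sub>M {..<n} (\<lambda>_. borel))"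
    using \<epsilon>m by (intro measurable_restrict) auto
  have fstm: "fst \<in> measurable B (count_space UNIV)"
    unfolding B_def by (rule message_noise_space_measurable) simp
  have C: "C \<in> sets B"
  proof -
    let ?h = "\<lambda>x. g (Y (\<lambda>i\<in>{..<n}. \<epsilon> i x))"
    have "C = (\<Union>c. (?h -` {c} \<inter> space B) \<inter> (fst -` {c} \<inter> space B))" by (auto simp: C_def)
    moreover have "(?h -` {c} \<inter> space B) \<inter> (fst -` {c} \<inter> space B) \<in> sets B" for c
      by (intro sets.Int measurable_sets[OF measurable_compose[OF \<epsilon>nm gY]] measurable_sets[OF fstm]) simp_all
    ultimately show ?thesis by (simp add: sets.countable_UN)
  qed
  have ind: "indicator C (m, \<omega>) = (indicator {m} (g (Y (\<lambda>i\<in>{..<n}. \<epsilon> i (m, \<omega>)))) :: ennreal)" if "m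
      \<in> {1..N}" "\<omega> \<in> space M" for m \<omega>
    using that by (auto simp: C_def spB indicator_def)
  have slm: "(\<lambda>\<omega>. (m, \<omega>)) \<in> measurable M B" if "m \<in> {1..N}" for m
    using that unfolding B_def message_noise_space_def by (intro measurable_Pair1') (simp add:
        space_uniform_count_measure)
  have Z1: "(\<integral>\<^sup>+x. ennreal (Z x) \<partial>B) \<le> 1"
  proof -
    have "(\<integral>\<^sup>+x. ennreal (Z x) \<partial>B) = (\<Sum>m\<in>{1..N}. ennreal (1 / N) * (\<integral>\<^sup>+\<omega>. ennreal (Z (m, \<omega>)) \<partial>M))"
      unfolding B_def by (rule nn_integral_message_noise[OF prob_space_axioms N])
         (use measurable_compose[OF slm Zm] in simp)
    also have "\<dots> = (\<Sum>m\<in>{1..N}. ennreal (1 / N) * 1)"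
      using change[of _ "\<lambda>_. 1"] by (intro sum.cong) (simp_all add: Q.emeasure_space_1)
    also have "\<dots> = 1"
      using N by (simp add: ennreal_of_nat_eq_real_of_nat ennreal_mult[symmetric] del: ennreal_mult)
    finally show ?thesis by simp
  qed
  \<comment> \<open>After the change of measure the decoder acts on one law Q for all messages. The
    events that it outputs m, for m up to N, are disjoint under Q, so their probabilities add up to
    at most 1.\<close>
  have ZC: "(\<integral>\<^sup>+x. ennreal (Z x) * indicator C x \<partial>B) \<le> ennreal (1 / N)"
  proof -
    have ZCm: "(\<lambda>x. ennreal (Z x) * indicator C x) \<in> borel_measurable B" using C by measurable
    have "(\<integral>\<^sup>+x. ennreal (Z x) * indicator C x \<partial>B) = (\<Sum>m\<in>{1..N}. ennreal (1 / N) * (\<integral>\<^sup>+\<omega>. ennreal (Z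
        (m, \<omega>)) * indicator C (m, \<omega>) \<partial>M))"
      unfolding B_def by (rule nn_integral_message_noise[OF prob_space_axioms N])
         (rule measurable_compose[OF slm ZCm])
    also have "\<dots> = (\<Sum>m\<in>{1..N}. ennreal (1 / N) * (\<integral>\<^sup>+h. indicator {m} (g (Y h)) \<partial>Q))"
    proof (rule sum.cong[OF refl])
      fix m assume m: "m \<in> {1..N}"
      have "(\<integral>\<^sup>+\<omega>. ennreal (Z (m, \<omega>)) * indicator C (m, \<omega>) \<partial>M) = (\<integral>\<^sup>+\<omega>. ennreal (Z (m, \<omega>)) *
          indicator {m} (g (Y (\<lambda>i\<in>{..<n}. \<epsilon> i (m, \<omega>)))) \<partial>M)"
        by (intro nn_integral_cong) (simp add: ind[OF m])
      also have "\<dots> = (\<integral>\<^sup>+h. indicator {m} (g (Y h)) \<partial>Q)"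
        by (rule change[OF m, of "\<lambda>h. indicator {m} (g (Y h))"]) (rule measurable_compose[OF gY], simp)
      finally show "ennreal (1 / N) * (\<integral>\<^sup>+\<omega>. ennreal (Z (m, \<omega>)) * indicator C (m, \<omega>) \<partial>M) = ennreal
          (1 / N) * (\<integral>\<^sup>+h. indicator {m} (g (Y h)) \<partial>Q)" by simp
    qed
    also have "\<dots> = ennreal (1 / N) * (\<integral>\<^sup>+h. (\<Sum>m\<in>{1..N}. indicator {m} (g (Y h))) \<partial>Q)"
      unfolding sum_distrib_left[symmetric]
      using measurable_compose[OF gY, of "indicator {_} :: nat \<Rightarrow> ennreal"]
      by (subst nn_integral_sum) (auto simp: measurable_cong_sets[OF sQ refl])
    also have "\<dots> \<le> ennreal (1 / N) * (\<integral>\<^sup>+h. 1 \<partial>Q)"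
    proof (intro mult_left_mono nn_integral_mono)
      fix h
      have "(\<Sum>m\<in>{1..N}. indicator {m} (g (Y h))) = (\<Sum>m\<in>{1..N}. if m = g (Y h) then 1 else (0::ennreal))"
        by (intro sum.cong) (auto simp: indicator_def)
      also have "\<dots> \<le> 1" by simp
      finally show "(\<Sum>m\<in>{1..N}. indicator {m} (g (Y h))) \<le> (1::ennreal)" .
    qed simp
    also have "\<dots> = ennreal (1 / N)" by (simp add: Q.emeasure_space_1)
    finally show ?thesis .
  qed
  have lnZ: "ln (Z x) = (\<Sum>i<n. ln (mvn_density (Yc i) (\<epsilon> i x)) - ln (mvn_density (\<Psi> i) (E i x)))" for x
    unfolding Z_def using mvn_density_pos[OF Yc] mvn_density_pos[OF pos_def_innovation]
    by (subst ln_prod) (auto simp: ln_div less_imp_neq[THEN not_sym])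
  have Y\<epsilon>: "cross_moment B (\<epsilon> i) (\<epsilon> i) = Yc i" if "i < n" for i
    using PY[OF that] that by (simp add: Yc_def Pc_def Sc_def Gc_def)
  have iY: "integrable B (\<lambda>x. ln (mvn_density (Yc i) (\<epsilon> i x)))" and iE: "integrable B (\<lambda>x. ln
      (mvn_density (\<Psi> i) (E i x)))" if "i < n" for i
    using expectation_ln_mvn(1)[OF B.prob_space_axioms s\<epsilon>[OF that] Yc Y\<epsilon>[OF that]]
      expectation_ln_mvn(1)[OF B.prob_space_axioms sE pos_def_innovation EE] by auto
  have ilnZ: "integrable B (\<lambda>x. ln (Z x))"
    unfolding lnZ using iY iE by (intro Bochner_Integration.integrable_sum
        Bochner_Integration.integrable_diff) auto
  \<comment> \<open>Numerator and denominator have matching second moments, so their mean logarithms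
    contain the same dimension terms, which cancel and leave the determinants.\<close>
  have ElnZ: "- (\<integral>x. ln (Z x) \<partial>B) = (\<Sum>i<n. ln (det (Yc i))) / 2 - (\<Sum>i<n. ln (det (\<Psi> i))) / 2"
  proof -
    have "(\<integral>x. ln (Z x) \<partial>B) = (\<Sum>i<n. (\<integral>x. ln (mvn_density (Yc i) (\<epsilon> i x)) \<partial>B) - (\<integral>x. ln (mvn_density
        (\<Psi> i) (E i x)) \<partial>B))"
      unfolding lnZ using iY iE by (subst Bochner_Integration.integral_sum) auto
    also have "\<dots> = (\<Sum>i<n. ln (det (\<Psi> i)) / 2 - ln (det (Yc i)) / 2)"
    proof (intro sum.cong refl)
      fix i assume "i \<in> {..<n}"
      then have i: "i < n" by simp
      show "(\<integral>x. ln (mvn_density (Yc i) (\<epsilon> i x)) \<partial>B) - (\<integral>x. ln (mvn_density (\<Psi> i) (E i x)) \<partial>B) = ln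
          (det (\<Psi> i)) / 2 - ln (det (Yc i)) / 2"
        unfolding expectation_ln_mvn(2)[OF B.prob_space_axioms s\<epsilon>[OF i] Yc Y\<epsilon>[OF i]]
          expectation_ln_mvn(2)[OF B.prob_space_axioms sE pos_def_innovation EE]
        by (simp add: field_simps)
    qed
    finally show ?thesis by (simp add: sum_subtractf sum_divide_distrib)
  qed
  have err: "error_prob M \<Lambda> z n N f g = 1 - measure B C"
  proof -
    have "{(m, \<omega>) \<in> space (message_noise_space N M). g (outputs \<Lambda> (f m) (\<lambda>t. z t \<omega>) n) \<noteq> m} = space B - C"
      unfolding out B_def[symmetric] C_def by auto
    then show ?thesis
      unfolding error_prob_def B_def[symmetric] using B.prob_compl[OF C] by simp
  qed
  let ?r = "1 / real n"
  have ld: "(\<Sum>i<n. ln (det (Yc i))) \<le> n * ln (det (?r *\<^sub>R (\<Sum>i<n. Yc i)))"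
    using ln_det_sum_le[where A=Yc, OF n Yc] by simp
  have Yavg: "?r *\<^sub>R (\<Sum>i<n. Yc i) = Psi_Y \<Lambda> H (?r *\<^sub>R (\<Sum>i<n. \<Psi> i)) (?r *\<^sub>R (\<Sum>i<n. Pc i), ?r *\<^sub>R
      (\<Sum>i<n. Sc i), ?r *\<^sub>R (\<Sum>i<n. Gc i))"
    unfolding Psi_Y_avg by (intro arg_cong[where f="scaleR ?r"] sum.cong) (auto simp: Yc_def)
  show thesis
  proof (rule that)
    show "transpose (?r *\<^sub>R (\<Sum>i<n. Pc i)) = ?r *\<^sub>R (\<Sum>i<n. Pc i)" "transpose (?r *\<^sub>R (\<Sum>i<n. Sc i)) =
        ?r *\<^sub>R (\<Sum>i<n. Sc i)"
      by (intro transpose_avg sym)+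
    show "0 \<le> joint_form (?r *\<^sub>R (\<Sum>i<n. Pc i)) (?r *\<^sub>R (\<Sum>i<n. Sc i)) (?r *\<^sub>R (\<Sum>i<n. Gc i)) \<alpha> \<beta>" for \<alpha> \<beta>
      unfolding joint_form_avg by (intro mult_nonneg_nonneg sum_nonneg nnf) auto
    have tr: "trace (Pc i) = (\<integral>x. X i x \<bullet> X i x \<partial>B)" "integrable B (\<lambda>x. X i x \<bullet> X i x)" if "i < n" for i
      using integral_inner_matrix[OF sX[OF that], of "mat 1"] by (simp_all add: Pc_def)
    have "ennreal (\<Sum>i<n. trace (Pc i)) = (\<Sum>i<n. \<integral>\<^sup>+x. ennreal (X i x \<bullet> X i x) \<partial>B)"
      using tr by (subst sum_ennreal[symmetric]) (auto simp: nn_integral_eq_integral intro!: sum.cong)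
    then have "ennreal (\<Sum>i<n. trace (Pc i)) \<le> ennreal (n * P)" using pw' by simp
    then have "(\<Sum>i<n. trace (Pc i)) \<le> n * P" using P by (subst (asm) ennreal_le_iff) auto
    then show "trace (?r *\<^sub>R (\<Sum>i<n. Pc i)) \<le> P" using n by (simp add: trace_avg field_simps)
    have "(1 - error_prob M \<Lambda> z n N f g) * ln N = measure B C * ln (real N)" by (simp add: err)
    also have "\<dots> \<le> - (\<integral>x. ln (Z x) \<partial>B) + 1"
      by (rule mult_ln_card_le[OF B.prob_space_axioms Zm C Zpos Z1 ZC _ ilnZ]) (use N in simp)
    also have "\<dots> \<le> n * (ln (det (?r *\<^sub>R (\<Sum>i<n. Yc i))) / 2) - (\<Sum>i<n. ln (det (\<Psi> i))) / 2 + 1"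
      unfolding ElnZ using ld by simp
    finally show "(1 - error_prob M \<Lambda> z n N f g) * ln N \<le> n * (ln (det (Psi_Y \<Lambda> H (?r *\<^sub>R (\<Sum>i<n. \<Psi>
        i)) (?r *\<^sub>R (\<Sum>i<n. Pc i), ?r *\<^sub>R (\<Sum>i<n. Sc i), ?r *\<^sub>R (\<Sum>i<n. Gc i)))) / 2)
        - (\<Sum>i<n. ln (det (\<Psi> i))) / 2 + 1"
      unfolding Yavg .
    fix a b
    let ?J = "\<lambda>i. joint_form (Pc i) (Sc i) (Gc i) (transpose F *v a + transpose H *v b) (transpose \<Lambda> *v b)"
    let ?N = "\<lambda>i. (transpose (K i) *v a + b) \<bullet> (\<Psi> i *v (transpose (K i) *v a + b))"
    have "D 0 = (\<lambda>x. 0)" by (simp add: D fun_eq_iff)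
    then have S0: "a \<bullet> (Sc 0 *v a) = 0"
      unfolding Sc_def by (simp add: cross_moment_def zero_vec_def[symmetric])
    have "0 \<le> a \<bullet> (Sc n *v a)"
      unfolding Sc_def using sD[of n] by (subst inner_cross_moment[symmetric]) auto
    \<comment> \<open>Shifting the index adds the last term and removes the first, and the first is
      0 because tracking starts without error. This puts the current covariance in place of the next
      one.\<close>
    then have "(\<Sum>i<n. a \<bullet> (Sc i *v a)) \<le> (\<Sum>i<n. a \<bullet> (Sc (Suc i) *v a))"
      using S0 sum.lessThan_Suc_shift[of "\<lambda>i. a \<bullet> (Sc i *v a)" n] by simp
    also have "\<dots> \<le> (\<Sum>i<n. ?J i + ?N i)"
      using step by (intro sum_mono) (auto simp: Sc_def Pc_def Gc_def)
    finally have "?r * (\<Sum>i<n. a \<bullet> (Sc i *v a)) \<le> ?r * (\<Sum>i<n. ?J i + ?N i)" by (rule mult_left_mono) simp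
    then show "a \<bullet> (?r *\<^sub>R (\<Sum>i<n. Sc i) *v a) \<le> joint_form (?r *\<^sub>R (\<Sum>i<n. Pc i)) (?r *\<^sub>R (\<Sum>i<n. Sc
        i)) (?r *\<^sub>R (\<Sum>i<n. Gc i)) (transpose F *v a + transpose H *v b) (transpose \<Lambda> *v b)
       + ?r * (\<Sum>i<n. ?N i)"
      unfolding inner_avg joint_form_avg by (simp only: sum.distrib distrib_left)
  qed
qed

end

section \<open>The limit of the block length\<close>

text \<open>The first K deviations have a fixed sum A and the later ones are below r/2 each; the
  number of terms is taken large enough that A divided by it is below r/2.\<close>

lemma cesaro:
  fixes x :: "nat \<Rightarrow> 'a::real_normed_vector"
  assumes "x \<longlonglongrightarrow> L"
  shows "(\<lambda>n. (1 / real (Suc n)) *\<^sub>R (\<Sum>i<Suc n. x i)) \<longlonglongrightarrow> L"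
proof (rule LIMSEQ_I)
  fix r :: real assume r: "0 < r"
  define c where "c i = norm (x i - L)" for i
  obtain K where K: "\<And>i. K \<le> i \<Longrightarrow> c i < r / 2"
    using LIMSEQ_D[OF assms, of "r / 2"] r by (auto simp: c_def)
  define A where "A = (\<Sum>i<K. c i)"
  have A: "0 \<le> A" by (auto simp: A_def c_def intro: sum_nonneg)
  have s: "(\<Sum>i<n. c i) \<le> A + n * (r / 2)" for n
  proof (induction n)
    case (Suc n)
    show ?case
    proof (cases "n < K")
      case True
      then have "(\<Sum>i<Suc n. c i) \<le> A" unfolding A_def by (intro sum_mono2) (auto simp: c_def)
      moreover have "0 \<le> real (Suc n) * (r / 2)" using r by simp
      ultimately show ?thesis by linarith
    next
      case False
      then show ?thesis using Suc K[of n] by (simp add: algebra_simps add_divide_distrib)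
    qed
  qed (use A in simp)
  obtain N :: nat where N: "2 * A / r < real N" using reals_Archimedean2 by blast
  show "\<exists>no. \<forall>n\<ge>no. norm ((1 / real (Suc n)) *\<^sub>R (\<Sum>i<Suc n. x i) - L) < r"
  proof (intro exI allI impI)
    fix n assume "N \<le> n"
    then have n: "2 * A / r < real (Suc n)" using N by simp
    have "(1 / real (Suc n)) *\<^sub>R (\<Sum>i<Suc n. x i) - L = (1 / real (Suc n)) *\<^sub>R (\<Sum>i<Suc n. x i - L)"
      by (simp add: sum_subtractf scaleR_diff_right sum_constant_scaleR del: sum.lessThan_Suc of_nat_Suc)
    also have "norm \<dots> \<le> (1 / real (Suc n)) * (\<Sum>i<Suc n. c i)"
      unfolding norm_scaleR c_def by (intro mult_mono norm_sum) auto
    also have "\<dots> \<le> (1 / real (Suc n)) * (A + Suc n * (r / 2))" by (intro mult_left_mono s) simp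
    also have "\<dots> < r" using n r by (simp add: field_simps del: of_nat_Suc)
    finally show "norm ((1 / real (Suc n)) *\<^sub>R (\<Sum>i<Suc n. x i) - L) < r" .
  qed
qed

lemma tendsto_matrix_mult:
  fixes A :: "'a \<Rightarrow> real^'n^'m" and B :: "'a \<Rightarrow> real^'k^'n"
  assumes "(A \<longlongrightarrow> A0) F" "(B \<longlongrightarrow> B0) F"
  shows "((\<lambda>x. A x ** B x) \<longlongrightarrow> A0 ** B0) F"
  by (intro vec_tendstoI) (auto simp: matrix_matrix_mult_def intro!: tendsto_intros assms)

lemma tendsto_transpose:
  fixes A :: "'a \<Rightarrow> real^'n^'m"
  assumes "(A \<longlongrightarrow> A0) F"
  shows "((\<lambda>x. transpose (A x)) \<longlongrightarrow> transpose A0) F"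
  by (intro vec_tendstoI) (auto simp: transpose_def intro!: tendsto_intros assms)

lemma tendsto_det:
  fixes A :: "'a \<Rightarrow> real^'n^'n"
  assumes "(A \<longlongrightarrow> A0) F"
  shows "((\<lambda>x. det (A x)) \<longlongrightarrow> det A0) F"
  unfolding det_def by (intro tendsto_intros assms)

lemma tendsto_Psi_Y:
  assumes "(PP \<longlongrightarrow> \<Psi>) F" "(P \<longlongrightarrow> P0) F" "(S \<longlongrightarrow> S0) F" "(\<Gamma> \<longlongrightarrow> \<Gamma>0) F"
  shows "((\<lambda>x. Psi_Y \<Lambda> H (PP x) (P x, S x, \<Gamma> x)) \<longlongrightarrow> Psi_Y \<Lambda> H \<Psi> (P0, S0, \<Gamma>0)) F"
  unfolding Psi_Y_def by (simp, intro tendsto_add tendsto_matrix_mult tendsto_transpose tendsto_const assms)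

lemma tendsto_innov_cov:
  "(S \<longlongrightarrow> S0) F \<Longrightarrow> ((\<lambda>x. innov_cov H V (S x)) \<longlongrightarrow> innov_cov H V S0) F"
  unfolding innov_cov_def by (intro tendsto_add tendsto_matrix_mult tendsto_const)

text \<open>By Cauchy-Schwarz a vector on which the form vanishes lies in the kernel.\<close>

lemma psd_invertible_pos_def:
  assumes "psd A" "invertible A" shows "pos_def A"
proof -
  have A: "transpose A = A" "\<And>x. 0 \<le> x \<bullet> (A *v x)" using assms by (auto simp: psd_def)
  have "x = 0" if "x \<bullet> (A *v x) = 0" for x
  proof -
    have "y \<bullet> (A *v x) = 0" for y using psd_entry_le[OF A, of y x] that by simp
    then have "A *v x = 0" by (metis inner_eq_zero_iff)
    then show ?thesis
      using assms(2) by (metis invertible_left_inverse matrix_left_invertible_ker)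
  qed
  then show ?thesis unfolding pos_def_def using A by (metis order.order_iff_strict)
qed

section \<open>Convexity and attainment of the maximum\<close>

lemma joint_form_combination:
  "joint_form (u *\<^sub>R P + v *\<^sub>R P') (u *\<^sub>R S + v *\<^sub>R S') (u *\<^sub>R \<Gamma> + v *\<^sub>R \<Gamma>') \<alpha> \<beta> = u * joint_form P
      S \<Gamma> \<alpha> \<beta> + v * joint_form P' S' \<Gamma>' \<alpha> \<beta>"
  unfolding joint_form_def
  by (simp add: matrix_vector_mult_add_rdistrib scaleR_matrix_vector_assoc[symmetric]
      inner_add_right algebra_simps)

lemma Psi_Y_combination:
  assumes "u + v = 1"
  shows "Psi_Y \<Lambda> H \<Psi> (u *\<^sub>R P + v *\<^sub>R P', u *\<^sub>R S + v *\<^sub>R S', u *\<^sub>R \<Gamma> + v *\<^sub>R \<Gamma>') =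
    u *\<^sub>R Psi_Y \<Lambda> H \<Psi> (P, S, \<Gamma>) + v *\<^sub>R Psi_Y \<Lambda> H \<Psi> (P', S', \<Gamma>')"
proof (rule matrix_eq_inner)
  fix a b
  have "a \<bullet> (\<Psi> *v b) = u * (a \<bullet> (\<Psi> *v b)) + v * (a \<bullet> (\<Psi> *v b))"
    using assms by (metis distrib_right mult_1)
  then show "a \<bullet> (Psi_Y \<Lambda> H \<Psi> (u *\<^sub>R P + v *\<^sub>R P', u *\<^sub>R S + v *\<^sub>R S', u *\<^sub>R \<Gamma> + v *\<^sub>R \<Gamma>') *v b) =
    a \<bullet> ((u *\<^sub>R Psi_Y \<Lambda> H \<Psi> (P, S, \<Gamma>) + v *\<^sub>R Psi_Y \<Lambda> H \<Psi> (P', S', \<Gamma>')) *v b)"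
    by (simp add: inner_Psi_Y matrix_vector_mult_add_rdistrib scaleR_matrix_vector_assoc[symmetric]
        inner_add_right distrib_left del: transpose_matrix_vector)
qed

lemma pos_def_Psi_Y_feasible:
  assumes "pos_def \<Psi>" "(PX, S, \<Gamma>) \<in> feasible_set \<Lambda> F H Kp \<Psi> P"
  shows "pos_def (Psi_Y \<Lambda> H \<Psi> (PX, S, \<Gamma>))"
  using assms(2) unfolding feasible_set_iff[OF assms(1)] by (intro pos_def_Psi_Y assms(1)) auto

text \<open>In the form of \<open>feasible_set_iff\<close> every constraint is linear in the
  variables apart from the noise term, which is a constant and is reproduced by weights of sum
  1.\<close>

lemma convex_feasible_set:
  assumes "pos_def \<Psi>" shows "convex (feasible_set \<Lambda> F H Kp \<Psi> P)"
  unfolding convex_def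
proof (intro ballI allI impI)
  fix q q' and u v :: real
  assume q: "q \<in> feasible_set \<Lambda> F H Kp \<Psi> P" "q' \<in> feasible_set \<Lambda> F H Kp \<Psi> P" and uv: "0 \<le> u" "0 \<le> v"
      "u + v = 1"
  obtain A S \<Gamma> where 1: "q = (A, S, \<Gamma>)" by (cases q)
  obtain A' S' \<Gamma>' where 2: "q' = (A', S', \<Gamma>')" by (cases q')
  note f = q[unfolded 1 2 feasible_set_iff[OF assms]]
  have "(u *\<^sub>R A + v *\<^sub>R A', u *\<^sub>R S + v *\<^sub>R S', u *\<^sub>R \<Gamma> + v *\<^sub>R \<Gamma>') \<in> feasible_set \<Lambda> F H Kp \<Psi> P"
    unfolding feasible_set_iff[OF assms] joint_form_combination
  proof (intro conjI allI)
    show "transpose (u *\<^sub>R A + v *\<^sub>R A') = u *\<^sub>R A + v *\<^sub>R A'" "transpose (u *\<^sub>R S + v *\<^sub>R S') = u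
        *\<^sub>R S + v *\<^sub>R S'"
      using f by (simp_all add: transpose_plus transpose_scalar)
    show "0 \<le> u * joint_form A S \<Gamma> \<alpha> \<beta> + v * joint_form A' S' \<Gamma>' \<alpha> \<beta>" for \<alpha> \<beta>
      using f uv by (intro add_nonneg_nonneg mult_nonneg_nonneg) auto
    have "trace (u *\<^sub>R A + v *\<^sub>R A') = u * trace A + v * trace A'"
      by (simp add: trace_def sum.distrib sum_distrib_left)
    also have "\<dots> \<le> u * P + v * P" using f uv by (intro add_mono mult_left_mono) auto
    also have "\<dots> = P" using uv by (metis distrib_right mult_1)
    finally show "trace (u *\<^sub>R A + v *\<^sub>R A') \<le> P" .
    fix a b
    let ?n = "(transpose Kp *v a + b) \<bullet> (\<Psi> *v (transpose Kp *v a + b))"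
    let ?j = "joint_form A S \<Gamma> (transpose F *v a + transpose H *v b) (transpose \<Lambda> *v b)"
    let ?j' = "joint_form A' S' \<Gamma>' (transpose F *v a + transpose H *v b) (transpose \<Lambda> *v b)"
    have "a \<bullet> ((u *\<^sub>R S + v *\<^sub>R S') *v a) = u * (a \<bullet> (S *v a)) + v * (a \<bullet> (S' *v a))"
      by (simp add: matrix_vector_mult_add_rdistrib scaleR_matrix_vector_assoc[symmetric] inner_add_right)
    also have "\<dots> \<le> u * (?j + ?n) + v * (?j' + ?n)"
      using f uv by (intro add_mono mult_left_mono) auto
    also have "\<dots> = u * ?j + v * ?j' + (u + v) * ?n" by (simp only: distrib_left distrib_right)
    finally show "a \<bullet> ((u *\<^sub>R S + v *\<^sub>R S') *v a) \<le> u * ?j + v * ?j' + ?n" unfolding uv(3) by simp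
  qed
  then show "u *\<^sub>R q + v *\<^sub>R q' \<in> feasible_set \<Lambda> F H Kp \<Psi> P" by (simp add: 1 2)
qed

text \<open>Log det is concave and \<open>Psi_Y\<close> is affine in the decision variable.\<close>

lemma concave_objective:
  assumes "pos_def \<Psi>" shows "concave_on (feasible_set \<Lambda> F H Kp \<Psi> P) (objective \<Lambda> H \<Psi>)"
  unfolding concave_on_iff
proof (intro conjI ballI allI impI convex_feasible_set assms)
  fix q q' and u v :: real
  assume q: "q \<in> feasible_set \<Lambda> F H Kp \<Psi> P" "q' \<in> feasible_set \<Lambda> F H Kp \<Psi> P" and uv: "0 \<le> u" "0 \<le> v"
      "u + v = 1"
  obtain A S \<Gamma> where 1: "q = (A, S, \<Gamma>)" by (cases q)
  obtain A' S' \<Gamma>' where 2: "q' = (A', S', \<Gamma>')" by (cases q')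
  have "u * ln (det (Psi_Y \<Lambda> H \<Psi> q)) + v * ln (det (Psi_Y \<Lambda> H \<Psi> q')) \<le> ln (det (Psi_Y \<Lambda> H \<Psi> (u *\<^sub>R q
      + v *\<^sub>R q')))"
    using ln_det_concave[OF pos_def_Psi_Y_feasible[OF assms q(1)[unfolded 1]]
        pos_def_Psi_Y_feasible[OF assms q(2)[unfolded 2]] uv]
    by (simp add: 1 2 Psi_Y_combination[OF uv(3)])
  then have "(u * ln (det (Psi_Y \<Lambda> H \<Psi> q)) + v * ln (det (Psi_Y \<Lambda> H \<Psi> q'))) / (2 * ln 2) \<le> ln (det
      (Psi_Y \<Lambda> H \<Psi> (u *\<^sub>R q + v *\<^sub>R q'))) / (2 * ln 2)"
    by (rule divide_right_mono) simp
  moreover have "u * c + v * c = c" for c :: real using uv(3) by (metis distrib_right mult_1)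
  note this[of "ln (det \<Psi>) / (2 * ln 2)"]
  ultimately show "u * objective \<Lambda> H \<Psi> q + v * objective \<Lambda> H \<Psi> q' \<le> objective \<Lambda> H \<Psi> (u *\<^sub>R q + v *\<^sub>R q')"
    unfolding objective_def log_def by (simp add: algebra_simps add_divide_distrib)
qed

text \<open>\<open>feasible_limit\<close> for a sequence that meets the constraints exactly. The
  noise term is then the same for all n and vanishes at the value of b that yields the bound, which
  explains the choice 0 for \<open>\<kappa>\<close>.\<close>

lemma compact_feasible_set:
  fixes F :: "real^'d^'d" and \<Lambda> :: "real^'m^'p"
  assumes \<Psi>: "pos_def \<Psi>" and stab: "spectral_radius (F - Kp ** H) < 1"
  shows "compact (feasible_set \<Lambda> F H Kp \<Psi> P)"
  unfolding compact_eq_seq_compact_metric seq_compact_def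
proof (intro allI impI)
  fix q :: "nat \<Rightarrow> (real^'m^'m) \<times> (real^'d^'d) \<times> (real^'d^'m)"
  assume q: "\<forall>n. q n \<in> feasible_set \<Lambda> F H Kp \<Psi> P"
  define A S \<Gamma> where "A n = fst (q n)" and "S n = fst (snd (q n))" and "\<Gamma> n = snd (snd (q n))" for n
  have "(A n, S n, \<Gamma> n) \<in> feasible_set \<Lambda> F H Kp \<Psi> P" for n using q by (simp add: A_def S_def \<Gamma>_def)
  note f = this[unfolded feasible_set_iff[OF \<Psi>]]
  obtain r A' S' G' where r: "strict_mono r" "(A', S', G') \<in> feasible_set \<Lambda> F H Kp \<Psi> P"
    "(\<lambda>n. A (r n)) \<longlonglongrightarrow> A'" "(\<lambda>n. S (r n)) \<longlonglongrightarrow> S'" "(\<lambda>n. \<Gamma> (r n)) \<longlonglongrightarrow> G'"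
    by (rule feasible_limit[where P=A and S=S and \<Gamma>=\<Gamma> and \<Lambda>=\<Lambda> and c=P and \<kappa>=0
          and N="\<lambda>n a b. (transpose Kp *v a + b) \<bullet> (\<Psi> *v (transpose Kp *v a + b))", OF \<Psi> stab]) (use
              f in auto)
  have "(q \<circ> r) = (\<lambda>n. (A (r n), S (r n), \<Gamma> (r n)))" by (auto simp: A_def S_def \<Gamma>_def)
  then have "(q \<circ> r) \<longlonglongrightarrow> (A', S', G')" using r(3-5) by (simp add: tendsto_Pair)
  then show "\<exists>l\<in>feasible_set \<Lambda> F H Kp \<Psi> P. \<exists>r. strict_mono r \<and> (q \<circ> r) \<longlonglongrightarrow> l" using r(1,2) by blast
qed

lemma objective_attains_max:
  assumes \<Psi>: "pos_def \<Psi>" and stab: "spectral_radius (F - Kp ** H) < 1" and P: "0 \<le> P"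
  obtains q where "q \<in> feasible_set \<Lambda> F H Kp \<Psi> P"
    "\<And>q'. q' \<in> feasible_set \<Lambda> F H Kp \<Psi> P \<Longrightarrow> objective \<Lambda> H \<Psi> q' \<le> objective \<Lambda> H \<Psi> q"
proof -
  let ?S = "feasible_set \<Lambda> F H Kp \<Psi> P"
  \<comment> \<open>No input and no tracking error: the matrix inequality says that the noise term
    is nonnegative, and the trace constraint that P is.\<close>
  have "(0, 0, 0) \<in> ?S"
    unfolding feasible_set_iff[OF \<Psi>] using P pos_def_psd[OF \<Psi>]
    by (auto simp: joint_form_def trace_def psd_def transpose_def vec_eq_iff)
  then have ne: "?S \<noteq> {}" by auto
  have "continuous_on ?S (objective \<Lambda> H \<Psi>)"
    unfolding continuous_on_def
  proof
    fix q assume q: "q \<in> ?S"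
    have "((\<lambda>x. Psi_Y \<Lambda> H \<Psi> (fst x, fst (snd x), snd (snd x))) \<longlongrightarrow> Psi_Y \<Lambda> H \<Psi> (fst q, fst (snd q),
        snd (snd q))) (at q within ?S)"
      by (intro tendsto_Psi_Y tendsto_intros)
    then have "((\<lambda>x. det (Psi_Y \<Lambda> H \<Psi> x)) \<longlongrightarrow> det (Psi_Y \<Lambda> H \<Psi> q)) (at q within ?S)"
      by (intro tendsto_det) simp
    moreover have "0 < det (Psi_Y \<Lambda> H \<Psi> q)"
      using pos_def_det[OF pos_def_Psi_Y_feasible[OF \<Psi>, of "fst q" "fst (snd q)" "snd (snd q)"]] q by simp
    ultimately show "(objective \<Lambda> H \<Psi> \<longlongrightarrow> objective \<Lambda> H \<Psi> q) (at q within ?S)"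
      unfolding objective_def[abs_def] log_def by (intro tendsto_intros) auto
  qed
  from continuous_attains_sup[OF compact_feasible_set[OF \<Psi> stab] ne this]
  show thesis using that by blast
qed

text \<open>The state and noise equations hold on the sample space only, so replacing z by a
  function of the innovations is justified pointwise there.\<close>

lemma feedback_code_cong:
  assumes "\<And>t \<omega>. \<omega> \<in> space M \<Longrightarrow> z t \<omega> = z' t \<omega>"
  shows "feedback_code M \<Lambda> z P n N f g = feedback_code M \<Lambda> z' P n N f g"
    "error_prob M \<Lambda> z n N f g = error_prob M \<Lambda> z' n N f g"
proof -
  have 1: "(\<lambda>t. z t \<omega>) = (\<lambda>t. z' t \<omega>)" if "(m, \<omega>) \<in> space (message_noise_space N M)" for m \<omega>
    using that assms by (auto simp: message_noise_space_def space_pair_measure)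
  have "(\<integral>\<^sup>+(m, \<omega>). ennreal (let x = channel_input \<Lambda> (f m) (\<lambda>t. z t \<omega>) i in x \<bullet> x) \<partial>message_noise_space N M)
    = (\<integral>\<^sup>+(m, \<omega>). ennreal (let x = channel_input \<Lambda> (f m) (\<lambda>t. z' t \<omega>) i in x \<bullet> x)
        \<partial>message_noise_space N M)" for i
    by (intro nn_integral_cong) (auto simp: 1)
  then show "feedback_code M \<Lambda> z P n N f g = feedback_code M \<Lambda> z' P n N f g"
    unfolding feedback_code_def by simp
  have "{(m, \<omega>) \<in> space (message_noise_space N M). g (outputs \<Lambda> (f m) (\<lambda>t. z t \<omega>) n) \<noteq> m}
      = {(m, \<omega>) \<in> space (message_noise_space N M). g (outputs \<Lambda> (f m) (\<lambda>t. z' t \<omega>) n) \<noteq> m}"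
    using 1 by auto
  then show "error_prob M \<Lambda> z n N f g = error_prob M \<Lambda> z' n N f g"
    unfolding error_prob_def by simp
qed

lemma gaussian_vector_square_integrable:
  assumes "gaussian_vector M X" "integral\<^sup>L M X = 0"
  shows "square_integrable M X"
  using assms gaussian_vector_char(1)[OF assms] by (intro square_integrableI) (auto simp: gaussian_vector_def)

lemma integral_Pair_0:
  assumes "integral\<^sup>L M (X :: 'a \<Rightarrow> 'b::euclidean_space) = 0" "integral\<^sup>L M (Y :: 'a \<Rightarrow>
      'c::euclidean_space) = 0"
  shows "(\<integral>\<omega>. (X \<omega>, Y \<omega>) \<partial>M) = 0"
proof (cases "integrable M (\<lambda>\<omega>. (X \<omega>, Y \<omega>))")
  case True
  show ?thesis
    using integral_bounded_linear[OF bounded_linear_fst True] integral_bounded_linear[OF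
        bounded_linear_snd True] assms
    by (simp add: prod_eq_iff)
qed (simp add: not_integrable_integral_eq)

lemma char_gaussian_vector:
  fixes X :: "'a \<Rightarrow> real^'n"
  assumes "gaussian_vector M X" and mean: "integral\<^sup>L M X = 0"
  shows "(CLINT \<omega>|M. iexp (t \<bullet> X \<omega>)) = exp (- (t \<bullet> (cov_matrix M X *v t)) / 2)"
proof -
  note s = gaussian_vector_square_integrable[OF assms]
  have "(\<integral>\<omega>. (t \<bullet> X \<omega>)\<^sup>2 \<partial>M) = t \<bullet> (cov_matrix M X *v t)"
    using inner_cross_moment[OF s s, of t t] by (simp add: cov_matrix_def mean power2_eq_square)
  then show ?thesis using gaussian_vector_char(3)[OF assms, of t] by simp
qed

lemma char_gaussian_pair:
  fixes X :: "'a \<Rightarrow> real^'n" and Y :: "'a \<Rightarrow> real^'m"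
  assumes G: "gaussian_vector M (\<lambda>\<omega>. (X \<omega>, Y \<omega>))" and mean: "integral\<^sup>L M X = 0" "integral\<^sup>L M Y = 0"
  shows "(CLINT \<omega>|M. iexp ((a, b) \<bullet> (X \<omega>, Y \<omega>))) =
    exp (- (a \<bullet> (cov_matrix M X *v a) + 2 * (a \<bullet> (cross_moment M X Y *v b)) + b \<bullet> (cov_matrix M Y *v b)) / 2)"
proof -
  note m0 = integral_Pair_0[OF mean]
  have XY: "(\<lambda>\<omega>. (X \<omega>, Y \<omega>)) \<in> borel_measurable M" using G by (simp add: gaussian_vector_def)
  have s: "square_integrable M X" "square_integrable M Y"
    using gaussian_vector_char(1)[OF G m0, of "(_, 0)"] gaussian_vector_char(1)[OF G m0, of "(0,
        _)"] borel_measurable_fst_snd[OF XY]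
    by (auto intro!: square_integrableI)
  have "(\<integral>\<omega>. ((a, b) \<bullet> (X \<omega>, Y \<omega>))\<^sup>2 \<partial>M) = a \<bullet> (cov_matrix M X *v a) + 2 * (a \<bullet> (cross_moment M X Y
      *v b)) + b \<bullet> (cov_matrix M Y *v b)"
    using joint_form_moments[OF s(2,1), of b a] by (simp add: joint_form_def cov_matrix_def mean
        add.commute add.left_commute)
  then show ?thesis using gaussian_vector_char(3)[OF G m0, of "(a, b)"] by (simp only:)
qed

text \<open>The maximum is expressed by a feasible point q that attains it. The concavity statement,
  which includes convexity of the feasible set, says that the problem is a convex
  optimization.\<close>

theorem lemma5:
  fixes M :: "'a measure"
    and \<Lambda> :: "real^'m^'p" and F :: "real^'d^'d" and G :: "real^'q^'d" and H :: "real^'d^'p"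
    and W :: "real^'q^'q" and V :: "real^'p^'p" and L :: "real^'p^'q"
    and \<Sigma>1 \<Sigma> :: "real^'d^'d" and Kp :: "real^'p^'d" and \<Psi> :: "real^'p^'p"
    and s :: "nat \<Rightarrow> 'a \<Rightarrow> real^'d" and w :: "nat \<Rightarrow> 'a \<Rightarrow> real^'q"
    and v z :: "nat \<Rightarrow> 'a \<Rightarrow> real^'p"
    and P :: real
  assumes "prob_space M"
    and state: "\<And>i \<omega>. \<omega> \<in> space M \<Longrightarrow> s (Suc i) \<omega> = F *v s i \<omega> + G *v w i \<omega>"
    and noise: "\<And>i \<omega>. \<omega> \<in> space M \<Longrightarrow> z i \<omega> = H *v s i \<omega> + v i \<omega>"
    and "iid M (\<lambda>i \<omega>. (w i \<omega>, v i \<omega>))"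
    and "\<And>i. gaussian_vector M (\<lambda>\<omega>. (w i \<omega>, v i \<omega>))"
    and "\<And>i. integral\<^sup>L M (w i) = 0" and "\<And>i. integral\<^sup>L M (v i) = 0"
    and "\<And>i. cov_matrix M (w i) = W" and "\<And>i. cov_matrix M (v i) = V"
    and "\<And>i. cross_moment M (w i) (v i) = L"
    and "gaussian_vector M (s 0)" and "integral\<^sup>L M (s 0) = 0" and "cov_matrix M (s 0) = \<Sigma>1"
    and "indep_rv M borel (s 0) (Pi\<^sub>M UNIV (\<lambda>_. borel)) (\<lambda>\<omega> i. (w i \<omega>, v i \<omega>))"
    and "\<And>i. pos_def (innov_cov H V (riccati_seq F G H W V L \<Sigma>1 i))"
    and "invertible V"
    and "detectable F H"
    and "unit_circle_controllable
           (F - G ** L ** matrix_inv V ** H)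
           (G ** W ** transpose G - G ** L ** matrix_inv V ** transpose L ** transpose G)"
    and "stabilizing_solution F G H W V L \<Sigma>"
    and "riccati_seq F G H W V L \<Sigma>1 \<longlonglongrightarrow> \<Sigma>"
    and "Kp = predictor_gain F G H V L \<Sigma>" and "\<Psi> = innov_cov H V \<Sigma>"
    and "0 \<le> P"
  shows "concave_on (feasible_set \<Lambda> F H Kp \<Psi> P) (objective \<Lambda> H \<Psi>) \<and>
    (\<exists>q \<in> feasible_set \<Lambda> F H Kp \<Psi> P.
       (\<forall>q' \<in> feasible_set \<Lambda> F H Kp \<Psi> P. objective \<Lambda> H \<Psi> q' \<le> objective \<Lambda> H \<Psi> q) \<and>
       feedback_capacity M \<Lambda> z P \<le> ereal (objective \<Lambda> H \<Psi> q))"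
proof -
  note [simp del] = transpose_matrix_vector
  interpret prob_space M by fact
  define S where "S = riccati_seq F G H W V L \<Sigma>1"
  define \<Psi>i where "\<Psi>i i = innov_cov H V (S i)" for i
  define K where "K i = predictor_gain F G H V L (S i)" for i
  define e where "e i \<omega> = innovation F G H K (s 0 \<omega>) (\<lambda>i. w i \<omega>) (\<lambda>i. v i \<omega>) i" for i \<omega>
  have symm: "transpose \<Sigma>1 = \<Sigma>1" "transpose W = W" "transpose V = V"
    unfolding assms(13)[symmetric] assms(8)[of 0, symmetric] assms(9)[of 0, symmetric]
        cov_matrix_def by (rule cross_moment_symmetric)+
  have pos: "pos_def (\<Psi>i i)" for i using assms(15)[of i] by (simp add: \<Psi>i_def S_def)
  have charx: "(CLINT \<omega>|M. iexp (t \<bullet> s 0 \<omega>)) = exp (- (t \<bullet> (\<Sigma>1 *v t)) / 2)" for t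
    using char_gaussian_vector[OF assms(11,12), of t] assms(13) by simp
  have charu: "(CLINT \<omega>|M. iexp ((a, b) \<bullet> (w 0 \<omega>, v 0 \<omega>))) = exp (- (a \<bullet> (W *v a) + 2 * (a \<bullet> (L *v
      b)) + b \<bullet> (V *v b)) / 2)" for a b
    using char_gaussian_pair[OF assms(5)[of 0] assms(6)[of 0] assms(7)[of 0], of a b] assms(8)[of 0]
        assms(9)[of 0] assms(10)[of 0] by simp
  note inn = innovations_distr[OF assms(1) assms(4) assms(14) symm assms(15) charx charu]
  interpret innovations M e \<Psi>i
  proof
    show "e i \<in> borel_measurable M" for i
      using inn(2)[of i] by (simp add: e_def[abs_def] K_def[abs_def] S_def)
    show "pos_def (\<Psi>i i)" for i by (rule pos)
    show "distr M (Pi\<^sub>M {..<n} (\<lambda>_. borel)) (\<lambda>\<omega>. \<lambda>i\<in>{..<n}. e i \<omega>) = Pi\<^sub>M {..<n} (\<lambda>i. density lborel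
        (\<lambda>x. ennreal (mvn_density (\<Psi>i i) x)))" for n
      using inn(1)[of n] by (simp add: e_def[abs_def] K_def[abs_def] S_def \<Psi>i_def[abs_def])
  qed
  have zeq: "z i \<omega> = noise_of F H K (\<lambda>i. e i \<omega>) i" if "\<omega> \<in> space M" for i \<omega>
    unfolding noise[OF that] e_def[abs_def]
    by (rule noise_of_innovation[of "\<lambda>i. s i \<omega>"]) (rule state[OF that])
  have Slim: "S \<longlonglongrightarrow> \<Sigma>" using assms(20) by (simp add: S_def)
  have stab: "transpose \<Sigma> = \<Sigma>" "invertible \<Psi>" "\<Sigma> = riccati_step F G H W V L \<Sigma>" "spectral_radius (F -
      Kp ** H) < 1"
    using assms(19) unfolding stabilizing_solution_def assms(21)[symmetric] assms(22)[symmetric] by blast+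
  have \<Psi>lim: "\<Psi>i \<longlonglongrightarrow> \<Psi>"
    unfolding \<Psi>i_def assms(22) by (rule tendsto_innov_cov[OF Slim])
  \<comment> \<open>A limit of positive definite matrices is in general just semidefinite; the
    invertibility contained in \<open>stabilizing_solution\<close> closes the gap.\<close>
  have \<Psi>: "pos_def \<Psi>"
  proof (rule psd_invertible_pos_def[OF _ stab(2)])
    have "0 \<le> x \<bullet> (\<Psi> *v x)" for x
      by (rule LIMSEQ_le_const[OF tendsto_inner_matrix[OF \<Psi>lim]]) (use pos_def_psd[OF pos] in \<open>auto
          simp: psd_def\<close>)
    then show "psd \<Psi>"
      unfolding psd_def using symmetric_limit[OF \<Psi>lim] pos by (auto simp: pos_def_def)
  qed
  \<comment> \<open>The gains enter the noise term through two products, with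
    \<open>\<Psi>i i\<close> once and with the transposed gain on the other side as well. The first
    is affine in the current Riccati iterate, the second, by the recursion, in two consecutive ones.
    So the limits follow without continuity of the matrix inverse.\<close>
  have Kpsi: "K i ** \<Psi>i i = F ** S i ** transpose H + G ** L" for i
    unfolding K_def predictor_gain_def \<Psi>i_def[symmetric]
    by (simp add: matrix_mul_assoc[symmetric] matrix_inv_mult[OF pos_def_invertible[OF pos]])
  have Kpsi': "Kp ** \<Psi> = F ** \<Sigma> ** transpose H + G ** L"
    unfolding assms(21) predictor_gain_def assms(22)[symmetric]
    by (simp add: matrix_mul_assoc[symmetric] matrix_inv_mult[OF stab(2)])
  have KK: "K i ** \<Psi>i i ** transpose (K i) = F ** S i ** transpose F + G ** W ** transpose G - S
      (Suc i)" for i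
    by (simp add: S_def K_def \<Psi>i_def riccati_step_def)
  have KK': "Kp ** \<Psi> ** transpose Kp = F ** \<Sigma> ** transpose F + G ** W ** transpose G - \<Sigma>"
    using stab(3) unfolding riccati_step_def assms(21)[symmetric] assms(22)[symmetric] by (simp add:
        algebra_simps)
  have Klim: "(\<lambda>i. K i ** \<Psi>i i) \<longlonglongrightarrow> Kp ** \<Psi>"
    unfolding Kpsi Kpsi' by (intro tendsto_add tendsto_matrix_mult tendsto_const Slim)
  have KKlim: "(\<lambda>i. K i ** \<Psi>i i ** transpose (K i)) \<longlonglongrightarrow> Kp ** \<Psi> ** transpose Kp"
    unfolding KK KK' by (intro tendsto_add tendsto_diff tendsto_matrix_mult tendsto_const Slim LIMSEQ_Suc)
  define \<nu> where "\<nu> i a b = (transpose (K i) *v a + b) \<bullet> (\<Psi>i i *v (transpose (K i) *v a + b))" for i a b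
  have form: "(transpose k *v a + b) \<bullet> (A *v (transpose k *v a + b)) = a \<bullet> ((k ** A ** transpose k)
      *v a) + 2 * (a \<bullet> ((k ** A) *v b)) + b \<bullet> (A *v b)"
    if "transpose A = A" for k :: "real^'p^'d" and A :: "real^'p^'p" and a b
  proof -
    have "b \<bullet> (A *v (transpose k *v a)) = (transpose k *v a) \<bullet> (A *v b)"
      by (metis that inner_commute inner_matrix_vector)
    then show ?thesis
      by (simp add: matrix_vector_right_distrib inner_add_left inner_add_right
          matrix_vector_mul_assoc[symmetric] inner_transpose_matrix)
  qed
  have \<Psi>sym: "transpose \<Psi> = \<Psi>" "transpose (\<Psi>i i) = \<Psi>i i" for i using \<Psi> pos[of i] by (auto simp: pos_def_def)
  have \<nu>lim: "(\<lambda>i. \<nu> i a b) \<longlonglongrightarrow> (transpose Kp *v a + b) \<bullet> (\<Psi> *v (transpose Kp *v a + b))" for a b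
    unfolding \<nu>_def form[OF \<Psi>sym(1)] form[OF \<Psi>sym(2)]
    by (intro tendsto_intros tendsto_inner_matrix KKlim Klim \<Psi>lim)
  \<comment> \<open>As a quadratic form this is
    \<open>(K i - Kp) ** \<Psi>i i ** transpose (K i - Kp)\<close> with its two cross terms merged
    into one. Its boundedness supplies the constant \<open>\<kappa>\<close>.\<close>
  define T where "T i = K i ** \<Psi>i i ** transpose (K i) - 2 *\<^sub>R (K i ** \<Psi>i i ** transpose Kp) + Kp **
      \<Psi>i i ** transpose Kp" for i
  have \<nu>T: "\<nu> i a (- (transpose Kp *v a)) = a \<bullet> (T i *v a)" for i a
    unfolding \<nu>_def form[OF \<Psi>sym(2)] T_def
    by (simp add: matrix_vector_mult_add_rdistrib matrix_vector_mult_diff_rdistrib inner_add_right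
        inner_diff_right scaleR_matrix_vector_assoc[symmetric]
        matrix_vector_mul_assoc[symmetric] inner_transpose_matrix linear_neg[OF matrix_vector_mul_linear])
  have "T \<longlonglongrightarrow> Kp ** \<Psi> ** transpose Kp - 2 *\<^sub>R (Kp ** \<Psi> ** transpose Kp) + Kp ** \<Psi> ** transpose Kp"
    unfolding T_def by (intro tendsto_add tendsto_diff tendsto_scaleR tendsto_matrix_mult
        tendsto_const KKlim Klim \<Psi>lim)
  then have "Bseq T" using convergent_imp_Bseq convergentI by blast
  then obtain c where c: "\<And>i. norm (T i) \<le> c" unfolding Bseq_def by blast
  \<comment> \<open>The expression under the root is the bound of
    \<open>inner_matrix_le_entries\<close> for a form whose entries are at most c. The root is taken
    because \<open>feasible_limit\<close> compares square roots of quadratic forms.\<close>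
  define \<kappa> where "\<kappa> = sqrt (CARD('d) * (CARD('d) * c))"
  have c0: "0 \<le> c" using c[of 0] norm_ge_zero[of "T 0"] by linarith
  have \<kappa>: "0 \<le> \<kappa>" "\<kappa>\<^sup>2 = CARD('d) * (CARD('d) * c)" using c0 by (simp_all add: \<kappa>_def)
  have \<nu>b: "\<nu> i a (- (transpose Kp *v a)) \<le> \<kappa>\<^sup>2 * (norm a)\<^sup>2" for i a
    unfolding \<nu>T \<kappa>(2)
  proof (rule inner_matrix_le_entries)
    fix j k
    have "\<bar>T i $ j $ k\<bar> \<le> norm (T i $ j)" by (rule component_le_norm_cart)
    also have "\<dots> \<le> norm (T i)" by (rule Finite_Cartesian_Product.norm_nth_le)
    finally show "\<bar>T i $ j $ k\<bar> \<le> c" using c[of i] by linarith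
  qed
  obtain q where q: "q \<in> feasible_set \<Lambda> F H Kp \<Psi> P"
    "\<And>q'. q' \<in> feasible_set \<Lambda> F H Kp \<Psi> P \<Longrightarrow> objective \<Lambda> H \<Psi> q' \<le> objective \<Lambda> H \<Psi> q"
    using objective_attains_max[OF \<Psi> stab(4) assms(23)] by blast
  have "R \<le> objective \<Lambda> H \<Psi> q" if ach: "achievable M \<Lambda> z P R" for R
  proof -
    obtain f g where R: "0 \<le> R"
      and code: "\<And>n. 1 \<le> n \<Longrightarrow> feedback_code M \<Lambda> z P n (num_messages n R) (f n) (g n)"
      and err0: "(\<lambda>n. error_prob M \<Lambda> z n (num_messages n R) (f n) (g n)) \<longlonglongrightarrow> 0"
      using ach unfolding achievable_def by blast
    let ?N = "\<lambda>n. num_messages n R"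
    let ?z = "\<lambda>t \<omega>. noise_of F H K (\<lambda>i. e i \<omega>) t"
    let ?err = "\<lambda>n. error_prob M \<Lambda> z n (?N n) (f n) (g n)"
    have Npow: "2 powr (real n * R) \<le> real (?N n)" for n
      unfolding num_messages_def by linarith
    have N1: "1 \<le> ?N n" for n
    proof -
      have "1 \<le> 2 powr (real n * R)" using R by (simp add: ge_one_powr_ge_zero)
      then have "1 \<le> real (?N n)" using Npow[of n] by linarith
      then show ?thesis by simp
    qed
    \<comment> \<open>Block lengths are written \<open>Suc n\<close>, so that
      \<open>converse_bound\<close>, which needs a positive length, applies for every n.\<close>
    have "\<exists>A S \<Gamma>. transpose A = A \<and> transpose S = S \<and> (\<forall>\<alpha> \<beta>. 0 \<le> joint_form A S \<Gamma> \<alpha> \<beta>) \<and> trace A \<le> P \<and>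
      (\<forall>a b. a \<bullet> (S *v a) \<le> joint_form A S \<Gamma> (transpose F *v a + transpose H *v b) (transpose \<Lambda> *v
          b) + 1 / Suc n * (\<Sum>i<Suc n. \<nu> i a b)) \<and>
      (1 - ?err (Suc n)) * ln (?N (Suc n)) \<le> Suc n * (ln (det (Psi_Y \<Lambda> H ((1 / Suc n) *\<^sub>R (\<Sum>i<Suc n.
          \<Psi>i i)) (A, S, \<Gamma>))) / 2) - (\<Sum>i<Suc n. ln (det (\<Psi>i i))) / 2 + 1" for n
    proof -
      have code': "feedback_code M \<Lambda> ?z P (Suc n) (?N (Suc n)) (f (Suc n)) (g (Suc n))"
        by (rule iffD1[OF feedback_code_cong(1)[OF zeq] code]) simp_all
      have err': "?err (Suc n) = error_prob M \<Lambda> ?z (Suc n) (?N (Suc n)) (f (Suc n)) (g (Suc n))"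
        by (rule feedback_code_cong(2)[OF zeq])
      show ?thesis
        unfolding err' \<nu>_def by (rule converse_bound[OF code' zero_less_Suc N1 assms(23)]) blast
    qed
    then obtain A Sc \<Gamma> where sym: "\<And>n. transpose (A n) = A n" "\<And>n. transpose (Sc n) = Sc n"
      and nn: "\<And>n \<alpha> \<beta>. 0 \<le> joint_form (A n) (Sc n) (\<Gamma> n) \<alpha> \<beta>" and tr: "\<And>n. trace (A n) \<le> P"
      and lmi: "\<And>n a b. a \<bullet> (Sc n *v a) \<le> joint_form (A n) (Sc n) (\<Gamma> n) (transpose F *v a +
          transpose H *v b) (transpose \<Lambda> *v b) + 1 / Suc n * (\<Sum>i<Suc n. \<nu> i a b)"
      and bnd: "\<And>n. (1 - ?err (Suc n)) * ln (?N (Suc n)) \<le> Suc n * (ln (det (Psi_Y \<Lambda> H ((1 / Suc n)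
          *\<^sub>R (\<Sum>i<Suc n. \<Psi>i i)) (A n, Sc n, \<Gamma> n))) / 2) - (\<Sum>i<Suc n. ln (det (\<Psi>i i))) / 2 + 1"
      by metis
    have Nlim: "(\<lambda>n. 1 / Suc n * (\<Sum>i<Suc n. \<nu> i a b)) \<longlonglongrightarrow> (transpose Kp *v a + b) \<bullet> (\<Psi> *v (transpose
        Kp *v a + b))" for a b
      using cesaro[OF \<nu>lim[of a b]] by simp
    have Nb: "1 / Suc n * (\<Sum>i<Suc n. \<nu> i a (- (transpose Kp *v a))) \<le> \<kappa>\<^sup>2 * (norm a)\<^sup>2" for n a
    proof -
      have "(\<Sum>i<Suc n. \<nu> i a (- (transpose Kp *v a))) \<le> (\<Sum>i<Suc n. \<kappa>\<^sup>2 * (norm a)\<^sup>2)"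
        by (intro sum_mono \<nu>b)
      then show ?thesis by (simp add: field_simps)
    qed
    \<comment> \<open>The averaged moments of one code satisfy the constraints only approximately.
      Along a subsequence they converge to an exactly feasible point, which is all that is needed
      since the bound on R passes to the limit.\<close>
    obtain r A' S' G' where r: "strict_mono r" and feas: "(A', S', G') \<in> feasible_set \<Lambda> F H Kp \<Psi> P"
      and lim: "(\<lambda>n. A (r n)) \<longlonglongrightarrow> A'" "(\<lambda>n. Sc (r n)) \<longlonglongrightarrow> S'" "(\<lambda>n. \<Gamma> (r n)) \<longlonglongrightarrow> G'"
      by (rule feasible_limit[where P=A and S=Sc and \<Gamma>=\<Gamma> and \<Lambda>=\<Lambda> and c=P and \<kappa>=\<kappa>
          and N="\<lambda>n a b. 1 / Suc n * (\<Sum>i<Suc n. \<nu> i a b)", OF \<Psi> stab(4) sym nn tr lmi Nlim Nb \<kappa>(1)])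
    let ?d = "\<lambda>n. ln (det (Psi_Y \<Lambda> H ((1 / Suc n) *\<^sub>R (\<Sum>i<Suc n. \<Psi>i i)) (A n, Sc n, \<Gamma> n)))"
    have dpos: "0 < det (Psi_Y \<Lambda> H \<Psi> (A', S', G'))" by (rule pos_def_det[OF
        pos_def_Psi_Y_feasible[OF \<Psi> feas]])
    have avg\<Psi>: "(\<lambda>n. (1 / Suc n) *\<^sub>R (\<Sum>i<Suc n. \<Psi>i i)) \<longlonglongrightarrow> \<Psi>" by (rule cesaro[OF \<Psi>lim])
    have dlim: "(\<lambda>n. ?d (r n)) \<longlonglongrightarrow> ln (det (Psi_Y \<Lambda> H \<Psi> (A', S', G')))"
      using dpos by (intro tendsto_ln tendsto_det tendsto_Psi_Y lim LIMSEQ_subseq_LIMSEQ[OF avg\<Psi> r,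
          unfolded o_def]) simp
    have "(\<lambda>i. ln (det (\<Psi>i i))) \<longlonglongrightarrow> ln (det \<Psi>)"
      using pos_def_det[OF \<Psi>] by (intro tendsto_ln tendsto_det \<Psi>lim) simp
    from LIMSEQ_subseq_LIMSEQ[OF cesaro[OF this] r]
    have plim: "(\<lambda>n. (1 / Suc (r n)) *\<^sub>R (\<Sum>i<Suc (r n). ln (det (\<Psi>i i)))) \<longlonglongrightarrow> ln (det \<Psi>)" by (simp add: o_def)
    have ilim: "(\<lambda>n. 1 / real (Suc (r n))) \<longlonglongrightarrow> 0"
      using LIMSEQ_subseq_LIMSEQ[OF LIMSEQ_Suc[OF lim_1_over_n] r] by (simp add: o_def)
    have elim: "(\<lambda>n. ?err (Suc (r n))) \<longlonglongrightarrow> 0"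
      using LIMSEQ_subseq_LIMSEQ[OF LIMSEQ_Suc[OF err0] r] by (simp add: o_def)
    \<comment> \<open>The converse divided by the block length. The number of messages is at least
      \<open>2 powr (real (Suc n) * R)\<close>, and the last summand is the additive 1 from
      \<open>mult_ln_card_le\<close>.\<close>
    have le: "(1 - ?err (Suc n)) * (R * ln 2) \<le> ?d n / 2 - ((1 / Suc n) *\<^sub>R (\<Sum>i<Suc n. ln (det (\<Psi>i
        i)))) / 2 + 1 / Suc n" for n
    proof -
      have "?err (Suc n) \<le> 1"
        unfolding error_prob_def by (rule prob_space.prob_le_1[OF prob_space_message_noise[OF assms(1) N1]])
      moreover have "real (Suc n) * R * ln 2 \<le> ln (real (?N (Suc n)))"
      proof -
        have "ln (2 powr (real (Suc n) * R)) \<le> ln (real (?N (Suc n)))"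
          by (intro ln_mono Npow) simp
        then show ?thesis by (simp add: ln_powr)
      qed
      ultimately have "(1 - ?err (Suc n)) * (real (Suc n) * R * ln 2) \<le> (1 - ?err (Suc n)) * ln
          (real (?N (Suc n)))"
        by (intro mult_left_mono) auto
      with bnd[of n] have "(1 - ?err (Suc n)) * (real (Suc n) * R * ln 2) \<le> Suc n * (?d n / 2) -
          (\<Sum>i<Suc n. ln (det (\<Psi>i i))) / 2 + 1" by linarith
      then have "(1 - ?err (Suc n)) * (real (Suc n) * R * ln 2) / Suc n \<le> (Suc n * (?d n / 2) -
          (\<Sum>i<Suc n. ln (det (\<Psi>i i))) / 2 + 1) / Suc n"
        by (rule divide_right_mono) simp
      moreover have "(1 - ?err (Suc n)) * (real (Suc n) * R * ln 2) / Suc n = (1 - ?err (Suc n)) * (R * ln 2)"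
        by (simp del: of_nat_Suc)
      moreover have "(Suc n * (?d n / 2) - (\<Sum>i<Suc n. ln (det (\<Psi>i i))) / 2 + 1) / Suc n = ?d n / 2 -
          ((1 / Suc n) *\<^sub>R (\<Sum>i<Suc n. ln (det (\<Psi>i i)))) / 2 + 1 / Suc n"
        by (simp add: add_divide_distrib diff_divide_distrib del: of_nat_Suc sum.lessThan_Suc)
      ultimately show ?thesis by (simp only:)
    qed
    have "(1 - 0) * (R * ln 2) \<le> ln (det (Psi_Y \<Lambda> H \<Psi> (A', S', G'))) / 2 - ln (det \<Psi>) / 2 + 0"
    proof (rule LIMSEQ_le)
      show "(\<lambda>n. (1 - ?err (Suc (r n))) * (R * ln 2)) \<longlonglongrightarrow> (1 - 0) * (R * ln 2)"
        by (intro tendsto_intros elim)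
      show "(\<lambda>n. ?d (r n) / 2 - ((1 / Suc (r n)) *\<^sub>R (\<Sum>i<Suc (r n). ln (det (\<Psi>i i)))) / 2 + 1 / Suc (r n))
        \<longlonglongrightarrow> ln (det (Psi_Y \<Lambda> H \<Psi> (A', S', G'))) / 2 - ln (det \<Psi>) / 2 + 0"
        by (intro tendsto_add tendsto_diff tendsto_divide tendsto_const dlim plim ilim) simp_all
    qed (use le in blast)
    then have "R \<le> (ln (det (Psi_Y \<Lambda> H \<Psi> (A', S', G'))) / 2 - ln (det \<Psi>) / 2) / ln 2"
      by (simp add: pos_le_divide_eq)
    also have "\<dots> = objective \<Lambda> H \<Psi> (A', S', G')"
      by (simp add: objective_def log_def field_simps)
    also have "\<dots> \<le> objective \<Lambda> H \<Psi> q" by (rule q(2)[OF feas])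
    finally show ?thesis .
  qed
  then have "feedback_capacity M \<Lambda> z P \<le> ereal (objective \<Lambda> H \<Psi> q)"
    unfolding feedback_capacity_def by (intro SUP_least) simp
  then show ?thesis using concave_objective[OF \<Psi>] q by blast
qed

end
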